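(* Let $n\ge 3$ be an integer. If a prime graph has an induced path of length $\lceil 6.75 n^7\rceil$, then it has a vertex-minor isomorphic to the cycle $C_n$ of length $n$.
   Context: All graphs are finite, simple and undirected. The length of a path is its number of edges. For a vertex $v$ of $G$, the local complementation $G*v$ replaces the subgraph induced on the neighborhood of $v$ by its complement. A graph $H$ is a vertex-minor of $G$ if $H$ is an induced subgraph of a graph obtained from $G$ by a sequence of local complementations. A split of $G$ is a partition $(A,B)$ of $V(G)$ with $|A|,|B|\ge 2$ such that there are $A'\subseteq A$, $B'\subseteq B$ with $a\in A$ adjacent to $b\in B$ iff $a\in A'$ and $b\in B'$; $G$ is prime if it has no split. *)

theory Defs
  imports Complex_Main
begin

type_synonym 'a ugraph = "'a set \<times> 'a set set"

definition verts :: "'a ugraph \<Rightarrow> 'a set" where "verts G = fst G"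
definition edges :: "'a ugraph \<Rightarrow> 'a set set" where "edges G = snd G"

definition simple_graph :: "'a ugraph \<Rightarrow> bool" where
  "simple_graph G \<longleftrightarrow> finite (verts G) \<and> (\<forall>e\<in>edges G. e \<subseteq> verts G \<and> card e = 2)"

definition adj :: "'a ugraph \<Rightarrow> 'a \<Rightarrow> 'a \<Rightarrow> bool" where
  "adj G x y \<longleftrightarrow> {x, y} \<in> edges G"

definition nbhd :: "'a ugraph \<Rightarrow> 'a \<Rightarrow> 'a set" where
  "nbhd G v = {u \<in> verts G. adj G v u}"

definition local_comp :: "'a ugraph \<Rightarrow> 'a \<Rightarrow> 'a ugraph" where
  "local_comp G v =
     (let D = {{x, y} | x y. x \<in> nbhd G v \<and> y \<in> nbhd G v \<and> x \<noteq> y}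
      in (verts G, (edges G - D) \<union> (D - edges G)))"

definition lc_step :: "'a ugraph \<Rightarrow> 'a ugraph \<Rightarrow> bool" where
  "lc_step G G' \<longleftrightarrow> (\<exists>v \<in> verts G. G' = local_comp G v)"

definition induced_subgraph_on :: "'a ugraph \<Rightarrow> 'a set \<Rightarrow> 'a ugraph" where
  "induced_subgraph_on G X = (X, {e \<in> edges G. e \<subseteq> X})"

definition vertex_minor :: "'a ugraph \<Rightarrow> 'a ugraph \<Rightarrow> bool" where
  "vertex_minor H G \<longleftrightarrow>
     (\<exists>G'. lc_step\<^sup>*\<^sup>* G G' \<and> (\<exists>X \<subseteq> verts G'. H = induced_subgraph_on G' X))"

definition graph_iso :: "'a ugraph \<Rightarrow> 'b ugraph \<Rightarrow> bool" where
  "graph_iso G H \<longleftrightarrow> (\<exists>f. bij_betw f (verts G) (verts H) \<and>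
     (\<forall>x \<in> verts G. \<forall>y \<in> verts G. adj G x y \<longleftrightarrow> adj H (f x) (f y)))"

definition has_split :: "'a ugraph \<Rightarrow> bool" where
  "has_split G \<longleftrightarrow> (\<exists>A B. A \<union> B = verts G \<and> A \<inter> B = {} \<and> card A \<ge> 2 \<and> card B \<ge> 2 \<and>
     (\<exists>A' \<subseteq> A. \<exists>B' \<subseteq> B. \<forall>a \<in> A. \<forall>b \<in> B. adj G a b \<longleftrightarrow> (a \<in> A' \<and> b \<in> B')))"

definition prime_graph :: "'a ugraph \<Rightarrow> bool" where
  "prime_graph G \<longleftrightarrow> \<not> has_split G"

definition has_induced_path :: "'a ugraph \<Rightarrow> nat \<Rightarrow> bool" where
  "has_induced_path G L \<longleftrightarrow> (\<exists>p :: 'a list. length p = L + 1 \<and> distinct p \<and> set p \<subseteq> verts G \<and>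
     (\<forall>i < length p. \<forall>j < length p. adj G (p ! i) (p ! j) \<longleftrightarrow> (i = j + 1 \<or> j = i + 1)))"

definition cycle_graph :: "nat \<Rightarrow> nat ugraph" where
  "cycle_graph n = ({0..<n}, {{i, (i + 1) mod n} | i. i < n})"

end

theory Submission
  imports Defs
begin

text \<open>Suppose that no vertex-minor is a cycle \<open>C\<^sub>n\<close>, \<open>n \<ge> 4\<close>, and let \<open>X\<close> and \<open>Y\<close> be the first and
  the last edge of the long induced path. A connecting path from \<open>X\<close> to \<open>Y\<close> is still long: a vertex
  with many neighbours on the induced path yields \<open>C\<^sub>n\<close> from a fan, and a long gap between the
  vertices seen by the connecting path yields a long induced cycle.

  Primeness says that no separation of cut-rank at most one has \<open>X\<close> on one side and \<open>Y\<close> on the other.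
  Take a set \<open>H\<close> of vertices containing \<open>X\<close> and \<open>Y\<close> that is minimal with this property, a shortest path
  \<open>q\<close> through \<open>H\<close>, and a shortest augmenting path \<open>us\<close> with respect to \<open>q\<close>. Minimality forces \<open>H\<close> to
  consist of \<open>q\<close> and \<open>us\<close>, and makes every place where \<open>us\<close> jumps forward along \<open>q\<close> a vertex separator
  of size two. Jumps are short, since otherwise there is a long induced cycle, so there are many such
  separators. Every vertex between them can be removed, possibly after a local complementation at it,
  without creating a separation of rank one. What remains is a sequence of pairs of vertices, each
  joined to the next by a matrix of rank two.

  Such a graph is a ladder, given by a word in three letters. Local complementations rewrite the word,
  and a long word can be rewritten to one with a long factor between two consecutive rungs; this factor is a
  long induced cycle, which local complementations shorten to \<open>C\<^sub>n\<close>.\<close>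

text \<open>\<open>X\<close> and \<open>Y\<close> are edges because a side of a split has at least
  two vertices: every separation of rank one between two disjoint edges is a split. The obstacle is
  that a vertex can always be removed without creating a separation of rank one, but whether it must
  first be complemented is not ours to choose, so adjacencies get out of control. What survives
  every choice is nonadjacency across a separator containing no removed vertex. Hence all separators
  are found first, and only then are the vertices between them removed. Constants:
  \<open>(n - 1) * (n - 1) + 2 * n + 3\<close> runs of fewer than \<open>n\<close> letters have at
  most \<open>n ^ 3 + 4 * n\<close> letters. A separator contributes two letters, so
  \<open>n ^ 3\<close> separators suffice. They are found at thresholds spaced by \<open>n\<close>
  along \<open>q\<close>, so \<open>q\<close> has at most about \<open>n ^ 4 + 2 * n\<close>
  vertices. Each of them sees at most \<open>3 * n + 2\<close> vertices of the given path, and the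
  seen vertices are at most \<open>n\<close> apart, so its length is below
  \<open>n * ((3 * n + 2) * (n ^ 4 + 2 * n))\<close>, which is at most \<open>6 * n ^ 7\<close>. The
  word arguments need \<open>n \<ge> 4\<close>; a triangle is found directly.\<close>

section \<open>Local equivalence and vertex-minors of adjacency relations\<close>

definition lcE :: "('a \<Rightarrow> 'a \<Rightarrow> bool) \<Rightarrow> 'a \<Rightarrow> 'a \<Rightarrow> 'a \<Rightarrow> bool" where
  "lcE E v x y \<longleftrightarrow> E x y \<noteq> (E v x \<and> E v y \<and> x \<noteq> y)"

inductive lceq :: "'a set \<Rightarrow> ('a \<Rightarrow> 'a \<Rightarrow> bool) \<Rightarrow> ('a \<Rightarrow> 'a \<Rightarrow> bool) \<Rightarrow> bool" for V E where
  lceq_refl: "lceq V E E"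
| lceq_step: "lceq V E E' \<Longrightarrow> v \<in> V \<Longrightarrow> lceq V E (lcE E' v)"

text \<open>Relations live on the whole type, so taking an induced subgraph means agreement on
  \<open>V'\<close> only; values elsewhere stay arbitrary.\<close>

definition vminor :: "'a set \<Rightarrow> ('a \<Rightarrow> 'a \<Rightarrow> bool) \<Rightarrow> 'a set \<Rightarrow> ('a \<Rightarrow> 'a \<Rightarrow> bool) \<Rightarrow> bool" where
  "vminor V E V' E' \<longleftrightarrow> V' \<subseteq> V \<and> (\<exists>F. lceq V E F \<and> (\<forall>x\<in>V'. \<forall>y\<in>V'. E' x y = F x y))"

lemma lceq_trans: "lceq V F F' \<Longrightarrow> lceq V E F \<Longrightarrow> lceq V E F'"
  by (induction rule: lceq.induct) (auto intro: lceq.intros)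

text \<open>A complementation at a vertex of \<open>V'\<close> changes pairs inside
  \<open>V'\<close> according to adjacencies inside \<open>V'\<close> only, so it commutes with
  restriction to \<open>V'\<close>.\<close>

lemma lceq_lift:
  assumes "lceq V' E' F'" "V' \<subseteq> V" "\<forall>x\<in>V'. \<forall>y\<in>V'. E' x y = F x y"
  shows "\<exists>G. lceq V F G \<and> (\<forall>x\<in>V'. \<forall>y\<in>V'. F' x y = G x y)"
  using assms
proof (induction rule: lceq.induct)
  case lceq_refl
  then show ?case by (blast intro: lceq.intros)
next
  case (lceq_step E'' v)
  then obtain G where G: "lceq V F G" "\<forall>x\<in>V'. \<forall>y\<in>V'. E'' x y = G x y" by blast
  have "lceq V F (lcE G v)" using G(1) lceq_step by (blast intro: lceq.intros)
  moreover have "\<forall>x\<in>V'. \<forall>y\<in>V'. lcE E'' v x y = lcE G v x y"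
    using G(2) lceq_step(2) unfolding lcE_def by metis
  ultimately show ?case by blast
qed

lemma vminor_trans:
  assumes "vminor V E V1 E1" "vminor V1 E1 V2 E2"
  shows "vminor V E V2 E2"
proof -
  obtain F where F: "V1 \<subseteq> V" "lceq V E F" "\<forall>x\<in>V1. \<forall>y\<in>V1. E1 x y = F x y"
    using assms(1) unfolding vminor_def by blast
  obtain F1 where F1: "V2 \<subseteq> V1" "lceq V1 E1 F1" "\<forall>x\<in>V2. \<forall>y\<in>V2. E2 x y = F1 x y"
    using assms(2) unfolding vminor_def by blast
  obtain G where "lceq V F G" "\<forall>x\<in>V1. \<forall>y\<in>V1. F1 x y = G x y"
    using lceq_lift[OF F1(2) F(1,3)] by blast
  then show ?thesis unfolding vminor_def using F F1 lceq_trans[of V F G E]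
    by (metis subsetD subset_trans)
qed

lemma vminor_sub: "V' \<subseteq> V \<Longrightarrow> vminor V E V' E"
  unfolding vminor_def by (blast intro: lceq.intros)

lemma vminor_lc: "v \<in> V \<Longrightarrow> V' \<subseteq> V \<Longrightarrow> vminor V E V' (lcE E v)"
  unfolding vminor_def by (blast intro: lceq.intros)

subsection \<open>Ladders as words\<close>

text \<open>A letter \<open>La\<close> (\<open>Lb\<close>) moves the first (second) of two frontier vertices along an edge to
  a fresh vertex, and \<open>Lc\<close> toggles the edge between the current frontier vertices.\<close>

datatype letter = La | Lb | Lc

definition edge_pair :: "'a \<Rightarrow> 'a \<Rightarrow> 'a \<Rightarrow> 'a \<Rightarrow> bool" where
  "edge_pair p q u v \<longleftrightarrow> (u = p \<and> v = q) \<or> (u = q \<and> v = p)"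

text \<open>The letters contribute edges by exclusive or. Concatenation of words thus becomes
  addition of edge sets (\<open>ladder_edge_append\<close>), and two consecutive \<open>Lc\<close>
  cancel.\<close>

fun ladder_edge :: "letter list \<Rightarrow> 'a \<Rightarrow> 'a \<Rightarrow> 'a list \<Rightarrow> 'a list \<Rightarrow> 'a \<Rightarrow> 'a \<Rightarrow> bool" where
  "ladder_edge [] x y xs ys u v = False"
| "ladder_edge (La # w) x y xs ys u v = (edge_pair x (hd xs) u v \<noteq> ladder_edge w (hd xs) y (tl xs) ys u v)"
| "ladder_edge (Lb # w) x y xs ys u v = (edge_pair y (hd ys) u v \<noteq> ladder_edge w x (hd ys) xs (tl ys) u v)"
| "ladder_edge (Lc # w) x y xs ys u v = (edge_pair x y u v \<noteq> ladder_edge w x y xs ys u v)"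

definition fits :: "letter list \<Rightarrow> 'a \<Rightarrow> 'a \<Rightarrow> 'a list \<Rightarrow> 'a list \<Rightarrow> bool" where
  "fits w x y xs ys \<longleftrightarrow> distinct (x # y # xs @ ys) \<and> length xs = count_list w La \<and> length ys = count_list w Lb"

definition has_ladder :: "'a set \<Rightarrow> ('a \<Rightarrow> 'a \<Rightarrow> bool) \<Rightarrow> letter list \<Rightarrow> bool" where
  "has_ladder V E w \<longleftrightarrow> (\<exists>x y xs ys. fits w x y xs ys \<and> set (x # y # xs @ ys) \<subseteq> V \<and>
     (\<forall>u \<in> set (x # y # xs @ ys). \<forall>v \<in> set (x # y # xs @ ys). E u v = ladder_edge w x y xs ys u v))"

definition ladder_minor :: "'a set \<Rightarrow> ('a \<Rightarrow> 'a \<Rightarrow> bool) \<Rightarrow> letter list \<Rightarrow> bool" where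
  "ladder_minor V E w \<longleftrightarrow> (\<exists>V' E'. vminor V E V' E' \<and> has_ladder V' E' w)"

lemma ladder_edge_append:
  "length xs1 = count_list p La \<Longrightarrow> length ys1 = count_list p Lb \<Longrightarrow>
   ladder_edge (p @ w) x y (xs1 @ xs2) (ys1 @ ys2) u v =
   (ladder_edge p x y xs1 ys1 u v \<noteq> ladder_edge w (last (x # xs1)) (last (y # ys1)) xs2 ys2 u v)"
proof (induction p arbitrary: x y xs1 ys1)
  case Nil
  then show ?case by simp
next
  case (Cons l p)
  show ?case
  proof (cases l)
    case La
    then obtain x' xs' where x': "xs1 = x' # xs'" using Cons.prems by (cases xs1) auto
    show ?thesis using Cons.IH[of xs' ys1 x' y] Cons.prems La x' by auto
  next
    case Lb
    then obtain x' xs' where x': "ys1 = x' # xs'" using Cons.prems by (cases ys1) auto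
    show ?thesis using Cons.IH[of xs1 xs' x x'] Cons.prems Lb x' by auto
  next
    case Lc
    show ?thesis using Cons.IH[of xs1 ys1 x y] Cons.prems Lc by auto
  qed
qed

lemma ladder_edge_verts:
  "length xs = count_list w La \<Longrightarrow> length ys = count_list w Lb \<Longrightarrow> ladder_edge w x y xs ys u v \<Longrightarrow>
   u \<in> set (x # y # xs @ ys) \<and> v \<in> set (x # y # xs @ ys)"
proof (induction w arbitrary: x y xs ys)
  case Nil
  then show ?case by simp
next
  case (Cons l p)
  show ?case
  proof (cases l)
    case La
    then obtain x' xs' where x': "xs = x' # xs'" using Cons.prems by (cases xs) auto
    show ?thesis using Cons.IH[of xs' ys x' y] Cons.prems La x' by (auto simp: edge_pair_def)
  next
    case Lb
    then obtain x' xs' where x': "ys = x' # xs'" using Cons.prems by (cases ys) auto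
    show ?thesis using Cons.IH[of xs xs' x x'] Cons.prems Lb x' by (auto simp: edge_pair_def)
  next
    case Lc
    show ?thesis using Cons.IH[of xs ys x y] Cons.prems Lc by (auto simp: edge_pair_def)
  qed
qed

fun swl :: "letter \<Rightarrow> letter" where
  "swl La = Lb" | "swl Lb = La" | "swl Lc = Lc"

lemma ladder_edge_swap: "ladder_edge (map swl w) y x ys xs u v = ladder_edge w x y xs ys u v"
proof (induction w arbitrary: x y xs ys)
  case (Cons l w)
  then show ?case by (cases l) (auto simp: edge_pair_def)
qed simp

lemma count_swl [simp]: "count_list (map swl w) La = count_list w Lb"
  "count_list (map swl w) Lb = count_list w La"
proof (induction w)
  case (Cons l w)
  { case 1 then show ?case using Cons by (cases l) auto }
  { case 2 then show ?case using Cons by (cases l) auto }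
qed auto

lemma ladder_minor_trans: "vminor V E V' E' \<Longrightarrow> ladder_minor V' E' w \<Longrightarrow> ladder_minor V E w"
  unfolding ladder_minor_def using vminor_trans by blast

lemma ladder_minor_swap: "ladder_minor V E w \<Longrightarrow> ladder_minor V E (map swl w)"
proof -
  have "has_ladder V E (map swl w)" if h: "has_ladder V E w" for V :: "'a set" and E
  proof -
    from h obtain x y xs ys where f: "fits w x y xs ys" "set (x # y # xs @ ys) \<subseteq> V"
      "\<forall>u \<in> set (x # y # xs @ ys). \<forall>v \<in> set (x # y # xs @ ys). E u v = ladder_edge w x y xs ys u v"
      unfolding has_ladder_def by blast
    have "fits (map swl w) y x ys xs" using f(1) unfolding fits_def by auto
    moreover have "set (y # x # ys @ xs) = set (x # y # xs @ ys)" by auto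
    ultimately show ?thesis unfolding has_ladder_def using f by (metis ladder_edge_swap)
  qed
  then show "ladder_minor V E w \<Longrightarrow> ladder_minor V E (map swl w)" unfolding ladder_minor_def by blast
qed

lemma has_ladder_splitE:
  assumes "has_ladder V E (p @ w)"
  obtains x y xs1 ys1 xs2 ys2 xf yf where
    "length xs1 = count_list p La" "length ys1 = count_list p Lb"
    "length xs2 = count_list w La" "length ys2 = count_list w Lb"
    "distinct (x # y # xs1 @ xs2 @ ys1 @ ys2)"
    "set (x # y # xs1 @ xs2 @ ys1 @ ys2) \<subseteq> V"
    "xf = last (x # xs1)" "yf = last (y # ys1)"
    "\<forall>u \<in> set (x # y # xs1 @ xs2 @ ys1 @ ys2). \<forall>v \<in> set (x # y # xs1 @ xs2 @ ys1 @ ys2).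
      E u v = (ladder_edge p x y xs1 ys1 u v \<noteq> ladder_edge w xf yf xs2 ys2 u v)"
proof -
  from assms obtain x y xs ys where f: "fits (p @ w) x y xs ys" "set (x # y # xs @ ys) \<subseteq> V"
      "\<forall>u \<in> set (x # y # xs @ ys). \<forall>v \<in> set (x # y # xs @ ys). E u v = ladder_edge (p @ w) x y xs ys u v"
    unfolding has_ladder_def by blast
  define xs1 where "xs1 = take (count_list p La) xs"
  define xs2 where "xs2 = drop (count_list p La) xs"
  define ys1 where "ys1 = take (count_list p Lb) ys"
  define ys2 where "ys2 = drop (count_list p Lb) ys"
  have e: "xs = xs1 @ xs2" "ys = ys1 @ ys2" by (simp_all add: xs1_def xs2_def ys1_def ys2_def)
  have l: "length xs1 = count_list p La" "length ys1 = count_list p Lb"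
    "length xs2 = count_list w La" "length ys2 = count_list w Lb"
    using f(1) unfolding fits_def xs1_def xs2_def ys1_def ys2_def by auto
  have S: "set (x # y # xs @ ys) = set (x # y # xs1 @ xs2 @ ys1 @ ys2)" unfolding e by simp
  have d: "distinct (x # y # xs1 @ xs2 @ ys1 @ ys2)" using f(1) unfolding fits_def e by simp
  have E: "\<forall>u \<in> set (x # y # xs1 @ xs2 @ ys1 @ ys2). \<forall>v \<in> set (x # y # xs1 @ xs2 @ ys1 @ ys2).
      E u v = (ladder_edge p x y xs1 ys1 u v \<noteq> ladder_edge w (last (x # xs1)) (last (y # ys1)) xs2 ys2 u v)"
    using f(3) ladder_edge_append[OF l(1,2)] unfolding S unfolding e by blast
  show ?thesis by (rule that[OF l d f(2)[unfolded S] refl refl E])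
qed

lemma has_ladder_joinI:
  assumes "length xs1 = count_list p La" "length ys1 = count_list p Lb"
    "length xs2 = count_list w La" "length ys2 = count_list w Lb"
    "distinct (x # y # xs1 @ xs2 @ ys1 @ ys2)"
    "set (x # y # xs1 @ xs2 @ ys1 @ ys2) \<subseteq> V"
    "xf = last (x # xs1)" "yf = last (y # ys1)"
    "\<And>u v. u \<in> set (x # y # xs1 @ xs2 @ ys1 @ ys2) \<Longrightarrow> v \<in> set (x # y # xs1 @ xs2 @ ys1 @ ys2) \<Longrightarrow>
      E u v = (ladder_edge p x y xs1 ys1 u v \<noteq> ladder_edge w xf yf xs2 ys2 u v)"
  shows "has_ladder V E (p @ w)"
proof -
  have S: "set (x # y # (xs1 @ xs2) @ ys1 @ ys2) = set (x # y # xs1 @ xs2 @ ys1 @ ys2)" by simp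
  have "fits (p @ w) x y (xs1 @ xs2) (ys1 @ ys2)" using assms unfolding fits_def by simp
  moreover have "\<forall>u \<in> set (x # y # xs1 @ xs2 @ ys1 @ ys2). \<forall>v \<in> set (x # y # xs1 @ xs2 @ ys1 @ ys2).
      E u v = ladder_edge (p @ w) x y (xs1 @ xs2) (ys1 @ ys2) u v"
    using assms(9) ladder_edge_append[OF assms(1,2)] unfolding assms(7,8) by blast
  ultimately show ?thesis unfolding has_ladder_def using assms(6) S by metis
qed

lemma has_ladder_cong:
  fixes V :: "'a set"
  assumes "has_ladder V E (p @ w)" "count_list w La = count_list w' La" "count_list w Lb = count_list w' Lb"
    "\<And>(x::'a) y xs ys u v. length xs = count_list w La \<Longrightarrow> length ys = count_list w Lb \<Longrightarrow>
       ladder_edge w x y xs ys u v = ladder_edge w' x y xs ys u v"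
  shows "has_ladder V E (p @ w')"
  using assms(1)
proof (rule has_ladder_splitE)
  fix x y xs1 ys1 xs2 ys2 xf yf
  assume a: "length xs1 = count_list p La" "length ys1 = count_list p Lb"
    "length xs2 = count_list w La" "length ys2 = count_list w Lb"
    "distinct (x # y # xs1 @ xs2 @ ys1 @ ys2)"
    "set (x # y # xs1 @ xs2 @ ys1 @ ys2) \<subseteq> V"
    "xf = last (x # xs1)" "yf = last (y # ys1)"
    "\<forall>u \<in> set (x # y # xs1 @ xs2 @ ys1 @ ys2). \<forall>v \<in> set (x # y # xs1 @ xs2 @ ys1 @ ys2).
      E u v = (ladder_edge p x y xs1 ys1 u v \<noteq> ladder_edge w xf yf xs2 ys2 u v)"
  show ?thesis
    by (rule has_ladder_joinI[OF a(1,2) a(3)[unfolded assms(2)] a(4)[unfolded assms(3)] a(5-8)])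
      (use a(9) assms(4)[OF a(3,4)] in blast)
qed

text \<open>For rewritings that leave the graph alone and change only the word describing
  it.\<close>

lemma ladder_minor_cong:
  fixes V :: "'a set"
  assumes "ladder_minor V E (p @ w)" "count_list w La = count_list w' La" "count_list w Lb = count_list w' Lb"
    "\<And>(x::'a) y xs ys u v. length xs = count_list w La \<Longrightarrow> length ys = count_list w Lb \<Longrightarrow>
       ladder_edge w x y xs ys u v = ladder_edge w' x y xs ys u v"
  shows "ladder_minor V E (p @ w')"
  using assms(1) has_ladder_cong[OF _ assms(2,3,4)] unfolding ladder_minor_def by blast

lemma ladder_minor_comm: "ladder_minor V E (p @ [La, Lb] @ s) \<longleftrightarrow> ladder_minor V E (p @ [Lb, La] @ s)"
  by (rule iffI; erule ladder_minor_cong) auto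

lemma ladder_minor_cc: "ladder_minor V E (p @ [Lc, Lc] @ s) \<longleftrightarrow> ladder_minor V E (p @ s)"
  by (rule iffI; erule ladder_minor_cong) auto

lemma ladder_minorI:
  fixes V :: "'a set"
  assumes "\<And>(V::'a set) E. has_ladder V E w \<Longrightarrow> ladder_minor V E w'" "ladder_minor V E w"
  shows "ladder_minor V E w'"
proof -
  obtain V' E' where "vminor V E V' E'" "has_ladder V' E' w" using assms(2) unfolding ladder_minor_def by blast
  then show ?thesis using assms(1)[of V' E'] ladder_minor_trans by blast
qed

lemma ladder_edge_fresh:
  assumes "length xs = count_list w La" "length ys = count_list w Lb" "z \<notin> set (x # y # xs @ ys)"
  shows "\<not> ladder_edge w x y xs ys z v"
  using ladder_edge_verts[OF assms(1,2)] assms(3) by blast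

lemma vminor_fold:
  assumes "set zs \<subseteq> V" "V' \<subseteq> V"
  shows "vminor V E V' (foldl lcE E zs)"
proof -
  have "lceq V E (foldl lcE E zs)" using assms(1)
    by (induction zs rule: rev_induct) (auto intro: lceq.intros)
  then show ?thesis using assms(2) unfolding vminor_def by blast
qed

lemma foldl_lcE_agree:
  assumes "\<forall>u\<in>S. \<forall>v\<in>S. E u v = F u v" "set zs \<subseteq> S"
  shows "\<forall>u\<in>S. \<forall>v\<in>S. foldl lcE E zs u v = foldl lcE F zs u v"
  using assms(2)
proof (induction zs rule: rev_induct)
  case Nil then show ?case using assms(1) by simp
next
  case (snoc z zs)
  then show ?case by (simp add: lcE_def)
qed

text \<open>A centre without \<open>R\<close>-neighbours has its whole neighbourhood in the
  \<open>L\<close> part, and only pairs inside that neighbourhood are toggled.\<close>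

lemma foldl_lcE_local:
  assumes "\<And>z v. z \<in> set zs \<Longrightarrow> \<not> R z v"
  shows "foldl lcE (\<lambda>u v. R u v \<noteq> L u v) zs = (\<lambda>u v. R u v \<noteq> foldl lcE L zs u v)"
  using assms
proof (induction zs rule: rev_induct)
  case (snoc z zs)
  then show ?case by (auto simp: lcE_def fun_eq_iff)
qed simp

lemma foldl_lcE_outside:
  assumes "\<And>u v. u \<notin> A \<or> v \<notin> A \<Longrightarrow> \<not> L u v" "u \<notin> A \<or> v \<notin> A"
  shows "\<not> foldl lcE L zs u v"
  using assms(2)
proof (induction zs arbitrary: u v rule: rev_induct)
  case (snoc z zs)
  then show ?case by (auto simp: lcE_def)
qed (use assms(1) in simp)

subsection \<open>Rewriting rules\<close>

text \<open>Local complementations at inner vertices of a factor of a word do not see the rest of it.\<close>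

lemma ladder_minor_local_rule:
  fixes V :: "'a set"
  assumes w: "ladder_minor V E (p @ l @ s)"
    and rule: "\<And>(x::'a) y lx ly. distinct (x # y # lx @ ly) \<Longrightarrow> length lx = count_list l La \<Longrightarrow>
      length ly = count_list l Lb \<Longrightarrow>
      \<exists>zs lx' ly'. set zs \<subseteq> set (lx @ ly) - {last (x # lx), last (y # ly)} \<and>
        distinct (x # y # lx' @ ly') \<and> set (lx' @ ly') \<subseteq> set (lx @ ly) \<and>
        length lx' = count_list r La \<and> length ly' = count_list r Lb \<and>
        (if sw then last (x # lx') = last (y # ly) \<and> last (y # ly') = last (x # lx)
         else last (x # lx') = last (x # lx) \<and> last (y # ly') = last (y # ly)) \<and>
        (\<forall>u \<in> set (x # y # lx' @ ly'). \<forall>v \<in> set (x # y # lx' @ ly').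
           foldl lcE (ladder_edge l x y lx ly) zs u v = ladder_edge r x y lx' ly' u v)
        \<and> set zs \<inter> set (lx' @ ly') = {}
        \<and> (\<forall>u \<in> set (lx @ ly) - set zs. u \<in> set (lx' @ ly'))"
  shows "ladder_minor V E (p @ r @ (if sw then map swl s else s))"
  using w
proof (rule ladder_minorI[rotated])
  fix V :: "'a set" and E
  assume "has_ladder V E (p @ l @ s)"
  then show "ladder_minor V E (p @ r @ (if sw then map swl s else s))"
  proof (rule has_ladder_splitE)
    fix x y xs1 ys1 xs2 ys2 xf yf
    assume a: "length xs1 = count_list p La" "length ys1 = count_list p Lb"
      "length xs2 = count_list (l @ s) La" "length ys2 = count_list (l @ s) Lb"
      "distinct (x # y # xs1 @ xs2 @ ys1 @ ys2)"
      "set (x # y # xs1 @ xs2 @ ys1 @ ys2) \<subseteq> V"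
      "xf = last (x # xs1)" "yf = last (y # ys1)"
      "\<forall>u \<in> set (x # y # xs1 @ xs2 @ ys1 @ ys2). \<forall>v \<in> set (x # y # xs1 @ xs2 @ ys1 @ ys2).
        E u v = (ladder_edge p x y xs1 ys1 u v \<noteq> ladder_edge (l @ s) xf yf xs2 ys2 u v)"
    define lx where "lx = take (count_list l La) xs2"
    define xs3 where "xs3 = drop (count_list l La) xs2"
    define ly where "ly = take (count_list l Lb) ys2"
    define ys3 where "ys3 = drop (count_list l Lb) ys2"
    have e: "xs2 = lx @ xs3" "ys2 = ly @ ys3" by (simp_all add: lx_def xs3_def ly_def ys3_def)
    have len: "length lx = count_list l La" "length ly = count_list l Lb"
      "length xs3 = count_list s La" "length ys3 = count_list s Lb"
      using a(3,4) unfolding lx_def xs3_def ly_def ys3_def by auto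
    have fx: "xf \<in> set (x # xs1)" "yf \<in> set (y # ys1)" using a(7,8) last_in_set by blast+
    define P where "P = ladder_edge p x y xs1 ys1"
    define xg where "xg = last (xf # lx)"
    define yg where "yg = last (yf # ly)"
    have gx: "xg \<in> set (xf # lx)" "yg \<in> set (yf # ly)" unfolding xg_def yg_def using last_in_set by blast+
    define S where "S = ladder_edge s xg yg xs3 ys3"
    have ds: "distinct (xf # yf # lx @ ly)" using a(5) fx unfolding e by auto
    obtain zs lx' ly' where z: "set zs \<subseteq> set (lx @ ly) - {xg, yg}"
        "distinct (xf # yf # lx' @ ly')" "set (lx' @ ly') \<subseteq> set (lx @ ly)"
        "length lx' = count_list r La" "length ly' = count_list r Lb"
        "if sw then last (xf # lx') = yg \<and> last (yf # ly') = xg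
         else last (xf # lx') = xg \<and> last (yf # ly') = yg"
        "\<And>u v. u \<in> set (xf # yf # lx' @ ly') \<Longrightarrow> v \<in> set (xf # yf # lx' @ ly') \<Longrightarrow>
           foldl lcE (ladder_edge l xf yf lx ly) zs u v = ladder_edge r xf yf lx' ly' u v"
        "set zs \<inter> set (lx' @ ly') = {}"
        "\<forall>u \<in> set (lx @ ly) - set zs. u \<in> set (lx' @ ly')"
      using rule[OF ds len(1,2)] unfolding xg_def yg_def by blast
    let ?A = "set (x # y # xs1 @ xs2 @ ys1 @ ys2)"
    let ?F = "\<lambda>u v. (P u v \<noteq> S u v) \<noteq> ladder_edge l xf yf lx ly u v"
    have EF: "\<forall>u\<in>?A. \<forall>v\<in>?A. E u v = ?F u v"
    proof (intro ballI)
      fix u v assume "u \<in> ?A" "v \<in> ?A"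
      then have "E u v = (P u v \<noteq> ladder_edge (l @ s) xf yf xs2 ys2 u v)" using a(9) unfolding P_def by blast
      also have "ladder_edge (l @ s) xf yf xs2 ys2 u v = (ladder_edge l xf yf lx ly u v \<noteq> S u v)"
        unfolding e S_def xg_def yg_def by (rule ladder_edge_append[OF len(1,2)])
      finally show "E u v = ?F u v" by auto
    qed
    have fP: "\<not> P c v" if "c \<in> set zs" for c v
      unfolding P_def by (rule ladder_edge_fresh[OF a(1,2)]) (use that z(1) a(5) in \<open>auto simp: e\<close>)
    have fS: "\<not> S c v" if "c \<in> set zs" for c v
      unfolding S_def by (rule ladder_edge_fresh[OF len(3,4)]) (use that z(1) a(5) in \<open>auto simp: e\<close>)
    have zA: "set zs \<subseteq> ?A" using z(1) unfolding e by auto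
    have fold: "\<forall>u\<in>?A. \<forall>v\<in>?A. foldl lcE E zs u v =
      ((P u v \<noteq> S u v) \<noteq> foldl lcE (ladder_edge l xf yf lx ly) zs u v)"
      using foldl_lcE_agree[OF EF zA] foldl_lcE_local[of zs "\<lambda>u v. P u v \<noteq> S u v" "ladder_edge l xf yf lx ly"]
        fP fS by simp
    define B where "B = set (x # y # xs1 @ lx' @ xs3 @ ys1 @ ly' @ ys3)"
    have BA: "B \<subseteq> ?A" using z(3) unfolding B_def e by auto
    have zr: "foldl lcE (ladder_edge l xf yf lx ly) zs u v = False"
      if "u \<notin> set (xf # yf # lx @ ly) \<or> v \<notin> set (xf # yf # lx @ ly)" for u v
      using foldl_lcE_outside[of "set (xf # yf # lx @ ly)" "ladder_edge l xf yf lx ly" u v zs]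
        ladder_edge_verts[OF len(1,2)] that by blast
    have zr': "ladder_edge r xf yf lx' ly' u v = False"
      if "u \<notin> set (xf # yf # lx' @ ly') \<or> v \<notin> set (xf # yf # lx' @ ly')" for u v
      using ladder_edge_verts[OF z(4,5)] that by blast
    have loc: "foldl lcE (ladder_edge l xf yf lx ly) zs u v = ladder_edge r xf yf lx' ly' u v" if "u \<in> B" "v \<in> B" for u v
    proof (cases "u \<in> set (xf # yf # lx' @ ly') \<and> v \<in> set (xf # yf # lx' @ ly')")
      case True then show ?thesis using z(7) by blast
    next
      case False
      \<comment> \<open>The rule keeps all vertices of the old factor other than the centres
        \<open>zs\<close>, and no centre is in \<open>B\<close>. So a vertex of \<open>B\<close>
        outside the new factor is outside the old one too, and both relations are empty
        there.\<close>
      have "c \<notin> set (xf # yf # lx @ ly)" if "c \<in> B" "c \<notin> set (xf # yf # lx' @ ly')" for c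
      proof
        assume c: "c \<in> set (xf # yf # lx @ ly)"
        then have "c \<in> set (lx @ ly)" using that(2) by auto
        then have "c \<in> set zs" using z(9) that(2) by auto
        moreover have "c \<notin> set zs" using that \<open>c \<in> set (lx @ ly)\<close> a(5) unfolding B_def e by auto
        ultimately show False by blast
      qed
      then show ?thesis using False zr zr' that by metis
    qed
    have Ba: "foldl lcE E zs u v = (P u v \<noteq> (ladder_edge r xf yf lx' ly' u v \<noteq> S u v))"
      if "u \<in> B" "v \<in> B" for u v
    proof -
      have "foldl lcE E zs u v = ((P u v \<noteq> S u v) \<noteq> foldl lcE (ladder_edge l xf yf lx ly) zs u v)"
        using fold that BA by blast
      then show ?thesis unfolding loc[OF that] by blast
    qed
    have vm: "vminor V E B (foldl lcE E zs)"
      by (rule vminor_fold) (use zA BA a(6) in auto)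
    have "has_ladder B (foldl lcE E zs) (p @ r @ (if sw then map swl s else s))"
    proof (cases sw)
      case False
      have S': "ladder_edge (r @ s) xf yf (lx' @ xs3) (ly' @ ys3) u v = (ladder_edge r xf yf lx' ly' u v \<noteq> S u v)" for u v
        using ladder_edge_append[OF z(4,5), of s xf yf xs3 ys3 u v] z(6) False unfolding S_def by simp
      have "has_ladder B (foldl lcE E zs) (p @ (r @ s))"
      proof (rule has_ladder_joinI[OF a(1,2) _ _ _ _ a(7,8)])
        show "length (lx' @ xs3) = count_list (r @ s) La" using z len by simp
        show "length (ly' @ ys3) = count_list (r @ s) Lb" using z len by simp
        show "distinct (x # y # xs1 @ (lx' @ xs3) @ ys1 @ ly' @ ys3)" using a(5) z(2,3) unfolding e by auto
        show "set (x # y # xs1 @ (lx' @ xs3) @ ys1 @ ly' @ ys3) \<subseteq> B" unfolding B_def by auto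
        fix u v assume "u \<in> set (x # y # xs1 @ (lx' @ xs3) @ ys1 @ ly' @ ys3)"
          "v \<in> set (x # y # xs1 @ (lx' @ xs3) @ ys1 @ ly' @ ys3)"
        then have "u \<in> B" "v \<in> B" unfolding B_def by auto
        then show "foldl lcE E zs u v = (ladder_edge p x y xs1 ys1 u v \<noteq>
          ladder_edge (r @ s) xf yf (lx' @ xs3) (ly' @ ys3) u v)"
          using Ba S' unfolding P_def by blast
      qed
      then show ?thesis using False by simp
    next
      \<comment> \<open>The rule has interchanged the two frontier vertices, so the rest of the
        graph is unchanged but is read with \<open>La\<close> and \<open>Lb\<close>
        exchanged.\<close>
      case True
      have S': "ladder_edge (r @ map swl s) xf yf (lx' @ ys3) (ly' @ xs3) u v = (ladder_edge r xf yf lx' ly' u v \<noteq> S u v)" for u v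
        using ladder_edge_append[OF z(4,5), of "map swl s" xf yf ys3 xs3 u v] z(6) True
        unfolding S_def by (simp add: ladder_edge_swap)
      have "has_ladder B (foldl lcE E zs) (p @ (r @ map swl s))"
      proof (rule has_ladder_joinI[OF a(1,2) _ _ _ _ a(7,8)])
        show "length (lx' @ ys3) = count_list (r @ map swl s) La" using z len by simp
        show "length (ly' @ xs3) = count_list (r @ map swl s) Lb" using z len by simp
        show "distinct (x # y # xs1 @ (lx' @ ys3) @ ys1 @ ly' @ xs3)" using a(5) z(2,3) unfolding e by auto
        show "set (x # y # xs1 @ (lx' @ ys3) @ ys1 @ ly' @ xs3) \<subseteq> B" unfolding B_def by auto
        fix u v assume "u \<in> set (x # y # xs1 @ (lx' @ ys3) @ ys1 @ ly' @ xs3)"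
          "v \<in> set (x # y # xs1 @ (lx' @ ys3) @ ys1 @ ly' @ xs3)"
        then have "u \<in> B" "v \<in> B" unfolding B_def by auto
        then show "foldl lcE E zs u v = (ladder_edge p x y xs1 ys1 u v \<noteq>
          ladder_edge (r @ map swl s) xf yf (lx' @ ys3) (ly' @ xs3) u v)"
          using Ba S' unfolding P_def by blast
      qed
      then show ?thesis using True by simp
    qed
    then show "ladder_minor V E (p @ r @ (if sw then map swl s else s))" using vm unfolding ladder_minor_def by blast
  qed
qed

text \<open>Complementing at the middle vertex of a path of length two joins its ends; the middle
  vertex is then deleted.\<close>

lemma ladder_minor_aa: "ladder_minor V E (p @ [La, La] @ s) \<Longrightarrow> ladder_minor V E (p @ [La] @ s)"
proof (drule ladder_minor_local_rule[where r = "[La]" and sw = False], goal_cases)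
  case (1 x y lx ly)
  then obtain x1 x2 where l: "lx = [x1, x2]" "ly = []" by (auto simp: length_Suc_conv)
  have d: "x \<noteq> y" "x \<noteq> x1" "x \<noteq> x2" "y \<noteq> x1" "y \<noteq> x2" "x1 \<noteq> x2" using 1 l by auto
  show ?case unfolding l
    by (rule exI[of _ "[x1]"], rule exI[of _ "[x2]"], rule exI[of _ "[]"])
      (simp add: lcE_def edge_pair_def d d[symmetric])
qed simp

text \<open>The centre \<open>x1\<close> has the neighbours \<open>x\<close>, \<open>y\<close>,
  \<open>x2\<close>. Complementing there toggles the triangle on them, which is what
  \<open>Lc\<close>, \<open>La\<close>, \<open>Lc\<close> spells.\<close>

lemma ladder_minor_aca: "ladder_minor V E (p @ [La, Lc, La] @ s) \<Longrightarrow> ladder_minor V E (p @ [Lc, La, Lc] @ s)"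
proof (drule ladder_minor_local_rule[where r = "[Lc, La, Lc]" and sw = False], goal_cases)
  case (1 x y lx ly)
  then obtain x1 x2 where l: "lx = [x1, x2]" "ly = []" by (auto simp: length_Suc_conv)
  have d: "x \<noteq> y" "x \<noteq> x1" "x \<noteq> x2" "y \<noteq> x1" "y \<noteq> x2" "x1 \<noteq> x2" using 1 l by auto
  show ?case unfolding l
    by (rule exI[of _ "[x1]"], rule exI[of _ "[x2]"], rule exI[of _ "[]"])
      (simp add: lcE_def edge_pair_def d d[symmetric])
qed simp

text \<open>The three complementations form a pivot on the rung \<open>x1 y1\<close>: it toggles all
  pairs between \<open>{x, x2}\<close> and \<open>{y, y2}\<close>. In the result \<open>x\<close> is
  followed by \<open>y2\<close> and \<open>y\<close> by \<open>x2\<close>, hence the swap.\<close>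

lemma ladder_minor_abcab: "ladder_minor V E (p @ [La, Lb, Lc, La, Lb] @ s) \<Longrightarrow> ladder_minor V E (p @ [Lc, La, Lb, Lc] @ map swl s)"
proof (drule ladder_minor_local_rule[where r = "[Lc, La, Lb, Lc]" and sw = True], goal_cases)
  case (1 x y lx ly)
  then obtain x1 x2 y1 y2 where l: "lx = [x1, x2]" "ly = [y1, y2]" by (auto simp: length_Suc_conv)
  have d: "x \<noteq> y" "x \<noteq> x1" "x \<noteq> x2" "y \<noteq> x1" "y \<noteq> x2" "x1 \<noteq> x2" "x \<noteq> y1" "y \<noteq> y1" "x1 \<noteq> y1" "x2 \<noteq> y1"
    "x \<noteq> y2" "y \<noteq> y2" "x1 \<noteq> y2" "x2 \<noteq> y2" "y1 \<noteq> y2" using 1 l by auto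
  show ?case unfolding l
    by (rule exI[of _ "[x1, y1, x1]"], rule exI[of _ "[y2]"], rule exI[of _ "[x2]"])
      (simp add: lcE_def edge_pair_def d d[symmetric], blast)
qed simp

text \<open>The centre \<open>x1\<close> is adjacent to \<open>x\<close>, \<open>y\<close>,
  \<open>y1\<close>, \<open>x2\<close>. Among these only \<open>y y1\<close> was an edge of the
  factor, so afterwards all pairs but that one are edges, and \<open>x\<close> continues to
  \<open>y1\<close>, \<open>y\<close> to \<open>x2\<close>.\<close>

lemma ladder_minor_acbca: "ladder_minor V E (p @ [La, Lc, Lb, Lc, La] @ s) \<Longrightarrow> ladder_minor V E (p @ [Lc, Lb, Lc, La, Lc] @ map swl s)"
proof (drule ladder_minor_local_rule[where r = "[Lc, Lb, Lc, La, Lc]" and sw = True], goal_cases)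
  case (1 x y lx ly)
  then obtain x1 x2 y1 where l: "lx = [x1, x2]" "ly = [y1]" by (auto simp: length_Suc_conv)
  have d: "x \<noteq> y" "x \<noteq> x1" "x \<noteq> x2" "y \<noteq> x1" "y \<noteq> x2" "x1 \<noteq> x2" "x \<noteq> y1" "y \<noteq> y1" "x1 \<noteq> y1" "x2 \<noteq> y1"
    using 1 l by auto
  show ?case unfolding l
    by (rule exI[of _ "[x1]"], rule exI[of _ "[y1]"], rule exI[of _ "[x2]"])
      (simp add: lcE_def edge_pair_def d d[symmetric])
qed simp

text \<open>At the beginning of a word the first frontier vertices have no other neighbours and can
  serve as centres. Complementing at \<open>y\<close> and then at \<open>x\<close> leaves the edges
  \<open>x y\<close>, \<open>y x1\<close>, \<open>x y1\<close>, a ladder in which \<open>x\<close>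
  and \<open>y\<close> have exchanged their roles.\<close>

lemma ladder_minor_start: "ladder_minor V E ([Lc, La, Lc, Lb, Lc] @ s) \<Longrightarrow> ladder_minor V E ([Lc, La, Lb] @ s)"
proof (erule ladder_minorI[rotated])
  fix V :: "'a set" and E
  assume "has_ladder V E ([Lc, La, Lc, Lb, Lc] @ s)"
  then show "ladder_minor V E ([Lc, La, Lb] @ s)"
  proof (rule has_ladder_splitE)
    fix x y xs1 ys1 xs2 ys2 xf yf
    assume a: "length xs1 = count_list [Lc, La, Lc, Lb, Lc] La" "length ys1 = count_list [Lc, La, Lc, Lb, Lc] Lb"
      "length xs2 = count_list s La" "length ys2 = count_list s Lb"
      "distinct (x # y # xs1 @ xs2 @ ys1 @ ys2)"
      "set (x # y # xs1 @ xs2 @ ys1 @ ys2) \<subseteq> V"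
      "xf = last (x # xs1)" "yf = last (y # ys1)"
      "\<forall>u \<in> set (x # y # xs1 @ xs2 @ ys1 @ ys2). \<forall>v \<in> set (x # y # xs1 @ xs2 @ ys1 @ ys2).
        E u v = (ladder_edge [Lc, La, Lc, Lb, Lc] x y xs1 ys1 u v \<noteq> ladder_edge s xf yf xs2 ys2 u v)"
    obtain x1 y1 where l: "xs1 = [x1]" "ys1 = [y1]" using a(1,2) by (auto simp: length_Suc_conv)
    have f: "xf = x1" "yf = y1" using a(7,8) l by auto
    let ?A = "set (x # y # xs1 @ xs2 @ ys1 @ ys2)"
    let ?L = "ladder_edge [Lc, La, Lc, Lb, Lc] x y [x1] [y1]"
    define S where "S = ladder_edge s x1 y1 xs2 ys2"
    have EF: "\<forall>u\<in>?A. \<forall>v\<in>?A. E u v = (S u v \<noteq> ?L u v)"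
      using a(9) unfolding S_def l f by blast
    have fS: "\<not> S z v" if "z \<in> set [y, x]" for z v
      unfolding S_def by (rule ladder_edge_fresh[OF a(3,4)]) (use that a(5) l in auto)
    have fold: "foldl lcE E [y, x] u v = (S u v \<noteq> foldl lcE ?L [y, x] u v)" if "u \<in> ?A" "v \<in> ?A" for u v
    proof -
      have "\<forall>u\<in>?A. \<forall>v\<in>?A. foldl lcE E [y, x] u v = foldl lcE (\<lambda>u v. S u v \<noteq> ?L u v) [y, x] u v"
        by (rule foldl_lcE_agree[OF EF]) auto
      moreover have "foldl lcE (\<lambda>u v. S u v \<noteq> ?L u v) [y, x] = (\<lambda>u v. S u v \<noteq> foldl lcE ?L [y, x] u v)"
        by (rule foldl_lcE_local) (rule fS)
      ultimately have "\<forall>u\<in>?A. \<forall>v\<in>?A. foldl lcE E [y, x] u v = (S u v \<noteq> foldl lcE ?L [y, x] u v)"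
        by (simp only:)
      then show ?thesis using that by blast
    qed
    have d: "x \<noteq> y" "x \<noteq> x1" "x \<noteq> y1" "y \<noteq> x1" "y \<noteq> y1" "x1 \<noteq> y1" using a(5) l by auto
    have loc1: "\<forall>u \<in> {x, y, x1, y1}. \<forall>v \<in> {x, y, x1, y1}.
        foldl lcE ?L [y, x] u v = ladder_edge [Lc, La, Lb] y x [x1] [y1] u v"
      by (simp add: lcE_def edge_pair_def d d[symmetric])
    have loc2: "foldl lcE ?L [y, x] u v = ladder_edge [Lc, La, Lb] y x [x1] [y1] u v"
      if "u \<notin> {x, y, x1, y1} \<or> v \<notin> {x, y, x1, y1}" for u v
    proof -
      have "\<not> foldl lcE ?L [y, x] u v"
        by (rule foldl_lcE_outside[of "{x, y, x1, y1}"]) (use that in \<open>auto simp: edge_pair_def\<close>)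
      moreover have "\<not> ladder_edge [Lc, La, Lb] y x [x1] [y1] u v" using that by (auto simp: edge_pair_def)
      ultimately show ?thesis by blast
    qed
    have loc: "foldl lcE ?L [y, x] u v = ladder_edge [Lc, La, Lb] y x [x1] [y1] u v" for u v
      using loc1 loc2 by blast
    have "has_ladder V (foldl lcE E [y, x]) ([Lc, La, Lb] @ s)"
    proof (rule has_ladder_joinI[of "[x1]" _ "[y1]" xs2 s ys2 y x _ x1 y1])
      show "distinct (y # x # [x1] @ xs2 @ [y1] @ ys2)" using a(5) l by auto
      show "set (y # x # [x1] @ xs2 @ [y1] @ ys2) \<subseteq> V" using a(6) l by auto
      fix u v assume "u \<in> set (y # x # [x1] @ xs2 @ [y1] @ ys2)" "v \<in> set (y # x # [x1] @ xs2 @ [y1] @ ys2)"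
      then have "u \<in> ?A" "v \<in> ?A" using l by auto
      then show "foldl lcE E [y, x] u v = (ladder_edge [Lc, La, Lb] y x [x1] [y1] u v \<noteq> ladder_edge s x1 y1 xs2 ys2 u v)"
        using fold loc unfolding S_def by blast
    qed (use a(1-8) in auto)
    moreover have "vminor V E V (foldl lcE E [y, x])" by (rule vminor_fold) (use a(6) in auto)
    ultimately show ?thesis unfolding ladder_minor_def by blast
  qed
qed

lemma ladder_edge_irrefl:
  "distinct (x # y # xs @ ys) \<Longrightarrow> length xs = count_list w La \<Longrightarrow> length ys = count_list w Lb \<Longrightarrow>
   \<not> ladder_edge w x y xs ys u u"
proof (induction w arbitrary: x y xs ys)
  case (Cons l p)
  show ?case
  proof (cases l)
    case La
    then obtain x' xs' where x': "xs = x' # xs'" using Cons.prems by (cases xs) auto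
    show ?thesis using Cons.IH[of x' y xs' ys] Cons.prems La x' by (auto simp: edge_pair_def)
  next
    case Lb
    then obtain x' xs' where x': "ys = x' # xs'" using Cons.prems by (cases ys) auto
    show ?thesis using Cons.IH[of x x' xs xs'] Cons.prems Lb x' by (auto simp: edge_pair_def)
  next
    case Lc
    show ?thesis using Cons.IH[of x y xs ys] Cons.prems Lc by (auto simp: edge_pair_def)
  qed
qed simp

text \<open>Right after \<open>La\<close> the vertex \<open>xf\<close> is fresh: its only earlier
  edge leads back to \<open>z\<close>, which is discarded, so the prefix leaves no edge between
  \<open>xf\<close> and \<open>yf\<close>. After a final \<open>Lc\<close> it would leave
  one.\<close>

lemma ladder_minor_drop_prefix_a: "ladder_minor V E (p @ [La] @ w) \<Longrightarrow> ladder_minor V E w"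
proof (erule ladder_minorI[rotated])
  fix V :: "'a set" and E
  assume "has_ladder V E (p @ [La] @ w)"
  then have "has_ladder V E ((p @ [La]) @ w)" by simp
  then show "ladder_minor V E w"
  proof (rule has_ladder_splitE)
    fix x y xs1 ys1 xs2 ys2 xf yf
    assume a: "length xs1 = count_list (p @ [La]) La" "length ys1 = count_list (p @ [La]) Lb"
      "length xs2 = count_list w La" "length ys2 = count_list w Lb"
      "distinct (x # y # xs1 @ xs2 @ ys1 @ ys2)"
      "set (x # y # xs1 @ xs2 @ ys1 @ ys2) \<subseteq> V"
      "xf = last (x # xs1)" "yf = last (y # ys1)"
      "\<forall>u \<in> set (x # y # xs1 @ xs2 @ ys1 @ ys2). \<forall>v \<in> set (x # y # xs1 @ xs2 @ ys1 @ ys2).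
        E u v = (ladder_edge (p @ [La]) x y xs1 ys1 u v \<noteq> ladder_edge w xf yf xs2 ys2 u v)"
    obtain xs0 where xs1: "xs1 = xs0 @ [xf]" using a(1,7) by (cases xs1 rule: rev_cases) auto
    have l0: "length xs0 = count_list p La" "length ys1 = count_list p Lb" using a(1,2) xs1 by auto
    have yf: "yf \<in> set (y # ys1)" using a(8) last_in_set by blast
    define z where "z = last (x # xs0)"
    have xl: "z \<in> set (x # xs0)" unfolding z_def using last_in_set by blast
    have zn: "z \<notin> set (xf # yf # xs2 @ ys2)" using xl yf a(5) unfolding xs1 by auto
    have yn: "c = yf" if "c \<in> set (xf # yf # xs2 @ ys2)" "c \<in> set (x # y # xs0 @ ys1)" for c
      using that a(5) unfolding xs1 by auto
    have P: "\<not> ladder_edge (p @ [La]) x y xs1 ys1 u v"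
      if "u \<in> set (xf # yf # xs2 @ ys2)" "v \<in> set (xf # yf # xs2 @ ys2)" for u v
    proof -
      have "ladder_edge (p @ [La]) x y xs1 ys1 u v = (ladder_edge p x y xs0 ys1 u v \<noteq> edge_pair z xf u v)"
        using ladder_edge_append[OF l0, of "[La]" x y "[xf]" "[]" u v] xs1 unfolding z_def by simp
      moreover have "\<not> edge_pair z xf u v" using that zn unfolding edge_pair_def by blast
      moreover have "\<not> ladder_edge p x y xs0 ys1 u v"
      proof
        assume "ladder_edge p x y xs0 ys1 u v"
        moreover from this have "u = yf" "v = yf"
          using ladder_edge_verts[OF l0] that yn by blast+
        moreover have "\<not> ladder_edge p x y xs0 ys1 yf yf"
          by (rule ladder_edge_irrefl[OF _ l0]) (use a(5) xs1 in auto)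
        ultimately show False by simp
      qed
      ultimately show ?thesis by blast
    qed
    have "has_ladder V E ([] @ w)"
    proof (rule has_ladder_joinI[of "[]" "[]" "[]" xs2 w ys2 xf yf V xf yf E])
      show "distinct (xf # yf # [] @ xs2 @ [] @ ys2)" using a(5) yf xs1 by auto
      show "set (xf # yf # [] @ xs2 @ [] @ ys2) \<subseteq> V" using a(6) yf xs1 by auto
      fix u v assume uv: "u \<in> set (xf # yf # [] @ xs2 @ [] @ ys2)" "v \<in> set (xf # yf # [] @ xs2 @ [] @ ys2)"
      then have "u \<in> set (x # y # xs1 @ xs2 @ ys1 @ ys2)" "v \<in> set (x # y # xs1 @ xs2 @ ys1 @ ys2)"
        using yf xs1 by auto
      then have "E u v = (ladder_edge (p @ [La]) x y xs1 ys1 u v \<noteq> ladder_edge w xf yf xs2 ys2 u v)" using a(9) by blast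
      moreover have "\<not> ladder_edge (p @ [La]) x y xs1 ys1 u v" by (rule P) (use uv in simp_all)
      ultimately show "E u v = (ladder_edge [] xf yf [] [] u v \<noteq> ladder_edge w xf yf xs2 ys2 u v)" by simp
    qed (use a(1-8) in auto)
    then show ?thesis unfolding ladder_minor_def using vminor_sub[of V V E] by auto
  qed
qed

text \<open>After \<open>La\<close> the only old vertex on the frontier is \<open>yf\<close>, so
  every later edge has an end among the discarded vertices.\<close>

lemma ladder_minor_drop_suffix_a: "ladder_minor V E (w @ [La] @ s) \<Longrightarrow> ladder_minor V E w"
proof (erule ladder_minorI[rotated])
  fix V :: "'a set" and E
  assume "has_ladder V E (w @ [La] @ s)"
  then show "ladder_minor V E w"
  proof (rule has_ladder_splitE)
    fix x y xs1 ys1 xs2 ys2 xf yf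
    assume a: "length xs1 = count_list w La" "length ys1 = count_list w Lb"
      "length xs2 = count_list ([La] @ s) La" "length ys2 = count_list ([La] @ s) Lb"
      "distinct (x # y # xs1 @ xs2 @ ys1 @ ys2)"
      "set (x # y # xs1 @ xs2 @ ys1 @ ys2) \<subseteq> V"
      "xf = last (x # xs1)" "yf = last (y # ys1)"
      "\<forall>u \<in> set (x # y # xs1 @ xs2 @ ys1 @ ys2). \<forall>v \<in> set (x # y # xs1 @ xs2 @ ys1 @ ys2).
        E u v = (ladder_edge w x y xs1 ys1 u v \<noteq> ladder_edge ([La] @ s) xf yf xs2 ys2 u v)"
    obtain x1 xs3 where xs2: "xs2 = x1 # xs3" "length xs3 = count_list s La"
      using a(3) by (cases xs2) auto
    have yf: "yf \<in> set (y # ys1)" using a(8) last_in_set by blast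
    have P: "\<not> ladder_edge ([La] @ s) xf yf xs2 ys2 u v"
      if "u \<in> set (x # y # xs1 @ ys1)" "v \<in> set (x # y # xs1 @ ys1)" for u v
    proof -
      have "x1 \<notin> set (x # y # xs1 @ ys1)" using a(5) unfolding xs2 by auto
      then have "\<not> edge_pair xf x1 u v" using that unfolding edge_pair_def by blast
      moreover have "\<not> ladder_edge s x1 yf xs3 ys2 u v"
      proof
        assume e: "ladder_edge s x1 yf xs3 ys2 u v"
        have l: "length ys2 = count_list s Lb" using a(4) by simp
        have "c = yf" if "c \<in> set (x1 # yf # xs3 @ ys2)" "c \<in> set (x # y # xs1 @ ys1)" for c
          using that a(5) unfolding xs2 by auto
        then have "u = yf" "v = yf" using ladder_edge_verts[OF xs2(2) l e] that by blast+
        moreover have "\<not> ladder_edge s x1 yf xs3 ys2 yf yf"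
          by (rule ladder_edge_irrefl[OF _ xs2(2) l]) (use a(5) xs2 yf in auto)
        ultimately show False using e by simp
      qed
      ultimately show ?thesis unfolding xs2 by simp
    qed
    have "has_ladder V E (w @ [])"
    proof (rule has_ladder_joinI[OF a(1,2), of "[]" "[]" "[]" x y V xf yf E])
      fix u v assume uv: "u \<in> set (x # y # xs1 @ [] @ ys1 @ [])" "v \<in> set (x # y # xs1 @ [] @ ys1 @ [])"
      then have "u \<in> set (x # y # xs1 @ xs2 @ ys1 @ ys2)" "v \<in> set (x # y # xs1 @ xs2 @ ys1 @ ys2)"
        by auto
      then have "E u v = (ladder_edge w x y xs1 ys1 u v \<noteq> ladder_edge ([La] @ s) xf yf xs2 ys2 u v)" using a(9) by blast
      moreover have "\<not> ladder_edge ([La] @ s) xf yf xs2 ys2 u v" by (rule P) (use uv in simp_all)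
      ultimately show "E u v = (ladder_edge w x y xs1 ys1 u v \<noteq> ladder_edge [] xf yf [] [] u v)" by simp
    qed (use a(1-8) in auto)
    then show ?thesis unfolding ladder_minor_def using vminor_sub[of V V E] by auto
  qed
qed

lemma swl_swl [simp]: "swl \<circ> swl = id"
proof
  fix l show "(swl \<circ> swl) l = id l" by (cases l) auto
qed

lemma ladder_minor_drop_prefix_b: "ladder_minor V E (p @ [Lb] @ w) \<Longrightarrow> ladder_minor V E w"
  using ladder_minor_drop_prefix_a[of V E "map swl p" "map swl w"] ladder_minor_swap[of V E "p @ [Lb] @ w"]
    ladder_minor_swap[of V E "map swl w"] by simp

lemma ladder_minor_drop_suffix_b: "ladder_minor V E (w @ [Lb] @ s) \<Longrightarrow> ladder_minor V E w"
  using ladder_minor_drop_suffix_a[of V E "map swl w" "map swl s"] ladder_minor_swap[of V E "w @ [Lb] @ s"]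
    ladder_minor_swap[of V E "map swl w"] by simp

lemma ladder_minor_move_b: "ladder_minor V E (p @ [Lb] @ replicate i La @ s) \<longleftrightarrow> ladder_minor V E (p @ replicate i La @ [Lb] @ s)"
proof (induction i arbitrary: p)
  case (Suc i)
  have "ladder_minor V E (p @ [Lb] @ replicate (Suc i) La @ s) \<longleftrightarrow> ladder_minor V E (p @ [Lb, La] @ replicate i La @ s)"
    by simp
  also have "\<dots> \<longleftrightarrow> ladder_minor V E (p @ [La, Lb] @ replicate i La @ s)" by (rule ladder_minor_comm[symmetric])
  also have "\<dots> \<longleftrightarrow> ladder_minor V E ((p @ [La]) @ [Lb] @ replicate i La @ s)" by simp
  also have "\<dots> \<longleftrightarrow> ladder_minor V E ((p @ [La]) @ replicate i La @ [Lb] @ s)" by (rule Suc.IH)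
  finally show ?case by simp
qed simp

lemma ladder_minor_sort:
  "Lc \<notin> set u \<Longrightarrow> ladder_minor V E (p @ u @ s) \<longleftrightarrow>
     ladder_minor V E (p @ replicate (count_list u La) La @ replicate (count_list u Lb) Lb @ s)"
proof (induction u arbitrary: p)
  case (Cons l u)
  show ?case
  proof (cases l)
    case La
    then show ?thesis using Cons.IH[of "p @ [La]"] Cons.prems by simp
  next
    case Lb
    then show ?thesis using Cons.IH[of "p @ [Lb]"] Cons.prems
        ladder_minor_move_b[of V E p "count_list u La" "replicate (count_list u Lb) Lb @ s"] by simp
  next
    case Lc
    then show ?thesis using Cons.prems by simp
  qed
qed simp

lemma ladder_minor_perm:
  assumes "ladder_minor V E (p @ u @ s)" "Lc \<notin> set u" "Lc \<notin> set u'"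
    "count_list u La = count_list u' La" "count_list u Lb = count_list u' Lb"
  shows "ladder_minor V E (p @ u' @ s)"
  using assms ladder_minor_sort[of u V E p s] ladder_minor_sort[of u' V E p s] by simp

section \<open>Cycles as words with two rungs\<close>

definition cycle_minor :: "nat \<Rightarrow> 'a set \<Rightarrow> ('a \<Rightarrow> 'a \<Rightarrow> bool) \<Rightarrow> bool" where
  "cycle_minor n V E \<longleftrightarrow> (\<exists>cs F. length cs = n \<and> distinct cs \<and> set cs \<subseteq> V \<and> lceq V E F \<and>
     (\<forall>a<n. \<forall>b<n. F (cs ! a) (cs ! b) \<longleftrightarrow> b = Suc a mod n \<or> a = Suc b mod n))"

lemma cycle_minorI:
  assumes "vminor V E V' E'" "length cs = n" "distinct cs" "set cs \<subseteq> V'"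
    "\<forall>a<n. \<forall>b<n. E' (cs ! a) (cs ! b) \<longleftrightarrow> b = Suc a mod n \<or> a = Suc b mod n"
  shows "cycle_minor n V E"
proof -
  obtain F where F: "V' \<subseteq> V" "lceq V E F" "\<forall>x\<in>V'. \<forall>y\<in>V'. E' x y = F x y"
    using assms(1) unfolding vminor_def by blast
  have "cs ! a \<in> V'" if "a < n" for a using that assms(2,4) by auto
  then have "\<forall>a<n. \<forall>b<n. F (cs ! a) (cs ! b) \<longleftrightarrow> b = Suc a mod n \<or> a = Suc b mod n"
    using assms(5) F(3) by metis
  then show ?thesis unfolding cycle_minor_def using F assms by blast
qed

definition path_edge :: "'a list \<Rightarrow> 'a \<Rightarrow> 'a \<Rightarrow> bool" where
  "path_edge l u v \<longleftrightarrow> (\<exists>k. Suc k < length l \<and> edge_pair (l ! k) (l ! Suc k) u v)"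

lemma path_edge_Cons: "path_edge (x # y # l) u v \<longleftrightarrow> edge_pair x y u v \<or> path_edge (y # l) u v"
proof
  assume "path_edge (x # y # l) u v"
  then obtain k where k: "Suc k < length (x # y # l)" "edge_pair ((x # y # l) ! k) ((x # y # l) ! Suc k) u v"
    unfolding path_edge_def by blast
  then show "edge_pair x y u v \<or> path_edge (y # l) u v" by (cases k) (auto simp: path_edge_def)
next
  assume "edge_pair x y u v \<or> path_edge (y # l) u v"
  then show "path_edge (x # y # l) u v"
  proof
    assume "edge_pair x y u v" then show ?thesis unfolding path_edge_def by (intro exI[of _ 0]) simp
  next
    assume "path_edge (y # l) u v"
    then obtain k where "Suc k < length (y # l)" "edge_pair ((y # l) ! k) ((y # l) ! Suc k) u v" unfolding path_edge_def by blast
    then show ?thesis unfolding path_edge_def by (intro exI[of _ "Suc k"]) simp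
  qed
qed

lemma path_edge_single [simp]: "\<not> path_edge [x] u v" "\<not> path_edge [] u v" by (auto simp: path_edge_def)

lemma path_edge_in: "path_edge l u v \<Longrightarrow> u \<in> set l \<and> v \<in> set l"
  unfolding path_edge_def edge_pair_def by auto

lemma ladder_edge_path: "distinct (x # xs) \<Longrightarrow> length xs = i \<Longrightarrow> ladder_edge (replicate i La) x y xs [] u v \<longleftrightarrow> path_edge (x # xs) u v"
proof (induction i arbitrary: x xs)
  case (Suc i)
  then obtain x' xs' where xs: "xs = x' # xs'" by (cases xs) auto
  have "\<not> (edge_pair x x' u v \<and> path_edge (x' # xs') u v)" using Suc.prems xs path_edge_in[of "x' # xs'" u v] by (auto simp: edge_pair_def)
  then show ?case using Suc xs by (auto simp: path_edge_Cons)
qed auto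

lemma ladder_edge_path_b: "distinct (y # ys) \<Longrightarrow> length ys = i \<Longrightarrow> ladder_edge (replicate i Lb) x y [] ys u v \<longleftrightarrow> path_edge (y # ys) u v"
  using ladder_edge_path[of y ys i x u v] ladder_edge_swap[of "replicate i La" x y "[]" ys u v] by simp

lemma count_replicate [simp]: "count_list (replicate i a) b = (if a = b then i else 0)"
  by (induction i) auto

text \<open>The two rungs close the two frontier paths to a cycle. Without a letter between them
  they would be the same edge and cancel.\<close>

lemma cycle_minor_exact:
  assumes "ladder_minor V E (Lc # replicate i La @ replicate j Lb @ [Lc])" "i + j \<ge> 1"
  shows "cycle_minor (i + j + 2) V E"
proof -
  let ?w = "Lc # replicate i La @ replicate j Lb @ [Lc]"
  obtain V' E' where v: "vminor V E V' E'" "has_ladder V' E' ?w" using assms(1) unfolding ladder_minor_def by blast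
  then obtain x y xs ys where f: "fits ?w x y xs ys" "set (x # y # xs @ ys) \<subseteq> V'"
     "\<forall>u \<in> set (x # y # xs @ ys). \<forall>v \<in> set (x # y # xs @ ys). E' u v = ladder_edge ?w x y xs ys u v"
    unfolding has_ladder_def by blast
  have len: "length xs = i" "length ys = j" and d: "distinct (x # y # xs @ ys)"
    using f(1) unfolding fits_def by auto
  have e: "ladder_edge ?w x y xs ys u v = (edge_pair x y u v \<noteq> (path_edge (x # xs) u v \<noteq> (path_edge (y # ys) u v \<noteq>
     edge_pair (last (x # xs)) (last (y # ys)) u v)))" for u v
  proof -
    have "ladder_edge (replicate i La @ (replicate j Lb @ [Lc])) x y (xs @ []) ([] @ ys) u v =
      (ladder_edge (replicate i La) x y xs [] u v \<noteq> ladder_edge (replicate j Lb @ [Lc]) (last (x # xs)) (last [y]) [] ys u v)"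
      by (rule ladder_edge_append) (use len in auto)
    moreover have "ladder_edge (replicate j Lb @ [Lc]) (last (x # xs)) y ([] @ []) (ys @ []) u v =
      (ladder_edge (replicate j Lb) (last (x # xs)) y [] ys u v \<noteq> ladder_edge [Lc] (last [last (x # xs)]) (last (y # ys)) [] [] u v)"
      by (rule ladder_edge_append) (use len in auto)
    ultimately show ?thesis using ladder_edge_path[of x xs i y u v] ladder_edge_path_b[of y ys j "last (x # xs)" u v] len d by simp
  qed
  define cs where "cs = (x # xs) @ rev (y # ys)"
  \<comment> \<open>The cycle runs along the first path and back along the second; \<open>m\<close>
    is the position of the last vertex of the second path.\<close>
  define m where "m = Suc i"
  define n where "n = i + j + 2"
  have lc: "length cs = n" unfolding cs_def n_def using len by simp
  have dc: "distinct cs" unfolding cs_def using d by auto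
  have sc: "set cs = set (x # y # xs @ ys)" unfolding cs_def by auto
  have px: "(x # xs) ! t = cs ! t" if "t < m" for t
    using that len unfolding cs_def m_def by (auto simp: nth_append simp del: append_Cons)
  have py: "(y # ys) ! t = cs ! (n - 1 - t)" if "t < Suc j" for t
  proof -
    have "cs ! (n - 1 - t) = rev (y # ys) ! (n - 1 - t - length (x # xs))"
      unfolding cs_def nth_append using that len by (auto simp: n_def)
    also have "\<dots> = (y # ys) ! (length (y # ys) - Suc (n - 1 - t - length (x # xs)))"
      by (rule rev_nth) (use that len in \<open>auto simp: n_def\<close>)
    also have "length (y # ys) - Suc (n - 1 - t - length (x # xs)) = t" using that len by (auto simp: n_def)
    finally show ?thesis by simp
  qed
  have P: "edge_pair (cs ! s) (cs ! t) (cs ! a) (cs ! b) \<longleftrightarrow> a = s \<and> b = t \<or> a = t \<and> b = s"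
    if "s < n" "t < n" "a < n" "b < n" for s t a b
    unfolding edge_pair_def using that dc lc by (simp add: nth_eq_iff_index_eq)
  have x: "x = cs ! 0" "y = cs ! (n - 1)" using px[of 0] py[of 0] by (auto simp: m_def)
  have lx: "last (x # xs) = cs ! (m - 1)" using px[of "m - 1"] len last_conv_nth[of "x # xs"]
    by (simp del: last.simps add: m_def)
  have ly: "last (y # ys) = cs ! m" using py[of j] len last_conv_nth[of "y # ys"]
    by (simp del: last.simps add: m_def n_def)
  have pex: "path_edge (x # xs) (cs ! a) (cs ! b) \<longleftrightarrow> (b = Suc a \<and> b < m) \<or> (a = Suc b \<and> a < m)"
    if "a < n" "b < n" for a b
  proof -
    have "path_edge (x # xs) (cs ! a) (cs ! b) \<longleftrightarrow> (\<exists>k. Suc k < m \<and> edge_pair (cs ! k) (cs ! Suc k) (cs ! a) (cs ! b))"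
    proof -
      have "Suc k < length (x # xs) \<and> edge_pair ((x # xs) ! k) ((x # xs) ! Suc k) u v \<longleftrightarrow>
        Suc k < m \<and> edge_pair (cs ! k) (cs ! Suc k) u v" for k u v
      proof (cases "Suc k < m")
        case True
        have "(x # xs) ! k = cs ! k" "(x # xs) ! Suc k = cs ! Suc k" by (rule px, use True in simp)+
        then show ?thesis using True len by (simp only: m_def length_Cons)
      qed (use len in \<open>simp add: m_def\<close>)
      then show ?thesis unfolding path_edge_def by (simp only:)
    qed
    also have "\<dots> \<longleftrightarrow> (\<exists>k. Suc k < m \<and> (a = k \<and> b = Suc k \<or> a = Suc k \<and> b = k))"
      by (rule ex_cong1, rule conj_cong, rule refl, rule P[OF _ _ that]) (auto simp: m_def n_def)
    finally show ?thesis by auto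
  qed
  have pey: "path_edge (y # ys) (cs ! a) (cs ! b) \<longleftrightarrow> (b = Suc a \<and> m \<le> a) \<or> (a = Suc b \<and> m \<le> b)"
    if "a < n" "b < n" for a b
  proof -
    have "path_edge (y # ys) (cs ! a) (cs ! b) \<longleftrightarrow>
      (\<exists>k. Suc k < Suc j \<and> edge_pair (cs ! (n - 1 - k)) (cs ! (n - 1 - Suc k)) (cs ! a) (cs ! b))"
    proof -
      have "Suc k < length (y # ys) \<and> edge_pair ((y # ys) ! k) ((y # ys) ! Suc k) u v \<longleftrightarrow>
        Suc k < Suc j \<and> edge_pair (cs ! (n - 1 - k)) (cs ! (n - 1 - Suc k)) u v" for k u v
      proof (cases "Suc k < Suc j")
        case True
        have "(y # ys) ! k = cs ! (n - 1 - k)" "(y # ys) ! Suc k = cs ! (n - 1 - Suc k)"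
          by (rule py, use True in simp)+
        then show ?thesis using True len by (simp only: length_Cons)
      qed (use len in simp)
      then show ?thesis unfolding path_edge_def by (simp only:)
    qed
    also have "\<dots> \<longleftrightarrow> (\<exists>k. Suc k < Suc j \<and> (a = n - 1 - k \<and> b = n - 1 - Suc k \<or> a = n - 1 - Suc k \<and> b = n - 1 - k))"
      by (rule ex_cong1, rule conj_cong, rule refl, rule P[OF _ _ that]) (auto simp: m_def n_def)
    also have "\<dots> \<longleftrightarrow> (b = Suc a \<and> m \<le> a) \<or> (a = Suc b \<and> m \<le> b)"
    proof
      assume "(b = Suc a \<and> m \<le> a) \<or> (a = Suc b \<and> m \<le> b)"
      then show "\<exists>k. Suc k < Suc j \<and> (a = n - 1 - k \<and> b = n - 1 - Suc k \<or> a = n - 1 - Suc k \<and> b = n - 1 - k)"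
        using that by (intro exI[of _ "n - 1 - max a b"]) (auto simp: m_def n_def max_def)
    qed (auto simp: m_def n_def)
    finally show ?thesis .
  qed
  have "\<forall>a<n. \<forall>b<n. E' (cs ! a) (cs ! b) \<longleftrightarrow> b = Suc a mod n \<or> a = Suc b mod n"
  proof (intro allI impI)
    fix a b assume ab: "a < n" "b < n"
    have "cs ! a \<in> set cs" "cs ! b \<in> set cs" using ab lc by auto
    then have "E' (cs ! a) (cs ! b) = ladder_edge ?w x y xs ys (cs ! a) (cs ! b)" using f(3) sc by blast
    also have "\<dots> \<longleftrightarrow> ((a = 0 \<and> b = n - 1 \<or> a = n - 1 \<and> b = 0) \<noteq>
      (((b = Suc a \<and> b < m) \<or> (a = Suc b \<and> a < m)) \<noteq> (((b = Suc a \<and> m \<le> a) \<or> (a = Suc b \<and> m \<le> b)) \<noteq>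
        (a = m - 1 \<and> b = m \<or> a = m \<and> b = m - 1))))"
      unfolding e lx ly pex[OF ab] pey[OF ab] unfolding x
      using P[of 0 "n - 1" a b] P[of "m - 1" m a b] ab by (simp add: m_def n_def)
    also have "\<dots> \<longleftrightarrow> (b = Suc a \<or> a = Suc b) \<or> (a = 0 \<and> b = n - 1 \<or> a = n - 1 \<and> b = 0)"
    proof -
      consider "b = Suc a" "b < m" | "b = Suc a" "m \<le> a" | "b = Suc a" "a = m - 1"
        | "a = Suc b" "a < m" | "a = Suc b" "m \<le> b" | "a = Suc b" "b = m - 1" | "b \<noteq> Suc a" "a \<noteq> Suc b"
        by (cases "b = Suc a"; cases "a = Suc b") (fastforce simp: m_def)+
      then show ?thesis
        by cases (use ab assms(2) in \<open>auto simp: m_def n_def\<close>)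
    qed
    also have "\<dots> \<longleftrightarrow> b = Suc a mod n \<or> a = Suc b mod n"
    proof -
      have "Suc c mod n = (if c = n - 1 then 0 else Suc c)" if "c < n" for c using that by auto
      then show ?thesis using ab by auto
    qed
    finally show "E' (cs ! a) (cs ! b) \<longleftrightarrow> b = Suc a mod n \<or> a = Suc b mod n" .
  qed
  then show ?thesis using cycle_minorI[OF v(1) lc dc] sc f(2) unfolding n_def by blast
qed

text \<open>A cycle with more than \<open>n \<ge> 4\<close> vertices has three letters between its
  rungs, hence two equal ones, and \<open>ladder_minor_aa\<close> shortens it by one.\<close>

lemma cycle_minor_word:
  assumes "ladder_minor V E (Lc # replicate i La @ replicate j Lb @ [Lc])" "n \<ge> 4" "i + j + 2 \<ge> n"
  shows "cycle_minor n V E"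
  using assms
proof (induction "i + j + 2 - n" arbitrary: i j)
  case 0
  then have "i + j + 2 = n" "i + j \<ge> 1" by linarith+
  then show ?case using cycle_minor_exact[of V E i j] 0(2) by simp
next
  case (Suc k)
  then have "i \<ge> 2 \<or> j \<ge> 2" by linarith
  then show ?case
  proof
    assume "i \<ge> 2"
    then obtain i' where i: "i = Suc (Suc i')" by (metis add_2_eq_Suc le_Suc_ex)
    have "ladder_minor V E ([Lc] @ [La] @ replicate i' La @ replicate j Lb @ [Lc])"
      by (rule ladder_minor_aa) (use Suc.prems(1) i in simp)
    then show ?case using Suc.hyps(1)[of "Suc i'" j] Suc.hyps(2) Suc.prems i by simp
  next
    assume "j \<ge> 2"
    then obtain j' where j: "j = Suc (Suc j')" by (metis add_2_eq_Suc le_Suc_ex)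
    have sw: "ladder_minor V E (Lc # replicate j La @ replicate i Lb @ [Lc])" if "ladder_minor V E (Lc # replicate i La @ replicate j Lb @ [Lc])" for i j
      using ladder_minor_perm[of V E "[Lc]" "replicate i Lb @ replicate j La" "[Lc]" "replicate j La @ replicate i Lb"]
        ladder_minor_swap[OF that] by simp
    have "ladder_minor V E ([Lc] @ [La] @ replicate j' La @ replicate i Lb @ [Lc])"
      by (rule ladder_minor_aa) (use sw[OF Suc.prems(1)] j in simp)
    then have "ladder_minor V E (Lc # replicate i La @ replicate (Suc j') Lb @ [Lc])" using sw[of "Suc j'" i] by simp
    then show ?case using Suc.hyps(1)[of i "Suc j'"] Suc.hyps(2) Suc.prems j by simp
  qed
qed

subsection \<open>Run lists\<close>

text \<open>A word beginning and ending with \<open>Lc\<close> is given by the list of its runs, that is, of the numbers of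
  letters \<open>La\<close> and \<open>Lb\<close> between consecutive letters \<open>Lc\<close>; the order inside a run does not matter.\<close>

definition run :: "nat \<times> nat \<Rightarrow> letter list" where
  "run r = replicate (fst r) La @ replicate (snd r) Lb"

fun enc :: "(nat \<times> nat) list \<Rightarrow> letter list" where
  "enc [] = [Lc]"
| "enc (r # rs) = Lc # run r @ enc rs"

definition encp :: "(nat \<times> nat) list \<Rightarrow> letter list" where
  "encp rs = concat (map (\<lambda>r. Lc # run r) rs)"

definition runs_minor :: "'a set \<Rightarrow> ('a \<Rightarrow> 'a \<Rightarrow> bool) \<Rightarrow> (nat \<times> nat) list \<Rightarrow> bool" where
  "runs_minor V E rs \<longleftrightarrow> ladder_minor V E (enc rs)"

lemma enc_append: "enc (ps @ qs) = encp ps @ enc qs"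
  by (induction ps) (auto simp: encp_def)

lemma encp_snoc [simp]: "encp (ps @ [r]) = encp ps @ Lc # run r" "encp [] = []"
  by (auto simp: encp_def)

lemma run_simps [simp]: "Lc \<notin> set (run r)" "count_list (run r) La = fst r" "count_list (run r) Lb = snd r"
  by (auto simp: run_def)

lemma run_Suc_a: "run (Suc i, j) = La # run (i, j)" by (simp add: run_def)

lemma runs_minor_replace:
  assumes "ladder_minor V E (encp ps @ Lc # u @ s)" "Lc \<notin> set u" "Lc \<notin> set u'"
    "count_list u La = count_list u' La" "count_list u Lb = count_list u' Lb"
  shows "ladder_minor V E (encp ps @ Lc # u' @ s)"
  using ladder_minor_perm[of V E "encp ps @ [Lc]" u s u'] assms by simp

text \<open>A run may be spelled in any order, so the letters that a rewriting rule needs can be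
  moved next to a neighbouring \<open>Lc\<close>.\<close>

lemma runs_minor_first:
  assumes "runs_minor V E (ps @ (i, j) # qs)" "Lc \<notin> set u" "count_list u La = i" "count_list u Lb = j"
  shows "ladder_minor V E (encp ps @ Lc # u @ enc qs)"
  using runs_minor_replace[of V E ps "run (i, j)" "enc qs" u] assms by (simp add: runs_minor_def enc_append)

lemma runs_minorI:
  assumes "ladder_minor V E (encp ps @ Lc # u @ enc qs)" "Lc \<notin> set u" "count_list u La = i" "count_list u Lb = j"
  shows "runs_minor V E (ps @ (i, j) # qs)"
  using runs_minor_replace[of V E ps u "enc qs" "run (i, j)"] assms by (simp add: runs_minor_def enc_append)

lemma ladder_minor_swap_enc:
  "ladder_minor V E (p @ map swl (enc rs)) \<Longrightarrow> ladder_minor V E (p @ enc (map prod.swap rs))"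
proof (induction rs arbitrary: p)
  case (Cons r rs)
  have "ladder_minor V E ((p @ [Lc]) @ map swl (run r) @ map swl (enc rs))" using Cons.prems by simp
  then have "ladder_minor V E ((p @ [Lc]) @ run (prod.swap r) @ map swl (enc rs))"
    by (rule ladder_minor_perm) (auto simp: run_def)
  then show ?case using Cons.IH[of "p @ Lc # run (prod.swap r)"] by simp
qed simp

lemma runs_minor_swap: "runs_minor V E rs \<Longrightarrow> runs_minor V E (map prod.swap rs)"
  using ladder_minor_swap_enc[of V E "[]" rs] ladder_minor_swap[of V E "enc rs"] by (simp add: runs_minor_def)

text \<open>An empty run stands for two consecutive letters \<open>Lc\<close>, which cancel and let
  the neighbouring runs merge.\<close>

lemma runs_minor_cancel: "runs_minor V E (ps @ (i, j) # (0, 0) # (k, l) # qs) \<Longrightarrow> runs_minor V E (ps @ (i + k, j + l) # qs)"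
proof -
  assume "runs_minor V E (ps @ (i, j) # (0, 0) # (k, l) # qs)"
  then have "ladder_minor V E ((encp ps @ Lc # run (i, j)) @ [Lc, Lc] @ run (k, l) @ enc qs)"
    by (simp add: runs_minor_def enc_append run_def)
  then have "ladder_minor V E (encp ps @ Lc # (run (i, j) @ run (k, l)) @ enc qs)" unfolding ladder_minor_cc by simp
  then show ?thesis by (rule runs_minorI) (auto simp: run_def)
qed

lemma runs_minor_contract_a: "runs_minor V E (ps @ (Suc (Suc i), j) # qs) \<Longrightarrow> runs_minor V E (ps @ (Suc i, j) # qs)"
  using ladder_minor_aa[of V E "encp ps @ [Lc]" "run (i, j) @ enc qs"]
  by (simp add: runs_minor_def enc_append run_Suc_a)

lemma runs_minor_contract_b: "runs_minor V E (ps @ (i, Suc (Suc j)) # qs) \<Longrightarrow> runs_minor V E (ps @ (i, Suc j) # qs)"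
  using runs_minor_contract_a[of V E "map prod.swap ps" j i "map prod.swap qs"]
    runs_minor_swap[of V E "ps @ (i, Suc (Suc j)) # qs"]
    runs_minor_swap[of V E "map prod.swap ps @ (Suc j, i) # map prod.swap qs"] by (simp add: comp_def)

lemma runs_minor_contract:
  assumes "runs_minor V E (ps @ (i, j) # qs)" "i' \<le> i" "j' \<le> j" "i' \<ge> 1 \<or> i = 0" "j' \<ge> 1 \<or> j = 0"
  shows "runs_minor V E (ps @ (i', j') # qs)"
proof -
  have a: "runs_minor V E (ps @ (i', j) # qs)" using assms(2,1,4)
  proof (induction rule: inc_induct)
    case (step k)
    then show ?case using runs_minor_contract_a[of V E ps "k - 1" j qs] by (cases k) auto
  qed
  show ?thesis using assms(3) a assms(5)
  proof (induction rule: inc_induct)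
    case (step k)
    then show ?case using runs_minor_contract_b[of V E ps i' "k - 1" qs] by (cases k) auto
  qed
qed

lemma runs_minor_aca: "runs_minor V E (ps @ (Suc i, j) # (Suc k, l) # qs) \<Longrightarrow> runs_minor V E (ps @ (i, j) # (1, 0) # (k, l) # qs)"
proof -
  assume "runs_minor V E (ps @ (Suc i, j) # (Suc k, l) # qs)"
  then have "ladder_minor V E (encp ps @ Lc # (run (i, j) @ [La]) @ enc ((Suc k, l) # qs))"
    by (rule runs_minor_first) auto
  then have "ladder_minor V E ((encp ps @ Lc # run (i, j)) @ [La, Lc, La] @ run (k, l) @ enc qs)"
    by (simp add: run_Suc_a)
  from ladder_minor_aca[OF this] show ?thesis by (simp add: runs_minor_def enc_append run_def)
qed

lemma runs_minor_abcab:
  "runs_minor V E (ps @ (Suc i, Suc j) # (Suc k, Suc l) # qs) \<Longrightarrow>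
   runs_minor V E (ps @ (i, j) # (1, 1) # (l, k) # map prod.swap qs)"
proof -
  assume "runs_minor V E (ps @ (Suc i, Suc j) # (Suc k, Suc l) # qs)"
  then have "ladder_minor V E (encp ps @ Lc # (run (i, j) @ [La, Lb]) @ enc ((Suc k, Suc l) # qs))"
    by (rule runs_minor_first) auto
  then have "runs_minor V E ((ps @ [(Suc i, Suc j)]) @ (Suc k, Suc l) # qs)"
    using runs_minor_replace[of V E ps "run (i, j) @ [La, Lb]" "enc ((Suc k, Suc l) # qs)" "run (Suc i, Suc j)"]
    by (simp add: runs_minor_def enc_append)
  then have "ladder_minor V E (encp (ps @ [(Suc i, Suc j)]) @ Lc # ([La, Lb] @ run (k, l)) @ enc qs)"
    by (rule runs_minor_first) auto
  then have "ladder_minor V E (encp ps @ Lc # run (Suc i, Suc j) @ Lc # La # Lb # run (k, l) @ enc qs)" by simp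
  then have "ladder_minor V E (encp ps @ Lc # (run (i, j) @ [La, Lb]) @ Lc # La # Lb # run (k, l) @ enc qs)"
    by (rule runs_minor_replace) auto
  then have "ladder_minor V E ((encp ps @ Lc # run (i, j)) @ [La, Lb, Lc, La, Lb] @ run (k, l) @ enc qs)" by simp
  from ladder_minor_abcab[OF this]
  have "ladder_minor V E ((encp ps @ Lc # run (i, j) @ Lc # [La, Lb] @ Lc # map swl (run (k, l))) @ map swl (enc qs))" by simp
  from ladder_minor_swap_enc[OF this]
  have "ladder_minor V E (encp (ps @ [(i, j), (1, 1)]) @ Lc # map swl (run (k, l)) @ enc (map prod.swap qs))"
    by (simp add: encp_def run_def)
  from runs_minorI[OF this, of l k] show ?thesis by (simp add: run_def)
qed

lemma runs_minor_acbca: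
  "runs_minor V E (ps @ (Suc i, j) # (0, 1) # (Suc k, l) # qs) \<Longrightarrow>
   runs_minor V E (ps @ (i, j) # (0, 1) # (1, 0) # (l, k) # map prod.swap qs)"
proof -
  assume "runs_minor V E (ps @ (Suc i, j) # (0, 1) # (Suc k, l) # qs)"
  then have "ladder_minor V E (encp ps @ Lc # (run (i, j) @ [La]) @ enc ((0, 1) # (Suc k, l) # qs))"
    by (rule runs_minor_first) auto
  then have "ladder_minor V E ((encp ps @ Lc # run (i, j)) @ [La, Lc, Lb, Lc, La] @ run (k, l) @ enc qs)"
    by (simp add: run_Suc_a run_def)
  from ladder_minor_acbca[OF this]
  have "ladder_minor V E ((encp ps @ Lc # run (i, j) @ [Lc, Lb, Lc, La, Lc] @ map swl (run (k, l))) @ map swl (enc qs))" by simp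
  from ladder_minor_swap_enc[OF this]
  have "ladder_minor V E (encp (ps @ [(i, j), (0, 1), (1, 0)]) @ Lc # map swl (run (k, l)) @ enc (map prod.swap qs))"
    by (simp add: encp_def run_def)
  from runs_minorI[OF this, of l k] show ?thesis by (simp add: run_def)
qed

lemma runs_minor_start: "runs_minor V E ((1, 0) # (0, 1) # (i, j) # qs) \<Longrightarrow> runs_minor V E ((Suc i, Suc j) # qs)"
proof -
  assume "runs_minor V E ((1, 0) # (0, 1) # (i, j) # qs)"
  then have "ladder_minor V E ([Lc, La, Lc, Lb, Lc] @ run (i, j) @ enc qs)" by (simp add: runs_minor_def run_def)
  from ladder_minor_start[OF this] have "ladder_minor V E (encp [] @ Lc # ([La, Lb] @ run (i, j)) @ enc qs)" by simp
  from runs_minorI[OF this, of "Suc i" "Suc j"] show ?thesis by simp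
qed

lemma runs_minor_drop_prefix1: "runs_minor V E (r # qs) \<Longrightarrow> r \<noteq> (0, 0) \<Longrightarrow> runs_minor V E qs"
proof -
  assume a: "runs_minor V E (r # qs)" "r \<noteq> (0, 0)"
  obtain i j where r: "r = (i, j)" by (cases r)
  show ?thesis
  proof (cases j)
    case 0
    then obtain i' where i: "i = Suc i'" using a r by (cases i) auto
    have "run r = replicate i' La @ [La]" unfolding r i 0 run_def by (simp add: replicate_append_same)
    then show ?thesis using a(1) ladder_minor_drop_prefix_a[of V E "Lc # replicate i' La" "enc qs"] by (simp add: runs_minor_def)
  next
    case (Suc j')
    have "run r = run (i, j') @ [Lb]" unfolding r Suc run_def by (simp add: replicate_append_same)
    then show ?thesis using a(1) ladder_minor_drop_prefix_b[of V E "Lc # run (i, j')" "enc qs"] by (simp add: runs_minor_def)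
  qed
qed

lemma runs_minor_drop_suffix1: "runs_minor V E (rs @ [r]) \<Longrightarrow> r \<noteq> (0, 0) \<Longrightarrow> runs_minor V E rs"
proof -
  assume a: "runs_minor V E (rs @ [r])" "r \<noteq> (0, 0)"
  obtain i j where r: "r = (i, j)" by (cases r)
  have e: "enc rs = encp rs @ [Lc]" using enc_append[of rs "[]"] by simp
  show ?thesis
  proof (cases i)
    case (Suc i')
    then show ?thesis using a(1) r e ladder_minor_drop_suffix_a[of V E "encp rs @ [Lc]" "run (i', j) @ [Lc]"]
      by (simp add: runs_minor_def enc_append run_Suc_a)
  next
    case 0
    then obtain j' where j: "j = Suc j'" using a r by (cases j) auto
    show ?thesis using a(1) r e 0 j ladder_minor_drop_suffix_b[of V E "encp rs @ [Lc]" "run (0, j') @ [Lc]"]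
      by (simp add: runs_minor_def enc_append run_def)
  qed
qed

lemma runs_minor_drop_prefix: "runs_minor V E (ps @ qs) \<Longrightarrow> (0, 0) \<notin> set ps \<Longrightarrow> runs_minor V E qs"
  by (induction ps) (auto dest: runs_minor_drop_prefix1)

lemma runs_minor_drop_suffix: "runs_minor V E (ps @ qs) \<Longrightarrow> (0, 0) \<notin> set qs \<Longrightarrow> runs_minor V E ps"
  by (induction qs rule: rev_induct) (auto dest!: runs_minor_drop_suffix1[of V E "ps @ _", simplified])

definition rsize :: "nat \<times> nat \<Rightarrow> nat" where "rsize r = fst r + snd r"

text \<open>Everything before and after the run can be cut off; the run between its two rungs is a
  cycle of \<open>rsize r + 2\<close> vertices.\<close>

lemma runs_minor_long_run:
  assumes "runs_minor V E rs" "(0, 0) \<notin> set rs" "r \<in> set rs" "n \<ge> 4" "rsize r + 2 \<ge> n"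
  shows "cycle_minor n V E"
proof -
  obtain ps qs where rs: "rs = ps @ r # qs" using assms(3) by (meson split_list)
  have "runs_minor V E (r # qs)" using runs_minor_drop_prefix[of V E ps "r # qs"] assms rs by simp
  then have "runs_minor V E [r]" using runs_minor_drop_suffix[of V E "[r]" qs] assms rs by simp
  then show ?thesis using cycle_minor_word[of V E "fst r" "snd r" n] assms by (simp add: runs_minor_def run_def rsize_def)
qed

text \<open>Three consecutive chords at a common vertex cancel.\<close>

lemma runs_minor_XX: "runs_minor V E (ps @ (i, j) # (Suc p, 0) # (Suc q, 0) # (k, l) # qs) \<Longrightarrow>
   runs_minor V E (ps @ (Suc (i + k), j + l) # qs)"
proof -
  assume "runs_minor V E (ps @ (i, j) # (Suc p, 0) # (Suc q, 0) # (k, l) # qs)"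
  then have "runs_minor V E ((ps @ [(i, j)]) @ (Suc p, 0) # (Suc q, 0) # (k, l) # qs)" by simp
  then have "runs_minor V E ((ps @ [(i, j)]) @ (1, 0) # (Suc q, 0) # (k, l) # qs)" by (rule runs_minor_contract) auto
  then have "runs_minor V E ((ps @ [(i, j), (1, 0)]) @ (Suc q, 0) # (k, l) # qs)" by simp
  then have "runs_minor V E ((ps @ [(i, j), (1, 0)]) @ (1, 0) # (k, l) # qs)" by (rule runs_minor_contract) auto
  then have "runs_minor V E ((ps @ [(i, j)]) @ (Suc 0, 0) # (Suc 0, 0) # (k, l) # qs)" by simp
  from runs_minor_aca[OF this] have "runs_minor V E (ps @ (i, j) # (0, 0) # (1, 0) # (0, 0) # (k, l) # qs)" by simp
  from runs_minor_cancel[OF this] have "runs_minor V E (ps @ (Suc i, j) # (0, 0) # (k, l) # qs)" by simp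
  from runs_minor_cancel[OF this] show ?thesis by simp
qed

lemma runs_minor_YY: "runs_minor V E (ps @ (i, j) # (0, Suc p) # (0, Suc q) # (k, l) # qs) \<Longrightarrow>
   runs_minor V E (ps @ (i + k, Suc (j + l)) # qs)"
  using runs_minor_XX[of V E "map prod.swap ps" j i p q l k "map prod.swap qs"]
    runs_minor_swap[of V E "ps @ (i, j) # (0, Suc p) # (0, Suc q) # (k, l) # qs"]
    runs_minor_swap[of V E "map prod.swap ps @ (Suc (j + l), i + k) # map prod.swap qs"]
  by (simp add: comp_def)

lemma runs_minor_bcb: "runs_minor V E (ps @ (i, Suc j) # (k, Suc l) # qs) \<Longrightarrow> runs_minor V E (ps @ (i, j) # (0, 1) # (k, l) # qs)"
  using runs_minor_aca[of V E "map prod.swap ps" j i l k "map prod.swap qs"]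
    runs_minor_swap[of V E "ps @ (i, Suc j) # (k, Suc l) # qs"]
    runs_minor_swap[of V E "map prod.swap ps @ (j, i) # (1, 0) # (l, k) # map prod.swap qs"]
  by (simp add: comp_def)

lemma runs_minor_bcacb:
  "runs_minor V E (ps @ (i, Suc j) # (1, 0) # (k, Suc l) # qs) \<Longrightarrow>
   runs_minor V E (ps @ (i, j) # (1, 0) # (0, 1) # (l, k) # map prod.swap qs)"
  using runs_minor_acbca[of V E "map prod.swap ps" j i l k "map prod.swap qs"]
    runs_minor_swap[of V E "ps @ (i, Suc j) # (1, 0) # (k, Suc l) # qs"]
    runs_minor_swap[of V E "map prod.swap ps @ (j, i) # (0, 1) # (1, 0) # (k, l) # qs"]
  by (simp add: comp_def)

text \<open>In the following names \<open>X\<close>, \<open>Y\<close> and \<open>Q\<close> stand for runs in \<open>La\<close> only, in \<open>Lb\<close> only, and in both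
  letters: a run \<open>u\<close> followed by runs of the given kinds and by \<open>s\<close> is rewritten to one longer run.\<close>

definition grows :: "'a set \<Rightarrow> ('a \<Rightarrow> 'a \<Rightarrow> bool) \<Rightarrow> nat \<times> nat \<Rightarrow> nat \<times> nat \<Rightarrow> (nat \<times> nat) list \<Rightarrow> bool" where
  "grows V E u s qs \<longleftrightarrow> (\<exists>i j. Suc i + Suc j \<ge> rsize u + rsize s + 1 \<and>
     (runs_minor V E ((Suc i, Suc j) # qs) \<or> runs_minor V E ((Suc i, Suc j) # map prod.swap qs)))"

lemma growsI:
  assumes "runs_minor V E ((Suc i, Suc j) # qs) \<or> runs_minor V E ((Suc i, Suc j) # map prod.swap qs)"
    "Suc i + Suc j \<ge> rsize u + rsize s + 1"
  shows "grows V E u s qs"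
  using assms unfolding grows_def by blast

text \<open>With both mixed runs contracted to \<open>(1, 1)\<close>, the pivot empties the runs
  around the new \<open>(1, 1)\<close>. It then merges with the runs on both sides.\<close>

lemma runs_minor_QQ:
  assumes "runs_minor V E ((i, j) # (Suc p, Suc q) # (Suc p', Suc q') # (k, l) # qs)"
  shows "runs_minor V E ((Suc (i + l), Suc (j + k)) # map prod.swap qs)"
proof -
  have "runs_minor V E ([(i, j)] @ (1, 1) # (Suc p', Suc q') # (k, l) # qs)"
    by (rule runs_minor_contract[of _ _ _ "Suc p" "Suc q"]) (use assms in auto)
  then have "runs_minor V E ([(i, j), (1, 1)] @ (1, 1) # (k, l) # qs)"
    by - (rule runs_minor_contract[of _ _ _ "Suc p'" "Suc q'"], auto)
  then have "runs_minor V E ([(i, j)] @ (Suc 0, Suc 0) # (Suc 0, Suc 0) # (k, l) # qs)" by simp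
  from runs_minor_abcab[OF this]
  have "runs_minor V E ([] @ (i, j) # (0, 0) # (1, 1) # (0, 0) # (l, k) # map prod.swap qs)" by simp
  from runs_minor_cancel[OF this] have "runs_minor V E ([] @ (Suc i, Suc j) # (0, 0) # (l, k) # map prod.swap qs)" by simp
  from runs_minor_cancel[OF this] show ?thesis by simp
qed

lemma grows_QQ: "runs_minor V E ((Suc i, Suc j) # (Suc p, Suc q) # (Suc p', Suc q') # (k, l) # qs) \<Longrightarrow>
   grows V E (Suc i, Suc j) (k, l) qs"
  by (drule runs_minor_QQ, rule growsI[of _ _ "Suc i + l" "Suc j + k"]) (auto simp: rsize_def)

text \<open>\<open>runs_minor_acbca\<close> empties the \<open>X\<close>, so the \<open>Y\<close>
  joins \<open>u\<close>, and it leaves two runs in \<open>La\<close> only for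
  \<open>runs_minor_XX\<close>.\<close>

lemma grows_XYQ:
  assumes "runs_minor V E ((Suc i, Suc j) # (Suc p, 0) # (0, Suc q) # (Suc p', Suc q') # (k, l) # qs)"
  shows "grows V E (Suc i, Suc j) (k, l) qs"
proof -
  have "runs_minor V E ([(Suc i, Suc j)] @ (1, 0) # (0, Suc q) # (Suc p', Suc q') # (k, l) # qs)"
    by (rule runs_minor_contract[of _ _ _ "Suc p" 0]) (use assms in auto)
  then have "runs_minor V E ([(Suc i, Suc j), (1, 0)] @ (0, 1) # (Suc p', Suc q') # (k, l) # qs)"
    by - (rule runs_minor_contract[of _ _ _ 0 "Suc q"], auto)
  then have "runs_minor V E ([(Suc i, Suc j), (1, 0), (0, 1)] @ (1, 1) # (k, l) # qs)"
    by - (rule runs_minor_contract[of _ _ _ "Suc p'" "Suc q'"], auto)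
  then have "runs_minor V E ([(Suc i, Suc j)] @ (Suc 0, 0) # (0, 1) # (Suc 0, 1) # (k, l) # qs)" by simp
  from runs_minor_acbca[OF this]
  have "runs_minor V E ([] @ (Suc i, Suc j) # (0, 0) # (0, 1) # (1, 0) # (1, 0) # (l, k) # map prod.swap qs)" by simp
  from runs_minor_cancel[OF this]
  have "runs_minor V E ([] @ (Suc i, Suc (Suc j)) # (Suc 0, 0) # (Suc 0, 0) # (l, k) # map prod.swap qs)" by simp
  from runs_minor_XX[OF this] show ?thesis
    by (intro growsI[of _ _ "Suc i + l" "Suc j + k"]) (auto simp: rsize_def)
qed

lemma grows_XQY:
  assumes "runs_minor V E ((Suc i, Suc j) # (Suc p, 0) # (Suc p', Suc q') # (0, Suc q) # (k, l) # qs)"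
  shows "grows V E (Suc i, Suc j) (k, l) qs"
proof -
  have "runs_minor V E ([(Suc i, Suc j), (Suc p, 0)] @ (1, 1) # (0, Suc q) # (k, l) # qs)"
    by (rule runs_minor_contract[of _ _ _ "Suc p'" "Suc q'"]) (use assms in auto)
  then have "runs_minor V E ([(Suc i, Suc j), (Suc p, 0), (1, 1)] @ (0, 1) # (k, l) # qs)"
    by - (rule runs_minor_contract[of _ _ _ 0 "Suc q"], auto)
  then have "runs_minor V E ([(Suc i, Suc j), (Suc p, 0)] @ (1, Suc 0) # (0, Suc 0) # (k, l) # qs)" by simp
  from runs_minor_bcb[OF this]
  have "runs_minor V E ([(Suc i, Suc j), (Suc p, 0), (1, 0)] @ (0, 1) # (0, 0) # (k, l) # qs)" by simp
  from runs_minor_cancel[OF this]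
  have "runs_minor V E ([] @ (Suc i, Suc j) # (Suc p, 0) # (Suc 0, 0) # (k, Suc l) # qs)" by simp
  from runs_minor_XX[OF this] show ?thesis
    by (intro growsI[of _ _ "Suc i + k" "Suc j + l"]) (auto simp: rsize_def)
qed

text \<open>Here \<open>u\<close> lends one letter: \<open>runs_minor_aca\<close> across its
  boundary empties the \<open>X\<close> and reduces the pattern to \<open>QQ\<close>, which more
  than repays it.\<close>

lemma grows_XQQ:
  assumes "runs_minor V E ((Suc i, Suc j) # (Suc p, 0) # (Suc p', Suc q') # (Suc p'', Suc q'') # (k, l) # qs)"
  shows "grows V E (Suc i, Suc j) (k, l) qs"
proof -
  have "runs_minor V E ([(Suc i, Suc j)] @ (1, 0) # (Suc p', Suc q') # (Suc p'', Suc q'') # (k, l) # qs)"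
    by (rule runs_minor_contract[of _ _ _ "Suc p" 0]) (use assms in auto)
  then have "runs_minor V E ([] @ (Suc i, Suc j) # (Suc 0, 0) # (Suc p', Suc q') # (Suc p'', Suc q'') # (k, l) # qs)" by simp
  from runs_minor_aca[OF this]
  have "runs_minor V E ([(i, Suc j)] @ (1, 0) # (0, 0) # (Suc p', Suc q') # (Suc p'', Suc q'') # (k, l) # qs)" by simp
  from runs_minor_cancel[OF this]
  have "runs_minor V E ((i, Suc j) # (Suc (Suc p'), Suc q') # (Suc p'', Suc q'') # (k, l) # qs)" by simp
  from runs_minor_QQ[OF this] show ?thesis
    by (intro growsI[of _ _ "i + l" "Suc j + k"]) (auto simp: rsize_def)
qed

lemma grows_QXY:
  assumes "runs_minor V E ((Suc i, Suc j) # (Suc p', Suc q') # (Suc p, 0) # (0, Suc q) # (k, l) # qs)"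
  shows "grows V E (Suc i, Suc j) (k, l) qs"
proof -
  have "runs_minor V E ([(Suc i, Suc j)] @ (1, 1) # (Suc p, 0) # (0, Suc q) # (k, l) # qs)"
    by (rule runs_minor_contract[of _ _ _ "Suc p'" "Suc q'"]) (use assms in auto)
  then have "runs_minor V E ([(Suc i, Suc j), (1, 1)] @ (1, 0) # (0, Suc q) # (k, l) # qs)"
    by - (rule runs_minor_contract[of _ _ _ "Suc p" 0], auto)
  then have "runs_minor V E ([(Suc i, Suc j), (1, 1), (1, 0)] @ (0, 1) # (k, l) # qs)"
    by - (rule runs_minor_contract[of _ _ _ 0 "Suc q"], auto)
  then have "runs_minor V E ([(Suc i, Suc j)] @ (1, Suc 0) # (1, 0) # (0, Suc 0) # (k, l) # qs)" by simp
  from runs_minor_bcacb[OF this]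
  have "runs_minor V E ([(Suc i, Suc j), (1, 0), (1, 0)] @ (0, 1) # (0, 0) # (l, k) # map prod.swap qs)" by simp
  from runs_minor_cancel[OF this]
  have "runs_minor V E ([] @ (Suc i, Suc j) # (Suc 0, 0) # (Suc 0, 0) # (l, Suc k) # map prod.swap qs)" by simp
  from runs_minor_XX[OF this] show ?thesis
    by (intro growsI[of _ _ "Suc i + l" "Suc j + k"]) (auto simp: rsize_def)
qed

text \<open>The two rules \<open>runs_minor_acbca\<close> and \<open>runs_minor_bcacb\<close> swap
  the rest once each, so \<open>qs\<close> reappears unswapped; \<open>u\<close> lends one
  letter.\<close>

lemma grows_QXQ:
  assumes "runs_minor V E ((Suc i, Suc j) # (Suc p', Suc q') # (Suc p, 0) # (Suc p'', Suc q'') # (k, l) # qs)"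
  shows "grows V E (Suc i, Suc j) (k, l) qs"
proof -
  have "runs_minor V E ([(Suc i, Suc j)] @ (1, 1) # (Suc p, 0) # (Suc p'', Suc q'') # (k, l) # qs)"
    by (rule runs_minor_contract[of _ _ _ "Suc p'" "Suc q'"]) (use assms in auto)
  then have "runs_minor V E ([(Suc i, Suc j), (1, 1)] @ (1, 0) # (Suc p'', Suc q'') # (k, l) # qs)"
    by - (rule runs_minor_contract[of _ _ _ "Suc p" 0], auto)
  then have "runs_minor V E ([(Suc i, Suc j), (1, 1), (1, 0)] @ (1, 1) # (k, l) # qs)"
    by - (rule runs_minor_contract[of _ _ _ "Suc p''" "Suc q''"], auto)
  then have "runs_minor V E ([(Suc i, Suc j)] @ (Suc 0, 1) # (Suc 0, 0) # (1, 1) # (k, l) # qs)" by simp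
  from runs_minor_aca[OF this]
  have "runs_minor V E ([(Suc i, Suc j), (0, 1)] @ (1, 0) # (0, 0) # (1, 1) # (k, l) # qs)" by simp
  from runs_minor_cancel[OF this]
  have "runs_minor V E ([] @ (Suc i, Suc j) # (0, 1) # (Suc 1, 1) # (k, l) # qs)" by (simp add: numeral_2_eq_2)
  from runs_minor_acbca[OF this]
  have "runs_minor V E ([(i, Suc j)] @ (0, Suc 0) # (1, 0) # (1, Suc 0) # (l, k) # map prod.swap qs)" by simp
  from runs_minor_bcacb[OF this]
  have "runs_minor V E ([] @ (i, Suc j) # (0, 0) # (1, 0) # (0, 1) # (0, 1) # (k, l) # qs)" by (simp add: comp_def)
  from runs_minor_cancel[OF this]
  have "runs_minor V E ([] @ (Suc i, Suc j) # (0, Suc 0) # (0, Suc 0) # (k, l) # qs)" by simp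
  from runs_minor_YY[OF this] show ?thesis
    by (intro growsI[of _ _ "i + k" "Suc j + l"]) (auto simp: rsize_def)
qed

lemma grows_XYXY:
  assumes "runs_minor V E ((Suc i, Suc j) # (Suc p, 0) # (0, Suc q) # (Suc p', 0) # (0, Suc q') # (k, l) # qs)"
  shows "grows V E (Suc i, Suc j) (k, l) qs"
proof -
  have "runs_minor V E ([(Suc i, Suc j)] @ (1, 0) # (0, Suc q) # (Suc p', 0) # (0, Suc q') # (k, l) # qs)"
    by (rule runs_minor_contract[of _ _ _ "Suc p" 0]) (use assms in auto)
  then have "runs_minor V E ([(Suc i, Suc j), (1, 0)] @ (0, 1) # (Suc p', 0) # (0, Suc q') # (k, l) # qs)"
    by - (rule runs_minor_contract[of _ _ _ 0 "Suc q"], auto)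
  then have "runs_minor V E ([(Suc i, Suc j), (1, 0), (0, 1)] @ (1, 0) # (0, Suc q') # (k, l) # qs)"
    by - (rule runs_minor_contract[of _ _ _ "Suc p'" 0], auto)
  then have "runs_minor V E ([(Suc i, Suc j)] @ (Suc 0, 0) # (0, 1) # (Suc 0, 0) # (0, Suc q') # (k, l) # qs)" by simp
  from runs_minor_acbca[OF this]
  have "runs_minor V E ([] @ (Suc i, Suc j) # (0, 0) # (0, 1) # (1, 0) # (0, 0) # (Suc q', 0) # (l, k) # map prod.swap qs)" by simp
  from runs_minor_cancel[OF this]
  have "runs_minor V E ([(Suc i, Suc (Suc j))] @ (1, 0) # (0, 0) # (Suc q', 0) # (l, k) # map prod.swap qs)" by simp
  from runs_minor_cancel[OF this]
  have "runs_minor V E ([] @ (Suc i, Suc (Suc j)) # (Suc (Suc q'), 0) # (l, k) # map prod.swap qs)" by simp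
  from runs_minor_aca[OF this]
  have "runs_minor V E ([] @ (i, Suc (Suc j)) # (Suc 0, 0) # (Suc q', 0) # (l, k) # map prod.swap qs)" by simp
  from runs_minor_XX[OF this] show ?thesis
    by (intro growsI[of _ _ "i + l" "Suc j + k"]) (auto simp: rsize_def)
qed

text \<open>\<open>runs_minor_aca\<close> empties the second \<open>X\<close>; its neighbours merge
  and the pattern becomes \<open>XQY\<close>.\<close>

lemma grows_XYXQ:
  assumes "runs_minor V E ((Suc i, Suc j) # (Suc p, 0) # (0, Suc q) # (Suc p', 0) # (Suc p'', Suc q'') # (k, l) # qs)"
  shows "grows V E (Suc i, Suc j) (k, l) qs"
proof -
  have "runs_minor V E ([(Suc i, Suc j), (Suc p, 0), (0, Suc q)] @ (1, 0) # (Suc p'', Suc q'') # (k, l) # qs)"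
    by (rule runs_minor_contract[of _ _ _ "Suc p'" 0]) (use assms in auto)
  then have "runs_minor V E ([(Suc i, Suc j), (Suc p, 0), (0, Suc q), (1, 0)] @ (1, 1) # (k, l) # qs)"
    by - (rule runs_minor_contract[of _ _ _ "Suc p''" "Suc q''"], auto)
  then have "runs_minor V E ([(Suc i, Suc j), (Suc p, 0), (0, Suc q)] @ (Suc 0, 0) # (Suc 0, 1) # (k, l) # qs)" by simp
  from runs_minor_aca[OF this]
  have "runs_minor V E ([(Suc i, Suc j), (Suc p, 0)] @ (0, Suc q) # (0, 0) # (1, 0) # (0, 1) # (k, l) # qs)" by simp
  from runs_minor_cancel[OF this]
  have "runs_minor V E ((Suc i, Suc j) # (Suc p, 0) # (Suc 0, Suc q) # (0, Suc 0) # (k, l) # qs)" by simp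
  from grows_XQY[OF this] show ?thesis .
qed

text \<open>\<open>runs_minor_aca\<close> empties the second \<open>X\<close> and shifts its letter,
  which turns the pattern into \<open>XYQ\<close>.\<close>

lemma grows_XQXY:
  assumes "runs_minor V E ((Suc i, Suc j) # (Suc p, 0) # (Suc p', Suc q') # (Suc p'', 0) # (0, Suc q) # (k, l) # qs)"
  shows "grows V E (Suc i, Suc j) (k, l) qs"
proof -
  have "runs_minor V E ([(Suc i, Suc j), (Suc p, 0)] @ (1, 1) # (Suc p'', 0) # (0, Suc q) # (k, l) # qs)"
    by (rule runs_minor_contract[of _ _ _ "Suc p'" "Suc q'"]) (use assms in auto)
  then have "runs_minor V E ([(Suc i, Suc j), (Suc p, 0), (1, 1)] @ (1, 0) # (0, Suc q) # (k, l) # qs)"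
    by - (rule runs_minor_contract[of _ _ _ "Suc p''" 0], auto)
  then have "runs_minor V E ([(Suc i, Suc j), (Suc p, 0)] @ (Suc 0, 1) # (Suc 0, 0) # (0, Suc q) # (k, l) # qs)" by simp
  from runs_minor_aca[OF this]
  have "runs_minor V E ([(Suc i, Suc j), (Suc p, 0), (0, 1)] @ (1, 0) # (0, 0) # (0, Suc q) # (k, l) # qs)" by simp
  from runs_minor_cancel[OF this]
  have "runs_minor V E ((Suc i, Suc j) # (Suc p, 0) # (0, Suc 0) # (Suc 0, Suc q) # (k, l) # qs)" by simp
  from grows_XYQ[OF this] show ?thesis .
qed

lemma grows_XQXQ:
  assumes "runs_minor V E ((Suc i, Suc j) # (Suc p, 0) # (Suc p', Suc q') # (Suc p'', 0) # (Suc p3, Suc q3) # (k, l) # qs)"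
  shows "grows V E (Suc i, Suc j) (k, l) qs"
proof -
  have "runs_minor V E ([(Suc i, Suc j), (Suc p, 0)] @ (1, 1) # (Suc p'', 0) # (Suc p3, Suc q3) # (k, l) # qs)"
    by (rule runs_minor_contract[of _ _ _ "Suc p'" "Suc q'"]) (use assms in auto)
  then have "runs_minor V E ([(Suc i, Suc j), (Suc p, 0), (1, 1)] @ (1, 0) # (Suc p3, Suc q3) # (k, l) # qs)"
    by - (rule runs_minor_contract[of _ _ _ "Suc p''" 0], auto)
  then have "runs_minor V E ([(Suc i, Suc j), (Suc p, 0), (1, 1), (1, 0)] @ (1, 1) # (k, l) # qs)"
    by - (rule runs_minor_contract[of _ _ _ "Suc p3" "Suc q3"], auto)
  then have "runs_minor V E ([(Suc i, Suc j), (Suc p, 0)] @ (1, Suc 0) # (1, 0) # (1, Suc 0) # (k, l) # qs)" by simp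
  from runs_minor_bcacb[OF this]
  have "runs_minor V E ([] @ (Suc i, Suc j) # (Suc p, 0) # (Suc 0, 0) # (1, 0) # (0, 1) # (0, 1) # (l, k) # map prod.swap qs)" by simp
  from runs_minor_XX[OF this]
  have "runs_minor V E ([] @ (Suc (Suc (Suc i)), Suc j) # (0, Suc 0) # (0, Suc 0) # (l, k) # map prod.swap qs)" by simp
  from runs_minor_YY[OF this] show ?thesis
    by (intro growsI[of _ _ "Suc (Suc i) + l" "Suc j + k"]) (auto simp: rsize_def)
qed

subsection \<open>Long words contain long cycles\<close>

text \<open>Weight of a pending run in the potential. The factor two for mixed runs makes a merge on
  the stack pay for the two input runs that it consumes.\<close>

definition rval :: "nat \<times> nat \<Rightarrow> nat" where
  "rval r = (if fst r = 0 \<or> snd r = 0 then 1 else 2 * rsize r)"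

text \<open>Up to exchanging the letters, an extension of one of these lists by one run is again in
  the list, or it contains a pattern that can be merged or absorbed with the help of the run after
  it. So three pending runs are enough.\<close>

inductive stackform :: "(nat \<times> nat) list \<Rightarrow> bool" where
  "stackform []"
| "stackform [(Suc p, 0)]"
| "stackform [(Suc p, Suc q)]"
| "stackform [(Suc p, 0), (0, Suc q)]"
| "stackform [(Suc p, 0), (Suc p', Suc q')]"
| "stackform [(Suc p', Suc q'), (Suc p, 0)]"
| "stackform [(Suc p, 0), (0, Suc q), (Suc p', 0)]"
| "stackform [(Suc p, 0), (Suc p', Suc q'), (Suc p'', 0)]"

lemma run_cases:
  assumes "r \<noteq> (0, 0)"
  obtains p where "r = (Suc p, 0)" | q where "r = (0, Suc q)" | p q where "r = (Suc p, Suc q)"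
  using assms by (cases r) (metis old.nat.exhaust)

lemma rsize_pos: "r \<noteq> (0, 0) \<Longrightarrow> rsize r \<ge> 1"
  by (cases r) (auto simp: rsize_def)

lemma swap_zero: "(0, 0) \<notin> set qs \<Longrightarrow> (0::nat, 0::nat) \<notin> set (map prod.swap qs)"
  by auto

text \<open>The stack holds the runs after the clean run \<open>u\<close> that have been read but not yet absorbed;
  every step either absorbs runs into \<open>u\<close> or enlarges the stack, so a large potential forces
  a run of length \<open>n - 2\<close>.\<close>

lemma cycle_minor_stack:
  assumes n: "n \<ge> 4"
  shows "stackform st \<Longrightarrow> runs_minor V E ((Suc i, Suc j) # st @ rest) \<Longrightarrow> (0, 0) \<notin> set rest \<Longrightarrow>
    (n - 1) * (Suc i + Suc j) + sum_list (map rval st) + length rest \<ge> (n - 1) * (n - 1) \<Longrightarrow> cycle_minor n V E"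
proof (induction "length rest" arbitrary: i j st rest rule: less_induct)
  case less
  let ?u = "(Suc i, Suc j)"
  have st0: "(0, 0) \<notin> set st" using less.prems(1) by cases auto
  show ?case
  proof (cases "\<exists>r \<in> set (?u # st @ rest). rsize r + 2 \<ge> n")
    case True
    then show ?thesis using runs_minor_long_run[OF less.prems(2) _ _ n] st0 less.prems(3) by auto
  next
    case False
    obtain m where m: "n = m + 4" using n by (metis add.commute le_Suc_ex)
    have sz: "rsize r \<le> m + 1" if "r \<in> set (?u # st @ rest)" for r using False that m by force
    have u: "Suc i + Suc j \<le> m + 1" using sz[of ?u] by (simp add: rsize_def)
    \<comment> \<open>At most one run on the stack is mixed and at most two others are
      present.\<close>
    have stv: "sum_list (map rval st) \<le> 2 * m + 4"
    proof -
      have "\<forall>r \<in> set st. rsize r \<le> m + 1" using sz by simp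
      with less.prems(1) show ?thesis by cases (simp_all add: rval_def rsize_def)
    qed
    have pot: "(m + 3) * (Suc i + Suc j) + sum_list (map rval st) + length rest \<ge> (m + 3) * (m + 3)"
      using less.prems(4) m by (simp add: numeral_eq_Suc)
    \<comment> \<open>With all runs of size at most \<open>n - 3\<close>, the clean run and the
      stack contribute at most \<open>(n - 1) * (n - 3) + 2 * n - 4\<close>, which is two less than
      \<open>(n - 1) * (n - 1)\<close>.\<close>
    have "length rest \<ge> 2"
    proof -
      have "(m + 3) * (Suc i + Suc j) \<le> (m + 3) * (m + 1)" using u by (rule mult_le_mono2)
      then show ?thesis using pot stv by (simp add: algebra_simps)
    qed
    then obtain s1 s2 rest' where rest: "rest = s1 # s2 # rest'"
      by (cases rest; cases "tl rest") simp_all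
    have s0: "s1 \<noteq> (0, 0)" "s2 \<noteq> (0, 0)" "(0, 0) \<notin> set rest'" using less.prems(3) rest by auto
    obtain k l where s2: "s2 = (k, l)" by (cases s2)
    have s2': "k + l \<ge> 1" using s0(2) s2 by auto
    have H: "runs_minor V E (?u # st @ s1 # (k, l) # rest')" using less.prems(2) rest s2 by simp
    have push: "cycle_minor n V E" if "stackform (st @ [s1])"
    proof (rule less.hyps[of "s2 # rest'" "st @ [s1]" i j])
      have "rval s1 \<ge> 1" using rsize_pos[OF s0(1)] by (simp add: rval_def)
      then show "(n - 1) * (n - 1) \<le> (n - 1) * (Suc i + Suc j) + sum_list (map rval (st @ [s1])) + length (s2 # rest')"
        using less.prems(4) rest by simp
    qed (use that H s2 s0 rest in auto)
    have pushs: "cycle_minor n V E" if "stackform (map prod.swap (st @ [s1]))"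
    proof (rule less.hyps[of "map prod.swap (s2 # rest')" "map prod.swap (st @ [s1])" j i])
      show "runs_minor V E ((Suc j, Suc i) # map prod.swap (st @ [s1]) @ map prod.swap (s2 # rest'))"
        using runs_minor_swap[OF H] s2 by simp
      have "rval (prod.swap r) = rval r" for r by (cases r) (auto simp: rval_def rsize_def)
      then have "sum_list (map rval (map prod.swap (st @ [s1]))) = sum_list (map rval (st @ [s1]))"
        by (simp add: comp_def)
      moreover have "rval s1 \<ge> 1" using rsize_pos[OF s0(1)] by (simp add: rval_def)
      ultimately show "(n - 1) * (n - 1) \<le> (n - 1) * (Suc j + Suc i) + sum_list (map rval (map prod.swap (st @ [s1])))
          + length (map prod.swap (s2 # rest'))"
        using less.prems(4) rest by (simp add: add.commute)
      show "(0, 0) \<notin> set (map prod.swap (s2 # rest'))" by (rule swap_zero) (use s0 in auto)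
    qed (use that rest in auto)
    have grow: "cycle_minor n V E" if g: "grows V E ?u (k, l) rest'"
    proof -
      obtain i' j' where ij: "Suc i' + Suc j' \<ge> rsize ?u + rsize (k, l) + 1"
        "runs_minor V E ((Suc i', Suc j') # rest') \<or> runs_minor V E ((Suc i', Suc j') # map prod.swap rest')"
        using g unfolding grows_def by blast
      have "Suc i' + Suc j' \<ge> Suc i + Suc j + 2" using ij(1) s2' by (simp add: rsize_def)
      \<comment> \<open>The weight \<open>n - 1\<close> per letter of the clean run is chosen for
        this: two new letters gain \<open>2 * (n - 1)\<close>, which covers the discarded stack (at
        most \<open>2 * n - 4\<close>) and the two input runs.\<close>
      then have "(m + 3) * (Suc i' + Suc j') \<ge> (m + 3) * (Suc i + Suc j + 2)" by (rule mult_le_mono2)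
      then have "(m + 3) * (Suc i' + Suc j') \<ge> (m + 3) * (Suc i + Suc j) + 2 * m + 6"
        by (simp add: algebra_simps)
      then have P: "(m + 3) * (Suc i' + Suc j') + length rest' \<ge> (m + 3) * (m + 3)"
        using pot stv rest by simp
      have P': "(n - 1) * (n - 1) \<le> (n - 1) * (Suc i' + Suc j') + sum_list (map rval []) + length q"
        if "length q = length rest'" for q
        using P that m by (simp add: numeral_eq_Suc)
      from ij(2) show ?thesis
      proof
        assume v: "runs_minor V E ((Suc i', Suc j') # rest')"
        show ?thesis
          by (rule less.hyps[of rest' "[]" i' j']) (use v rest s0 P'[of rest'] in \<open>auto intro: stackform.intros\<close>)
      next
        assume v: "runs_minor V E ((Suc i', Suc j') # map prod.swap rest')"
        show ?thesis
          by (rule less.hyps[of "map prod.swap rest'" "[]" i' j'])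
            (use v rest s0 P'[of "map prod.swap rest'"] swap_zero in \<open>auto intro: stackform.intros\<close>)
      qed
    qed
    \<comment> \<open>The summand 2 replaces \<open>s1\<close> and \<open>s2\<close>, which leave
      the input.\<close>
    have merge: "cycle_minor n V E" if "stackform st'" "runs_minor V E (?u # st' @ rest')"
      "sum_list (map rval st') \<ge> sum_list (map rval st) + 2" for st'
      by (rule less.hyps[of rest' st' i j]) (use that rest s0 less.prems(4) in auto)
    from less.prems(1) show ?thesis
    proof cases
      case 1
      show ?thesis by (rule run_cases[OF s0(1)]) (use 1 push pushs in \<open>auto intro: stackform.intros\<close>)
    next
      case (2 p)
      show ?thesis
      proof (rule run_cases[OF s0(1)])
        fix a assume s1: "s1 = (Suc a, 0)"
        have "runs_minor V E ([] @ ?u # (Suc p, 0) # (Suc a, 0) # (k, l) # rest')" using H 2 s1 by simp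
        from runs_minor_XX[OF this] show ?thesis
          by (intro grow growsI[of _ _ "Suc i + k" "j + l"]) (auto simp: rsize_def)
      qed (use 2 push in \<open>auto intro: stackform.intros\<close>)
    next
      case (3 p q)
      show ?thesis
      proof (rule run_cases[OF s0(1)])
        fix a b assume s1: "s1 = (Suc a, Suc b)"
        show ?thesis using H 3 s1 grows_QQ[of V E i j p q a b k l rest'] grow by simp
      qed (use 3 push pushs in \<open>auto intro: stackform.intros\<close>)
    next
      case (4 p q)
      show ?thesis
      proof (rule run_cases[OF s0(1)])
        fix a assume s1: "s1 = (0, Suc a)"
        have "runs_minor V E ([?u] @ (Suc p, 0) # (0, Suc q) # (0, Suc a) # (k, l) # rest')" using H 4 s1 by simp
        from runs_minor_YY[OF this] have v: "runs_minor V E (?u # [(Suc (p + k), Suc l)] @ rest')" by simp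
        show ?thesis
          by (rule merge[OF stackform.intros(3) v]) (use 4 in \<open>simp add: rval_def rsize_def\<close>)
      next
        fix a b assume s1: "s1 = (Suc a, Suc b)"
        show ?thesis using H 4 s1 grows_XYQ[of V E i j p q a b k l rest'] grow by simp
      qed (use 4 push in \<open>auto intro: stackform.intros\<close>)
    next
      case (5 p p' q')
      show ?thesis
      proof (rule run_cases[OF s0(1)])
        fix a assume s1: "s1 = (0, Suc a)"
        show ?thesis using H 5 s1 grows_XQY[of V E i j p p' q' a k l rest'] grow by simp
      next
        fix a b assume s1: "s1 = (Suc a, Suc b)"
        show ?thesis using H 5 s1 grows_XQQ[of V E i j p p' q' a b k l rest'] grow by simp
      qed (use 5 push in \<open>auto intro: stackform.intros\<close>)
    next
      case (6 p' q' p)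
      show ?thesis
      proof (rule run_cases[OF s0(1)])
        fix a assume s1: "s1 = (Suc a, 0)"
        have "runs_minor V E ([?u] @ (Suc p', Suc q') # (Suc p, 0) # (Suc a, 0) # (k, l) # rest')" using H 6 s1 by simp
        from runs_minor_XX[OF this] have v: "runs_minor V E (?u # [(Suc (Suc (p' + k)), Suc (q' + l))] @ rest')" by simp
        show ?thesis
          by (rule merge[OF stackform.intros(3) v]) (use 6 s2' in \<open>simp add: rval_def rsize_def\<close>)
      next
        fix a assume s1: "s1 = (0, Suc a)"
        show ?thesis using H 6 s1 grows_QXY[of V E i j p' q' p a k l rest'] grow by simp
      next
        fix a b assume s1: "s1 = (Suc a, Suc b)"
        show ?thesis using H 6 s1 grows_QXQ[of V E i j p' q' p a b k l rest'] grow by simp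
      qed
    next
      case (7 p q p')
      show ?thesis
      proof (rule run_cases[OF s0(1)])
        fix a assume s1: "s1 = (Suc a, 0)"
        have "runs_minor V E ([?u, (Suc p, 0)] @ (0, Suc q) # (Suc p', 0) # (Suc a, 0) # (k, l) # rest')" using H 7 s1 by simp
        from runs_minor_XX[OF this] have v: "runs_minor V E (?u # [(Suc p, 0), (Suc k, Suc (q + l))] @ rest')" by simp
        show ?thesis
          by (rule merge[OF stackform.intros(5) v]) (use 7 s2' in \<open>simp add: rval_def rsize_def\<close>)
      next
        fix a assume s1: "s1 = (0, Suc a)"
        show ?thesis using H 7 s1 grows_XYXY[of V E i j p q p' a k l rest'] grow by simp
      next
        fix a b assume s1: "s1 = (Suc a, Suc b)"
        show ?thesis using H 7 s1 grows_XYXQ[of V E i j p q p' a b k l rest'] grow by simp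
      qed
    next
      case (8 p p' q' p'')
      show ?thesis
      proof (rule run_cases[OF s0(1)])
        fix a assume s1: "s1 = (Suc a, 0)"
        have "runs_minor V E ([?u, (Suc p, 0)] @ (Suc p', Suc q') # (Suc p'', 0) # (Suc a, 0) # (k, l) # rest')" using H 8 s1 by simp
        from runs_minor_XX[OF this] have v: "runs_minor V E (?u # [(Suc p, 0), (Suc (Suc (p' + k)), Suc (q' + l))] @ rest')" by simp
        show ?thesis
          by (rule merge[OF stackform.intros(5) v]) (use 8 s2' in \<open>simp add: rval_def rsize_def\<close>)
      next
        fix a assume s1: "s1 = (0, Suc a)"
        show ?thesis using H 8 s1 grows_XQXY[of V E i j p p' q' p'' a k l rest'] grow by simp
      next
        fix a b assume s1: "s1 = (Suc a, Suc b)"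
        show ?thesis using H 8 s1 grows_XQXQ[of V E i j p p' q' p'' a b k l rest'] grow by simp
      qed
    qed
  qed
qed

text \<open>All rungs meet the same second vertex. Each use of \<open>runs_minor_XX\<close> absorbs
  three runs into the first one and adds at least two letters to it.\<close>

lemma cycle_minor_fan:
  assumes "n \<ge> 4" "runs_minor V E ((Suc i, 0) # rs)" "\<forall>r \<in> set rs. snd r = 0 \<and> r \<noteq> (0, 0)"
    "length rs \<ge> 3 * m" "i + 2 * m + 3 \<ge> n"
  shows "cycle_minor n V E"
  using assms(2-)
proof (induction m arbitrary: i rs)
  case 0
  then show ?case using runs_minor_long_run[OF 0(1) _ _ assms(1), of "(Suc i, 0)"] by (auto simp: rsize_def)
next
  case (Suc m)
  then obtain a b c rs' where rs: "rs = a # b # c # rs'"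
    by (cases rs; cases "tl rs"; cases "tl (tl rs)") auto
  obtain p where a: "a = (Suc p, 0)" using Suc.prems(2) rs by (cases a; cases "fst a") auto
  obtain q where b: "b = (Suc q, 0)" using Suc.prems(2) rs by (cases b; cases "fst b") auto
  obtain t where c: "c = (Suc t, 0)" using Suc.prems(2) rs by (cases c; cases "fst c") auto
  have "runs_minor V E ([] @ (Suc i, 0) # (Suc p, 0) # (Suc q, 0) # (Suc t, 0) # rs')" using Suc.prems(1) rs a b c by simp
  from runs_minor_XX[OF this] have "runs_minor V E ((Suc (Suc (Suc (i + t))), 0) # rs')" by simp
  from Suc.IH[OF this] show ?case using Suc.prems rs by simp
qed

text \<open>\<open>cycle_minor_stack\<close> needs a mixed run in front. A long initial stretch of
  runs in one letter is a fan. After a short one, either a mixed run follows, or the change of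
  letter at its end is made mixed by \<open>runs_minor_start\<close>.\<close>

lemma cycle_minor_runs:
  assumes n: "n \<ge> 4" and v: "runs_minor V E rs" and z: "(0, 0) \<notin> set rs"
    and len: "length rs \<ge> (n - 1) * (n - 1) + 2 * n + 3"
  shows "cycle_minor n V E"
proof -
  have Q: "cycle_minor n V E" if "runs_minor V E ((Suc i, Suc j) # qs)" "(0, 0) \<notin> set qs" "length qs \<ge> (n - 1) * (n - 1)" for i j qs
    by (rule cycle_minor_stack[OF n stackform.intros(1), of _ _ i j qs]) (use that in auto)
  have X: "cycle_minor n V E" if v: "runs_minor V E rs" and z: "(0, 0) \<notin> set rs"
    and len: "length rs \<ge> (n - 1) * (n - 1) + 2 * n + 3" and hd: "snd (hd rs) = 0" for rs
  proof -
    define xs where "xs = takeWhile (\<lambda>r. snd r = 0) rs"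
    define ys where "ys = dropWhile (\<lambda>r. snd r = 0) rs"
    have rs: "rs = xs @ ys" unfolding xs_def ys_def by simp
    have xs: "\<forall>r \<in> set xs. snd r = 0 \<and> r \<noteq> (0, 0)" using z unfolding xs_def
      by (auto dest: set_takeWhileD)
    have "rs \<noteq> []" using len by auto
    then have ne: "xs \<noteq> []" unfolding xs_def using hd by (cases rs) auto
    show ?thesis
    \<comment> \<open>The fan needs a first run and \<open>n div 2\<close> triples. If they are
      missing, the summand \<open>2 * n + 3\<close> leaves \<open>(n - 1) * (n - 1) + 2\<close>
      runs: two to build the mixed run, the others for the stack.\<close>
    proof (cases "length xs \<ge> 3 * (n div 2) + 1")
      case True
      obtain x xs' where x: "xs = x # xs'" using ne by (cases xs) auto
      obtain p where p: "x = (Suc p, 0)" using xs x by (cases x; cases "fst x") auto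
      have "runs_minor V E xs" using runs_minor_drop_suffix[of V E xs ys] v z rs by simp
      then show ?thesis using cycle_minor_fan[OF n, of V E p xs' "n div 2"] x p xs True by auto
    next
      case False
      obtain xs' x where x: "xs = xs' @ [x]" using ne by (cases xs rule: rev_cases) auto
      obtain p where p: "x = (Suc p, 0)" using xs x by (cases x; cases "fst x") auto
      have ly: "length ys \<ge> (n - 1) * (n - 1) + 2" using False len rs by simp
      then have "2 \<le> length ys" by linarith
      then obtain s t ys' where y: "ys = s # t # ys'" by (cases ys; cases "tl ys") simp_all
      have sn: "snd s \<noteq> 0" using y hd_dropWhile[of "\<lambda>r. snd r = 0" rs] unfolding ys_def by simp
      have V1: "runs_minor V E (x # ys)" using runs_minor_drop_prefix[of V E xs' "x # ys"] v z rs x by simp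
      show ?thesis
      proof (cases "fst s")
        case 0
        then obtain q where s: "s = (0, Suc q)" using sn by (cases s; cases "snd s") auto
        obtain k l where t: "t = (k, l)" by (cases t)
        have "runs_minor V E ([] @ (Suc p, 0) # s # t # ys')" using V1 p y by simp
        then have "runs_minor V E ([] @ (1, 0) # s # t # ys')" by - (rule runs_minor_contract, auto)
        then have "runs_minor V E ([(1, 0)] @ (0, Suc q) # t # ys')" using s by simp
        then have "runs_minor V E ([(1, 0)] @ (0, 1) # t # ys')" by - (rule runs_minor_contract, auto)
        then have "runs_minor V E ((1, 0) # (0, 1) # (k, l) # ys')" using t by simp
        from runs_minor_start[OF this] show ?thesis by (rule Q) (use z rs y ly in auto)
      next
        case (Suc a)
        then obtain q where s: "s = (Suc a, Suc q)" using sn by (cases s; cases "snd s") auto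
        have "runs_minor V E ys" using runs_minor_drop_prefix[of V E "[x]" ys] V1 p by simp
        then show ?thesis using Q[of a q "t # ys'"] z rs y ly s by auto
      qed
    qed
  qed
  obtain r qs where r: "rs = r # qs" using len by (cases rs) auto
  have r0: "r \<noteq> (0, 0)" using z r by auto
  show ?thesis
  proof (rule run_cases[OF r0])
    fix p assume "r = (Suc p, 0)"
    then show ?thesis using X[OF v z len] r by simp
  next
    fix q assume "r = (0, Suc q)"
    then show ?thesis using X[OF runs_minor_swap[OF v] swap_zero[OF z]] len r by simp
  next
    fix p q assume "r = (Suc p, Suc q)"
    then show ?thesis using Q[of p q qs] v z len r by simp
  qed
qed

subsection \<open>Separations of rank one\<close>

text \<open>Cut-rank at most one over the two-element field: the matrix between \<open>A\<close> and
  \<open>B\<close> is an outer product, possibly zero.\<close>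

definition rank1 :: "('a \<Rightarrow> 'a \<Rightarrow> bool) \<Rightarrow> 'a set \<Rightarrow> 'a set \<Rightarrow> bool" where
  "rank1 E A B \<longleftrightarrow> (\<exists>f g. \<forall>x\<in>A. \<forall>y\<in>B. E x y \<longleftrightarrow> f x \<and> g y)"

definition linked :: "'a set \<Rightarrow> ('a \<Rightarrow> 'a \<Rightarrow> bool) \<Rightarrow> 'a set \<Rightarrow> 'a set \<Rightarrow> bool" where
  "linked V E X Y \<longleftrightarrow> \<not> (\<exists>A. X \<subseteq> A \<and> A \<subseteq> V \<and> A \<inter> Y = {} \<and> rank1 E A (V - A))"

lemma linkedD:
  assumes "linked V E X Y" "X \<subseteq> A" "A \<subseteq> V" "A \<inter> Y = {}"
    "\<And>x y. x \<in> A \<Longrightarrow> y \<in> V - A \<Longrightarrow> E x y \<longleftrightarrow> f x \<and> g y"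
  shows False
proof -
  have "rank1 E A (V - A)" unfolding rank1_def
    by (rule exI[of _ f], rule exI[of _ g], intro ballI) (rule assms(5))
  then show False using assms(1-4) unfolding linked_def by blast
qed

lemma not_linkedE:
  assumes "\<not> linked V E X Y"
  obtains A f g where "X \<subseteq> A" "A \<subseteq> V" "A \<inter> Y = {}" "\<And>x y. x \<in> A \<Longrightarrow> y \<in> V - A \<Longrightarrow> E x y \<longleftrightarrow> f x \<and> g y"
proof -
  obtain A where A: "X \<subseteq> A" "A \<subseteq> V" "A \<inter> Y = {}" "rank1 E A (V - A)"
    using assms unfolding linked_def by blast
  then obtain f g where fg: "\<forall>x\<in>A. \<forall>y\<in>V - A. E x y \<longleftrightarrow> f x \<and> g y" unfolding rank1_def by (elim exE)
  show ?thesis by (rule that[OF A(1-3)]) (rule fg[rule_format])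
qed

definition simple_rel :: "('a \<Rightarrow> 'a \<Rightarrow> bool) \<Rightarrow> bool" where
  "simple_rel E \<longleftrightarrow> (\<forall>x y. E x y \<longrightarrow> E y x) \<and> (\<forall>x. \<not> E x x)"

lemma simple_rel_sym: "simple_rel E \<Longrightarrow> E x y \<longleftrightarrow> E y x" unfolding simple_rel_def by blast

lemma simple_rel_lcE:
  assumes "simple_rel E"
  shows "simple_rel (lcE E v)"
proof -
  have "E x y = E y x" "\<not> E x x" for x y using assms unfolding simple_rel_def by blast+
  then show ?thesis unfolding simple_rel_def lcE_def by auto
qed

text \<open>Over the two-element field two distinct nonzero triples are independent. So
  \<open>a\<close>, \<open>b\<close> and \<open>g\<close>, \<open>h\<close> would span two
  orthogonal planes in a space of dimension three.\<close>

lemma bool_triples: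
  assumes "((a1 \<and> g1) \<noteq> (a3 \<and> g3)) = (a2 \<and> g2)" "((a1 \<and> h1) \<noteq> (a3 \<and> h3)) = (a2 \<and> h2)"
    "((b1 \<and> g1) \<noteq> (b3 \<and> g3)) = (b2 \<and> g2)" "((b1 \<and> h1) \<noteq> (b3 \<and> h3)) = (b2 \<and> h2)"
    "a1 \<or> a2 \<or> a3" "b1 \<or> b2 \<or> b3" "\<not> (b1 = a1 \<and> b2 = a2 \<and> b3 = a3)"
    "g1 \<or> g2 \<or> g3" "h1 \<or> h2 \<or> h3" "\<not> (h1 = g1 \<and> h2 = g2 \<and> h3 = g3)"
  shows False
  using assms by (smt (verit))

text \<open>The three rank-one functions sum to zero on a corner of the two crossing separations, so one
  of the two sides of that corner has all its triples in \<open>{0, c}\<close>.\<close>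

lemma triple_orthogonal:
  assumes o: "\<forall>x\<in>a. \<forall>y\<in>d. ((f1 x \<and> g1 y) \<noteq> (n x \<and> m y)) = (f2 x \<and> g2 y)"
  shows "(\<exists>t. \<forall>x\<in>a. (f1 x, f2 x, n x) = (False, False, False) \<or> (f1 x, f2 x, n x) = t) \<or>
         (\<exists>t. \<forall>y\<in>d. (g1 y, g2 y, m y) = (False, False, False) \<or> (g1 y, g2 y, m y) = t)"
proof (rule ccontr)
  assume c: "\<not> ?thesis"
  define F where "F x = (f1 x, f2 x, n x)" for x
  define G where "G y = (g1 y, g2 y, m y)" for y
  have ca: "\<exists>x\<in>a. F x \<noteq> (False, False, False) \<and> F x \<noteq> t" for t using c unfolding F_def by blast
  have cd: "\<exists>y\<in>d. G y \<noteq> (False, False, False) \<and> G y \<noteq> t" for t using c unfolding G_def by blast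
  obtain x1 where x1: "x1 \<in> a" "F x1 \<noteq> (False, False, False)" using ca by blast
  obtain x2 where x2: "x2 \<in> a" "F x2 \<noteq> (False, False, False)" "F x2 \<noteq> F x1" using ca by blast
  obtain y1 where y1: "y1 \<in> d" "G y1 \<noteq> (False, False, False)" using cd by blast
  obtain y2 where y2: "y2 \<in> d" "G y2 \<noteq> (False, False, False)" "G y2 \<noteq> G y1" using cd by blast
  show False
    by (rule bool_triples[OF o[rule_format, OF x1(1) y1(1)] o[rule_format, OF x1(1) y2(1)]
          o[rule_format, OF x2(1) y1(1)] o[rule_format, OF x2(1) y2(1)]])
      (use x1(2) x2(2,3) y1(2) y2(2,3) in \<open>simp_all add: F_def G_def\<close>)
qed

text \<open>If both ways of removing \<open>v\<close> fail, they yield separations \<open>A1\<close>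
  and \<open>A2\<close> of \<open>V - {v}\<close>. By \<open>triple_orthogonal\<close>, on one of
  the corners \<open>A1 \<inter> A2\<close> and \<open>V - {v} - A1 - A2\<close> the vectors of the
  two separations and the neighbourhood of \<open>v\<close> are proportional. That corner against
  all other vertices, including \<open>v\<close>, has rank one in the original graph.\<close>

lemma linked_elim:
  assumes E: "simple_rel E" and l: "linked V E X Y" and v: "v \<in> V" "v \<notin> X" "v \<notin> Y" and Y: "Y \<subseteq> V"
  shows "linked (V - {v}) E X Y \<or> linked (V - {v}) (lcE E v) X Y"
proof (rule ccontr)
  assume c: "\<not> ?thesis"
  then have c1: "\<not> linked (V - {v}) E X Y" and c2: "\<not> linked (V - {v}) (lcE E v) X Y" by simp_all
  obtain A1 f1 g1 where A1: "X \<subseteq> A1" "A1 \<subseteq> V - {v}" "A1 \<inter> Y = {}"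
    "\<And>x y. x \<in> A1 \<Longrightarrow> y \<in> V - {v} - A1 \<Longrightarrow> E x y \<longleftrightarrow> f1 x \<and> g1 y"
    by (rule not_linkedE[OF c1]) (rule that)
  obtain A2 f2 g2 where A2: "X \<subseteq> A2" "A2 \<subseteq> V - {v}" "A2 \<inter> Y = {}"
    "\<And>x y. x \<in> A2 \<Longrightarrow> y \<in> V - {v} - A2 \<Longrightarrow> lcE E v x y \<longleftrightarrow> f2 x \<and> g2 y"
    by (rule not_linkedE[OF c2]) (rule that)
  have A2': "E x y \<longleftrightarrow> (f2 x \<and> g2 y) \<noteq> (E v x \<and> E v y)" if "x \<in> A2" "y \<in> V - {v} - A2" for x y
    using A2(4)[OF that] that unfolding lcE_def by auto
  let ?a = "A1 \<inter> A2" and ?d = "V - {v} - A1 - A2"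
  \<comment> \<open>Between the two corners both separations describe the same entries, once before
    and once after adding the outer product of the neighbourhood of \<open>v\<close>.\<close>
  have "\<forall>x\<in>?a. \<forall>y\<in>?d. ((f1 x \<and> g1 y) \<noteq> (E v x \<and> E v y)) = (f2 x \<and> g2 y)"
  proof (intro ballI)
    fix x y assume that: "x \<in> ?a" "y \<in> ?d"
    show "((f1 x \<and> g1 y) \<noteq> (E v x \<and> E v y)) = (f2 x \<and> g2 y)"
      using A1(4)[of x y] A2'[of x y] that by blast
  qed
  from triple_orthogonal[of ?a ?d f1 g1 "E v" "E v" f2 g2, OF this]
  show False
  proof (elim disjE exE)
    fix t
    assume "\<forall>x\<in>?a. (f1 x, f2 x, E v x) = (False, False, False) \<or> (f1 x, f2 x, E v x) = t"
    moreover obtain p q r where "t = (p, q, r)" by (cases t)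
    ultimately have a: "(\<not> f1 x \<and> \<not> f2 x \<and> \<not> E v x) \<or> (f1 x = p \<and> f2 x = q \<and> E v x = r)" if "x \<in> ?a" for x
      using that by auto
    show False
    proof (rule linkedD[OF l, of ?a "\<lambda>x. f1 x \<or> f2 x \<or> E v x"
          "\<lambda>y. if y = v then r else if y \<notin> A1 then p \<and> g1 y else (q \<and> g2 y) \<noteq> (r \<and> E v y)"])
      fix x y assume x: "x \<in> ?a" and y: "y \<in> V - ?a"
      consider "y = v" | "y \<noteq> v" "y \<notin> A1" | "y \<noteq> v" "y \<in> A1" "y \<notin> A2" using y by blast
      then show "E x y \<longleftrightarrow> (f1 x \<or> f2 x \<or> E v x) \<and>
         (if y = v then r else if y \<notin> A1 then p \<and> g1 y else (q \<and> g2 y) \<noteq> (r \<and> E v y))"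
      proof cases
        case 1
        have "E x y = E v x" using 1 simple_rel_sym[OF E] by blast
        then show ?thesis using a[OF x] 1 by argo
      next
        case 2
        have "E x y \<longleftrightarrow> f1 x \<and> g1 y" using A1(4)[of x y] x y 2 by blast
        then show ?thesis using a[OF x] 2 by argo
      next
        case 3
        have "E x y \<longleftrightarrow> (f2 x \<and> g2 y) \<noteq> (E v x \<and> E v y)" using A2'[of x y] x y 3 by blast
        then show ?thesis using a[OF x] 3 by argo
      qed
    qed (use A1 A2 in auto)
  next
    fix t
    assume "\<forall>y\<in>?d. (g1 y, g2 y, E v y) = (False, False, False) \<or> (g1 y, g2 y, E v y) = t"
    moreover obtain p q r where "t = (p, q, r)" by (cases t)
    ultimately have d: "(\<not> g1 y \<and> \<not> g2 y \<and> \<not> E v y) \<or> (g1 y = p \<and> g2 y = q \<and> E v y = r)" if "y \<in> ?d" for y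
      using that by auto
    show False
    proof (rule linkedD[OF l, of "V - ?d" "\<lambda>x. if x = v then r else if x \<in> A1 then f1 x \<and> p else (f2 x \<and> q) \<noteq> (E v x \<and> r)"
          "\<lambda>y. g1 y \<or> g2 y \<or> E v y"])
      fix x y assume x: "x \<in> V - ?d" and y: "y \<in> V - (V - ?d)"
      have yd: "y \<in> ?d" using y by blast
      consider "x = v" | "x \<noteq> v" "x \<in> A1" | "x \<noteq> v" "x \<notin> A1" "x \<in> A2" using x by blast
      then show "E x y \<longleftrightarrow> (if x = v then r else if x \<in> A1 then f1 x \<and> p else (f2 x \<and> q) \<noteq> (E v x \<and> r)) \<and>
         (g1 y \<or> g2 y \<or> E v y)"
      proof cases
        case 1
        then show ?thesis using d[OF yd] by argo
      next
        case 2
        have "E x y \<longleftrightarrow> f1 x \<and> g1 y" using A1(4)[of x y] x yd 2 by blast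
        then show ?thesis using d[OF yd] 2 by argo
      next
        case 3
        have "E x y \<longleftrightarrow> (f2 x \<and> g2 y) \<noteq> (E v x \<and> E v y)" using A2'[of x y] yd 3 by blast
        then show ?thesis using d[OF yd] 3 by argo
      qed
    qed (use A1 A2 v Y in auto)
  qed
qed

definition nonadjacent :: "('a \<Rightarrow> 'a \<Rightarrow> bool) \<Rightarrow> 'a set \<Rightarrow> 'a set \<Rightarrow> bool" where
  "nonadjacent E A B \<longleftrightarrow> (\<forall>a\<in>A. \<forall>b\<in>B. \<not> E a b)"

text \<open>Applies \<open>linked_elim\<close> to one vertex of \<open>V - K\<close> after another
  and records what holds whichever way it is removed. A centre in \<open>A\<close> has no neighbour
  in \<open>B\<close>, so it creates no edge between \<open>A\<close> and \<open>B\<close>; a vertex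
  of \<open>D\<close> is never in the neighbourhood of a centre.\<close>

lemma eliminate:
  assumes "finite V" "simple_rel E" "linked V E X Y" "X \<subseteq> K" "Y \<subseteq> K" "K \<subseteq> V"
    "\<And>A B. (A, B) \<in> Fam \<Longrightarrow> nonadjacent E A B \<and> V - K \<subseteq> A \<union> B"
    "\<And>x v. x \<in> D \<Longrightarrow> v \<in> V - K \<Longrightarrow> \<not> E v x"
  shows "\<exists>E'. vminor V E K E' \<and> simple_rel E' \<and> linked K E' X Y \<and> (\<forall>(A, B) \<in> Fam. nonadjacent E' A B) \<and>
    (\<forall>x\<in>D. \<forall>y. E' x y = E x y)"
  using assms
proof (induction "card (V - K)" arbitrary: V E)
  case 0
  then have "V = K" by auto
  then show ?case using 0 vminor_sub[of K K E] by blast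
next
  case (Suc k)
  then obtain v where v: "v \<in> V - K" by (metis card.empty ex_in_conv nat.distinct(1))
  have lE: "linked (V - {v}) E X Y \<or> linked (V - {v}) (lcE E v) X Y"
    by (rule linked_elim) (use Suc.prems v in auto)
  then obtain E1 where E1: "E1 = E \<or> E1 = lcE E v" "linked (V - {v}) E1 X Y" by blast
  have vm: "vminor V E (V - {v}) E1" using E1(1) vminor_sub[of "V - {v}" V E] vminor_lc[of v V "V - {v}" E] v by auto
  have sg: "simple_rel E1" using E1(1) Suc.prems(2) simple_rel_lcE[of E v] by auto
  have cd: "k = card (V - {v} - K)"
  proof -
    have "V - {v} - K = (V - K) - {v}" by blast
    then show ?thesis using Suc.hyps(2) v by (simp add: card_Diff_singleton)
  qed
  have F1: "nonadjacent E1 A B \<and> V - {v} - K \<subseteq> A \<union> B" if "(A, B) \<in> Fam" for A B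
  proof -
    have a: "nonadjacent E A B" "V - K \<subseteq> A \<union> B" using Suc.prems(7)[OF that] by auto
    have "v \<in> A \<or> v \<in> B" using a(2) v by blast
    then have "nonadjacent (lcE E v) A B" using a(1) simple_rel_sym[OF Suc.prems(2)] unfolding nonadjacent_def lcE_def by blast
    then show ?thesis using a E1(1) by blast
  qed
  have D1: "\<not> E1 w x \<and> (\<forall>y. E1 x y = E x y)" if "x \<in> D" "w \<in> V - {v} - K" for x w
    using E1(1) Suc.prems(8)[OF that(1)] v that unfolding lcE_def by auto
  have D2: "\<forall>y. E1 x y = E x y" if "x \<in> D" for x
    using E1(1) Suc.prems(8)[OF that(1)] v that unfolding lcE_def by auto
  obtain E' where E': "vminor (V - {v}) E1 K E'" "simple_rel E'" "linked K E' X Y" "\<forall>(A, B) \<in> Fam. nonadjacent E' A B"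
    "\<forall>x\<in>D. \<forall>y. E' x y = E1 x y"
    using Suc.hyps(1)[OF cd _ sg E1(2) Suc.prems(4,5) _ F1] D1 Suc.prems(1,6) v by blast
  then show ?case using vminor_trans[OF vm E'(1)] D2 by auto
qed

section \<open>Shortest directed paths\<close>

definition dpath :: "('a \<Rightarrow> 'a \<Rightarrow> bool) \<Rightarrow> 'a set \<Rightarrow> 'a set \<Rightarrow> 'a list \<Rightarrow> bool" where
  "dpath R S T us \<longleftrightarrow> us \<noteq> [] \<and> hd us \<in> S \<and> last us \<in> T \<and> successively R us"

lemma dpath_nth: "dpath R S T us \<Longrightarrow> Suc i < length us \<Longrightarrow> R (us ! i) (us ! Suc i)"
  unfolding dpath_def by (simp add: successively_conv_nth)

lemma successively_drop: "successively R us \<Longrightarrow> successively R (drop k us)"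
  by (simp add: successively_conv_nth)

lemma successively_take: "successively R us \<Longrightarrow> successively R (take k us)"
  by (simp add: successively_conv_nth)

lemma dpath_rtranclp: "R\<^sup>*\<^sup>* x y \<Longrightarrow> \<exists>us. dpath R {x} {y} us"
proof (induction rule: rtranclp_induct)
  case base
  then show ?case by (intro exI[of _ "[x]"]) (simp add: dpath_def)
next
  case (step y z)
  then obtain us where "dpath R {x} {y} us" by blast
  then show ?case using step by (intro exI[of _ "us @ [z]"]) (auto simp: dpath_def successively_append_iff)
qed

text \<open>\<open>R\<close> need not be symmetric, so minimal length excludes forward shortcuts
  only.\<close>

lemma shortest_dpath:
  assumes "dpath R S T vs"
  obtains us where "dpath R S T us" "\<And>vs. dpath R S T vs \<Longrightarrow> length us \<le> length vs"
    "\<And>i j. i + 2 \<le> j \<Longrightarrow> j < length us \<Longrightarrow> \<not> R (us ! i) (us ! j)"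
    "\<And>i. 0 < i \<Longrightarrow> i < length us \<Longrightarrow> us ! i \<notin> S"
    "\<And>i. Suc i < length us \<Longrightarrow> us ! i \<notin> T" "distinct us"
proof -
  define us where "us = arg_min length (dpath R S T)"
  have p: "dpath R S T us" unfolding us_def by (rule arg_min_natI) (rule assms)
  have m: "length us \<le> length vs" if "dpath R S T vs" for vs unfolding us_def by (rule arg_min_nat_le) (rule that)
  have s: "successively R us" and ne: "us \<noteq> []" using p by (auto simp: dpath_def)
  have sub: "\<not> R (us ! i) (us ! j)" if "i + 2 \<le> j" "j < length us" for i j
  proof
    assume r: "R (us ! i) (us ! j)"
    have "last (take (Suc i) us) = us ! i" using that by (simp add: take_Suc_conv_app_nth)
    moreover have "hd (drop j us) = us ! j" using that by (simp add: hd_drop_conv_nth)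
    ultimately have "dpath R S T (take (Suc i) us @ drop j us)"
      using p that r successively_take[OF s, of "Suc i"] successively_drop[OF s, of j]
      by (auto simp: dpath_def successively_append_iff)
    from m[OF this] show False using that by simp
  qed
  have nS: "us ! i \<notin> S" if "0 < i" "i < length us" for i
  proof
    assume "us ! i \<in> S"
    then have "dpath R S T (drop i us)"
      using p that successively_drop[OF s, of i] by (auto simp: dpath_def hd_drop_conv_nth)
    from m[OF this] show False using that by simp
  qed
  have nT: "us ! i \<notin> T" if "Suc i < length us" for i
  proof
    assume "us ! i \<in> T"
    moreover have "last (take (Suc i) us) = us ! i" using that by (simp add: take_Suc_conv_app_nth)
    ultimately have "dpath R S T (take (Suc i) us)"
      using p that successively_take[OF s, of "Suc i"] by (auto simp: dpath_def)
    from m[OF this] show False using that by simp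
  qed
  have ne': "us ! i \<noteq> us ! j" if "i < j" "j < length us" for i j
  proof
    assume e: "us ! i = us ! j"
    show False
    proof (cases i)
      case 0
      then have "dpath R S T (drop j us)"
        using p that e successively_drop[OF s, of j] by (auto simp: dpath_def hd_drop_conv_nth hd_conv_nth)
      from m[OF this] show False using that by simp
    next
      case (Suc k)
      have "R (us ! k) (us ! j)" using dpath_nth[OF p, of k] Suc that e by simp
      moreover have "k + 2 \<le> j" using Suc that by simp
      ultimately show False using sub that by blast
    qed
  qed
  have "distinct us" unfolding distinct_conv_nth using ne' by (metis linorder_neqE_nat)
  then show ?thesis using that p m sub nS nT by blast
qed

subsection \<open>Minimal linked sets\<close>

text \<open>Here \<open>X = {q ! 0, x0}\<close> and \<open>Y = {q ! K, y0}\<close>: a shortest path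
  meets each of the two edges in one end only. \<open>win\<close> holds since a vertex with
  neighbours further apart would shorten \<open>q\<close>.\<close>

locale minlinked =
  fixes H :: "'a set" and E :: "'a \<Rightarrow> 'a \<Rightarrow> bool" and q :: "'a list" and K :: nat and x0 y0 :: 'a
  assumes fin: "finite H" and sg: "simple_rel E"
    and qlen: "length q = Suc K" and qd: "distinct q" and qH: "set q \<subseteq> H"
    and qE: "\<And>i j. i \<le> K \<Longrightarrow> j \<le> K \<Longrightarrow> E (q ! i) (q ! j) \<longleftrightarrow> i = Suc j \<or> j = Suc i"
    and x0: "x0 \<in> H - set q" "E x0 (q ! 0)" and y0: "y0 \<in> H - set q" "E y0 (q ! K)" and xy: "x0 \<noteq> y0"
    and lk: "linked H E {q ! 0, x0} {q ! K, y0}"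
    and minimal: "\<And>H'. H' \<subset> H \<Longrightarrow> {q ! 0, x0, q ! K, y0} \<subseteq> H' \<Longrightarrow> \<not> linked H' E {q ! 0, x0} {q ! K, y0}"
    and win: "\<And>u i j. u \<in> H - set q \<Longrightarrow> i \<le> K \<Longrightarrow> j \<le> K \<Longrightarrow> E u (q ! i) \<Longrightarrow> E u (q ! j) \<Longrightarrow> j \<le> i + 2"
    and K1: "K \<ge> 1"
begin

definition NQ where "NQ u = {i. i \<le> K \<and> E u (q ! i)}"
text \<open>The position of the last neighbour on \<open>q\<close>, shifted by one so that 0 is free
  for a vertex without neighbours. With this 0 and \<open>lo u = Suc K\<close>, such a vertex
  restricts the position of a cut in neither direction.\<close>

definition hi where "hi u = (if NQ u = {} then 0 else Suc (Max (NQ u)))"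
definition lo where "lo u = (if NQ u = {} then Suc K else Min (NQ u))"

text \<open>A separation of rank one cuts \<open>q\<close> before some \<open>q ! c\<close>, and a vertex \<open>u\<close> on its left has \<open>hi u \<le> c + 1\<close>,
  a vertex \<open>v\<close> on its right has \<open>lo v \<ge> c - 1\<close>, and \<open>E u v\<close> holds iff both are equalities. So \<open>arr u v\<close> says
  that no such separation has \<open>u\<close> on the left and \<open>v\<close> on the right.\<close>

definition arr where
  "arr u v \<longleftrightarrow> u \<in> H - set q \<and> v \<in> H - set q \<and>
    (if hi u \<ge> lo v + 3 then True else if hi u = lo v + 2 then \<not> E u v else E u v)"

lemma fNQ: "finite (NQ u)" unfolding NQ_def by (rule finite_subset[of _ "{..K}"]) auto

lemma hi_lo: "i \<le> K \<Longrightarrow> E u (q ! i) \<Longrightarrow> lo u \<le> i \<and> i < hi u"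
  unfolding hi_def lo_def using fNQ[of u] Max_ge[of "NQ u" i] Min_le[of "NQ u" i]
  by (auto simp: NQ_def less_Suc_eq_le)

lemma NQ_Max: "NQ u \<noteq> {} \<Longrightarrow> Max (NQ u) \<le> K \<and> E u (q ! Max (NQ u))"
  using Max_in[OF fNQ[of u]] by (simp add: NQ_def)

lemma NQ_Min: "NQ u \<noteq> {} \<Longrightarrow> Min (NQ u) \<le> K \<and> E u (q ! Min (NQ u))"
  using Min_in[OF fNQ[of u]] by (simp add: NQ_def)

lemma hi_le: "hi u \<le> Suc K"
  using NQ_Max[of u] by (simp add: hi_def)

lemma hi_adj: "hi u = Suc i \<Longrightarrow> E u (q ! i) \<and> i \<le> K"
  using NQ_Max[of u] by (auto simp: hi_def split: if_splits)

lemma lo_adj: "lo u \<le> K \<Longrightarrow> E u (q ! lo u)"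
  using NQ_Min[of u] by (auto simp: lo_def split: if_splits)

lemma hi0: "hi u = 0 \<longleftrightarrow> lo u = Suc K"
proof
  assume "hi u = 0"
  then have "NQ u = {}" by (auto simp: hi_def split: if_splits)
  then show "lo u = Suc K" by (simp add: lo_def)
next
  assume l: "lo u = Suc K"
  show "hi u = 0"
  proof (rule ccontr)
    assume "hi u \<noteq> 0"
    then obtain i where "hi u = Suc i" by (cases "hi u") auto
    then have "E u (q ! i)" "i \<le> K" using hi_adj by auto
    then show False using hi_lo l by fastforce
  qed
qed

lemma lo_le: "lo u \<le> Suc K"
  by (cases "NQ u = {}") (use NQ_Min[of u] in \<open>auto simp: lo_def\<close>)

lemma hi_win: "u \<in> H - set q \<Longrightarrow> hi u \<le> lo u + 3"
proof (cases "hi u")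
  case (Suc i)
  assume u: "u \<in> H - set q"
  have "lo u \<le> K" using Suc hi0[of u] lo_le[of u] by linarith
  then show ?thesis using win[OF u, of "lo u" i] hi_adj[OF Suc] lo_adj Suc by auto
qed auto

lemma not_arr:
  assumes "\<not> arr u v" "u \<in> H - set q" "v \<in> H - set q"
  shows "hi u \<le> lo v + 2" "E u v \<longleftrightarrow> hi u = lo v + 2"
  using assms unfolding arr_def by (auto split: if_splits)

lemma q_inj: "i \<le> K \<Longrightarrow> j \<le> K \<Longrightarrow> q ! i = q ! j \<longleftrightarrow> i = j"
  using qd qlen by (simp add: nth_eq_iff_index_eq)

lemma in_q: "z \<in> set q \<longleftrightarrow> (\<exists>i \<le> K. z = q ! i)"
  unfolding in_set_conv_nth using qlen by (auto simp: less_Suc_eq_le)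

text \<open>An augmenting path argument as for Menger's theorem: the set reached from
  \<open>x0\<close>, together with an initial segment of \<open>q\<close>, would be a forbidden
  separation.\<close>

lemma arr_reach: "arr\<^sup>*\<^sup>* x0 y0"
proof (rule ccontr)
  assume nr: "\<not> arr\<^sup>*\<^sup>* x0 y0"
  define S where "S = {u \<in> H - set q. arr\<^sup>*\<^sup>* x0 u}"
  have Sx: "x0 \<in> S" "y0 \<notin> S" "finite S" "S \<subseteq> H - set q" unfolding S_def using x0 nr fin by auto
  define M where "M = Max (hi ` S)"
  have Mge: "hi u \<le> M" if "u \<in> S" for u unfolding M_def using Sx(3) that by (intro Max_ge) auto
  have "M \<in> hi ` S" unfolding M_def using Sx by (intro Max_in) auto
  then obtain u0 where u0: "u0 \<in> S" "hi u0 = M" by blast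
  have MK: "M \<le> Suc K" using u0 hi_le by blast
  \<comment> \<open>Then \<open>M \<le> Suc c\<close>. The vertex attaining \<open>M\<close> has no
    arrow to a vertex outside \<open>S\<close>, whose \<open>lo\<close> is therefore at least
    \<open>M - 2\<close>, hence at least \<open>c - 1\<close>. The maximum with 1 keeps
    \<open>q ! 0\<close> on the left.\<close>
  define c where "c = max (M - 1) 1"
  have c: "1 \<le> c" "c \<le> K" "M \<le> Suc c" using MK K1 unfolding c_def by auto
  have na: "\<not> arr u w" if "u \<in> S" "w \<in> H - set q" "w \<notin> S" for u w
  proof
    assume "arr u w"
    moreover have "arr\<^sup>*\<^sup>* x0 u" using that(1) unfolding S_def by blast
    ultimately have "arr\<^sup>*\<^sup>* x0 w" by (simp only: rtranclp.rtrancl_into_rtrancl)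
    then show False using that unfolding S_def by blast
  qed
  have low: "c - 1 \<le> lo w" if "w \<in> H - set q" "w \<notin> S" for w
    using not_arr(1)[OF na[OF u0(1) that]] u0 Sx(4) that unfolding c_def by auto
  let ?A = "(!) q ` {..<c} \<union> S"
  show False
  proof (rule linkedD[OF lk, of ?A "\<lambda>z. if z \<in> S then hi z = Suc c else z = q ! (c - 1)"
        "\<lambda>w. if w \<in> set q then w = q ! c else lo w = c - 1"])
    show "{q ! 0, x0} \<subseteq> ?A" using c(1) Sx(1) by auto
    show "?A \<subseteq> H" using qH qlen c Sx(4) by auto
    show "?A \<inter> {q ! K, y0} = {}"
    proof -
      have "q ! K \<notin> S" using Sx(4) qlen by auto
      moreover have "q ! K \<notin> (!) q ` {..<c}"
      proof
        assume "q ! K \<in> (!) q ` {..<c}"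
        then obtain i where "i < c" "q ! K = q ! i" by blast
        then show False using q_inj[of K i] c by simp
      qed
      moreover have "y0 \<notin> (!) q ` {..<c}"
      proof
        assume "y0 \<in> (!) q ` {..<c}"
        then obtain i where "i < c" "y0 = q ! i" by blast
        moreover from this have "q ! i \<in> set q" using c(2) qlen by simp
        ultimately show False using y0(1) by simp
      qed
      ultimately show ?thesis using Sx(2) by simp
    qed
    fix z w assume z: "z \<in> ?A" and w: "w \<in> H - ?A"
    have w': "\<exists>j. c \<le> j \<and> j \<le> K \<and> w = q ! j" if wq: "w \<in> set q"
    proof -
      obtain j where j: "j \<le> K" "w = q ! j" using wq in_q by blast
      have "\<not> j < c" using w j(2) by blast
      then show ?thesis using j by (intro exI[of _ j]) simp
    qed
    show "E z w \<longleftrightarrow> (if z \<in> S then hi z = Suc c else z = q ! (c - 1)) \<and>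
       (if w \<in> set q then w = q ! c else lo w = c - 1)"
    proof (cases "z \<in> S")
      case True
      note zS = this
      have zU: "z \<in> H - set q" using True Sx(4) by blast
      show ?thesis
      proof (cases "w \<in> set q")
        case True
        then obtain j where j: "c \<le> j" "j \<le> K" "w = q ! j" using w' by blast
        have "E z (q ! j) \<longleftrightarrow> hi z = Suc c \<and> j = c"
          using hi_lo[of j z] hi_adj[of z c] j Mge[OF zS] c by auto
        then show ?thesis using zS True j q_inj c by auto
      next
        case False
        have wU: "w \<in> H - set q" "w \<notin> S" using w False by auto
        have "E z w \<longleftrightarrow> hi z = lo w + 2" "hi z \<le> lo w + 2" using not_arr[OF na[OF zS wU] zU wU(1)] by auto
        then show ?thesis using zS False low[OF wU] Mge[OF zS] c by auto
      qed
    next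
      case False
      then obtain i where i: "i < c" "z = q ! i" using z by blast
      show ?thesis
      proof (cases "w \<in> set q")
        case True
        then obtain j where j: "c \<le> j" "j \<le> K" "w = q ! j" using w' by blast
        have "E z w \<longleftrightarrow> i = c - 1 \<and> j = c" using qE[of i j] i j c by auto
        then show ?thesis using False True i j q_inj c by auto
      next
        case F2: False
        have wU: "w \<in> H - set q" "w \<notin> S" using w F2 by auto
        have "E z w \<longleftrightarrow> E w (q ! i)" using simple_rel_sym[OF sg] i by blast
        also have "\<dots> \<longleftrightarrow> i = c - 1 \<and> lo w = c - 1"
        proof
          assume "E w (q ! i)"
          then show "i = c - 1 \<and> lo w = c - 1" using hi_lo[of i w] i c low[OF wU] by auto
        next
          assume "i = c - 1 \<and> lo w = c - 1"
          then show "E w (q ! i)" using lo_adj[of w] c by auto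
        qed
        finally show ?thesis using False F2 i q_inj[of i "c - 1"] c by auto
      qed
    qed
  qed
qed

end

locale minchain = minlinked +
  fixes us :: "'a list" and m :: nat
  assumes ulen: "length us = m" and ud: "distinct us" and uH: "set us \<subseteq> H - set q"
    and u0: "us ! 0 = x0" and um: "us ! (m - 1) = y0" and m2: "m \<ge> 2"
    and uarr: "\<And>i. Suc i < m \<Longrightarrow> arr (us ! i) (us ! Suc i)"
    and unarr: "\<And>i j. i + 2 \<le> j \<Longrightarrow> j < m \<Longrightarrow> \<not> arr (us ! i) (us ! j)"
begin

lemma u_in: "i < m \<Longrightarrow> us ! i \<in> H - set q" using uH ulen nth_mem[of i us] by blast

lemma u_far:
  assumes "i + 2 \<le> j" "j < m"
  shows "hi (us ! i) \<le> lo (us ! j) + 2" "E (us ! i) (us ! j) \<longleftrightarrow> hi (us ! i) = lo (us ! j) + 2"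
  using not_arr[OF unarr[OF assms]] u_in assms by auto

text \<open>If \<open>q\<close> came back into \<open>A\<close>, it would leave \<open>A\<close> a
  second time, to some \<open>q ! d\<close>. Rank one would then join \<open>q ! (c - 1)\<close> to
  \<open>q ! d\<close>, but \<open>q\<close> is induced.\<close>

lemma rank1_cut_path:
  assumes A: "q ! 0 \<in> A" "q ! K \<notin> A"
    and fg: "\<And>x y. x \<in> A \<Longrightarrow> x \<in> set q \<Longrightarrow> y \<notin> A \<Longrightarrow> y \<in> set q \<Longrightarrow> E x y \<longleftrightarrow> f x \<and> g y"
  obtains c where "1 \<le> c" "c \<le> K" "\<And>i. i \<le> K \<Longrightarrow> q ! i \<in> A \<longleftrightarrow> i < c" "f (q ! (c - 1))" "g (q ! c)"
proof -
  define c where "c = (LEAST i. q ! i \<notin> A)"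
  have cA: "q ! c \<notin> A" unfolding c_def by (rule LeastI[of _ K]) (rule A(2))
  have cK: "c \<le> K" unfolding c_def by (rule Least_le) (rule A(2))
  have lt: "q ! i \<in> A" if "i < c" for i using not_less_Least that unfolding c_def by blast
  have c1: "c \<ge> 1" using cA A(1) by (cases c) auto
  have qi: "q ! i \<in> set q" if "i \<le> K" for i using that qlen by auto
  have e: "f (q ! i) \<and> g (q ! Suc i)" if "i < K" "q ! i \<in> A" "q ! Suc i \<notin> A" for i
    using fg[of "q ! i" "q ! Suc i"] qE[of i "Suc i"] that qi by auto
  have c0: "f (q ! (c - 1))" "g (q ! c)" using e[of "c - 1"] lt[of "c - 1"] cA c1 cK by auto
  have ge: "q ! i \<notin> A" if "c \<le> i" "i \<le> K" for i
  proof (rule ccontr)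
    assume "\<not> q ! i \<notin> A"
    then have iA: "q ! i \<in> A" by simp
    then have ci: "c < i" using that cA by (cases "c = i") auto
    define d where "d = (LEAST k. i \<le> k \<and> k \<le> K \<and> q ! k \<notin> A)"
    have d: "i \<le> d \<and> d \<le> K \<and> q ! d \<notin> A" unfolding d_def by (rule LeastI[of _ K]) (use A(2) that in auto)
    have di: "i < d" using d iA by (cases "i = d") auto
    have "q ! (d - 1) \<in> A"
    proof (rule ccontr)
      assume "q ! (d - 1) \<notin> A"
      then have "d \<le> d - 1" unfolding d_def[symmetric] using d di
        by (subst (1) d_def) (rule Least_le, auto)
      then show False using di by simp
    qed
    then have "f (q ! (d - 1)) \<and> g (q ! Suc (d - 1))" using e[of "d - 1"] d di by auto
    then have "g (q ! d)" using di by simp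
    then have "E (q ! (c - 1)) (q ! d)" using fg[of "q ! (c - 1)" "q ! d"] lt[of "c - 1"] d c0 c1
      qi[of "c - 1"] qi[of d] cK by auto
    moreover have "c - 1 \<le> K" using cK by simp
    ultimately show False using qE[of "c - 1" d] d ci di c1 by auto
  qed
  show ?thesis by (rule that[OF c1 cK _ c0]) (use lt ge in \<open>metis not_less\<close>)
qed

text \<open>If the two paths did not exhaust \<open>H\<close>, minimality would give a rank-one
  separation of their union. It cuts \<open>q\<close> at one place \<open>c\<close>, and
  \<open>us\<close> leaves it in some step; for this step rank one gives just the conditions that
  negate \<open>arr\<close>.\<close>

lemma H_eq: "H = set q \<union> set us"
proof (rule ccontr)
  assume ne: "H \<noteq> set q \<union> set us"
  let ?W = "set q \<union> set us"
  have W: "?W \<subset> H" using ne qH uH by auto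
  have mem: "q ! 0 \<in> set q" "q ! K \<in> set q" "x0 \<in> set us" "y0 \<in> set us"
    using qlen u0 um m2 ulen by (auto intro: nth_mem)
  have "\<not> linked ?W E {q ! 0, x0} {q ! K, y0}" by (rule minimal[OF W]) (use mem in auto)
  then obtain A f g where A: "{q ! 0, x0} \<subseteq> A" "A \<subseteq> ?W" "A \<inter> {q ! K, y0} = {}"
    "\<And>x y. x \<in> A \<Longrightarrow> y \<in> ?W - A \<Longrightarrow> E x y \<longleftrightarrow> f x \<and> g y"
    by (rule not_linkedE) (rule that)
  obtain c where c: "1 \<le> c" "c \<le> K" "\<And>i. i \<le> K \<Longrightarrow> q ! i \<in> A \<longleftrightarrow> i < c" "f (q ! (c - 1))" "g (q ! c)"
    using rank1_cut_path[of A f g] A by auto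
  have "\<exists>k. Suc k < m \<and> us ! k \<in> A \<and> us ! Suc k \<notin> A"
  proof -
    define d where "d = (LEAST k. k < m \<and> us ! k \<notin> A)"
    have d: "d < m \<and> us ! d \<notin> A" unfolding d_def by (rule LeastI[of _ "m - 1"]) (use A(3) um m2 in auto)
    have "d \<noteq> 0" using d A(1) u0 by (metis insert_subset)
    moreover have "us ! (d - 1) \<in> A"
    proof (rule ccontr)
      assume "us ! (d - 1) \<notin> A"
      then have "d \<le> d - 1" using d by (subst (1) d_def) (rule Least_le, auto)
      then show False using \<open>d \<noteq> 0\<close> by simp
    qed
    ultimately show ?thesis using d by (intro exI[of _ "d - 1"]) auto
  qed
  then obtain k where k: "Suc k < m" "us ! k \<in> A" "us ! Suc k \<notin> A" by blast
  let ?u = "us ! k" and ?v = "us ! Suc k"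
  have vW: "?v \<in> ?W - A" "?u \<in> ?W" using k ulen by auto
  have qA: "q ! (c - 1) \<in> A" "q ! c \<in> ?W - A" using c qlen by auto
  have hu: "hi ?u \<le> Suc c" "f ?u \<longleftrightarrow> hi ?u = Suc c"
  proof -
    have *: "j = c" if "c \<le> j" "j \<le> K" "E ?u (q ! j)" for j
    proof -
      have qj: "q ! j \<in> ?W - A" using that c qlen by auto
      have "g (q ! j)" using A(4)[OF k(2) qj] that by blast
      then have "E (q ! (c - 1)) (q ! j)" using A(4)[OF qA(1) qj] c(4) by blast
      moreover have "c - 1 \<le> K" using c(2) by simp
      ultimately show ?thesis using qE[of "c - 1" j] that(1,2) c(1) by auto
    qed
    show "hi ?u \<le> Suc c"
    proof (cases "hi ?u")
      case (Suc i)
      then show ?thesis using *[of i] hi_adj[OF Suc] by (cases "c \<le> i") auto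
    qed simp
    have "f ?u \<longleftrightarrow> E ?u (q ! c)" using A(4)[OF k(2) qA(2)] c(5) by blast
    also have "\<dots> \<longleftrightarrow> hi ?u = Suc c" using hi_lo[of c ?u] hi_adj[of ?u c] \<open>hi ?u \<le> Suc c\<close> c by auto
    finally show "f ?u \<longleftrightarrow> hi ?u = Suc c" .
  qed
  have lv: "c - 1 \<le> lo ?v" "g ?v \<longleftrightarrow> lo ?v = c - 1"
  proof -
    have *: "j = c - 1" if "j < c" "E ?v (q ! j)" for j
    proof -
      have qj: "q ! j \<in> A" using that c by auto
      have "E (q ! j) ?v" using simple_rel_sym[OF sg] that by blast
      then have "f (q ! j)" using A(4)[OF qj vW(1)] by blast
      then have "E (q ! j) (q ! c)" using A(4)[OF qj qA(2)] c(5) by blast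
      then show ?thesis using qE[of j c] that c by auto
    qed
    show l: "c - 1 \<le> lo ?v"
    proof (cases "lo ?v \<le> K")
      case True
      then show ?thesis using *[of "lo ?v"] lo_adj[OF True] by (cases "lo ?v < c") auto
    qed (use c in auto)
    have "g ?v \<longleftrightarrow> E ?v (q ! (c - 1))" using A(4)[OF qA(1) vW(1)] c(4) simple_rel_sym[OF sg] by blast
    also have "\<dots> \<longleftrightarrow> lo ?v = c - 1" using hi_lo[of "c - 1" ?v] lo_adj[of ?v] l c by auto
    finally show "g ?v \<longleftrightarrow> lo ?v = c - 1" .
  qed
  have "E ?u ?v \<longleftrightarrow> f ?u \<and> g ?v" using A(4)[OF k(2) vW(1)] .
  then have "E ?u ?v \<longleftrightarrow> hi ?u = lo ?v + 2" "hi ?u \<le> lo ?v + 2" using hu lv c by auto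
  then show False using uarr[OF k(1)] unfolding arr_def by (auto split: if_splits)
qed

end

section \<open>Induced cycles made of two paths\<close>

lemma edge_pair_commute: "edge_pair p q u v = edge_pair p q v u"
  unfolding edge_pair_def by blast

lemma path_edge_commute: "path_edge l u v = path_edge l v u"
  unfolding path_edge_def using edge_pair_commute by metis

lemma path_edge_nth:
  assumes "distinct l" "a < length l" "b < length l"
  shows "path_edge l (l ! a) (l ! b) \<longleftrightarrow> b = Suc a \<or> a = Suc b"
proof
  assume "path_edge l (l ! a) (l ! b)"
  then obtain k where "Suc k < length l" "edge_pair (l ! k) (l ! Suc k) (l ! a) (l ! b)" unfolding path_edge_def by blast
  then show "b = Suc a \<or> a = Suc b" using assms unfolding edge_pair_def by (auto simp: nth_eq_iff_index_eq)
next
  assume "b = Suc a \<or> a = Suc b"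
  then show "path_edge l (l ! a) (l ! b)"
  proof
    assume "b = Suc a" then show ?thesis using assms unfolding path_edge_def edge_pair_def by (intro exI[of _ a]) auto
  next
    assume "a = Suc b" then show ?thesis using assms unfolding path_edge_def edge_pair_def by (intro exI[of _ b]) auto
  qed
qed

lemma ladder_edge_cycle:
  assumes d: "distinct (x # y # xs @ ys)"
  shows "ladder_edge (Lc # replicate (length xs) La @ replicate (length ys) Lb @ [Lc]) x y xs ys u v =
    (edge_pair x y u v \<noteq> (path_edge (x # xs) u v \<noteq> (path_edge (y # ys) u v \<noteq> edge_pair (last (x # xs)) (last (y # ys)) u v)))"
proof -
  have "ladder_edge (replicate (length xs) La @ (replicate (length ys) Lb @ [Lc])) x y (xs @ []) ([] @ ys) u v =
    (ladder_edge (replicate (length xs) La) x y xs [] u v \<noteq>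
      ladder_edge (replicate (length ys) Lb @ [Lc]) (last (x # xs)) (last [y]) [] ys u v)"
    by (rule ladder_edge_append) auto
  moreover have "ladder_edge (replicate (length ys) Lb @ [Lc]) (last (x # xs)) y ([] @ []) (ys @ []) u v =
    (ladder_edge (replicate (length ys) Lb) (last (x # xs)) y [] ys u v \<noteq> ladder_edge [Lc] (last [last (x # xs)]) (last (y # ys)) [] [] u v)"
    by (rule ladder_edge_append) auto
  ultimately show ?thesis
    using ladder_edge_path[of x xs "length xs" y u v] ladder_edge_path_b[of y ys "length ys" "last (x # xs)" u v] d by simp
qed

text \<open>The two edges between the ends of the paths are the rungs of a word with a single run,
  so \<open>cycle_minor_word\<close> applies.\<close>

lemma cyc_two_paths:
  assumes sg: "simple_rel E" and d: "distinct ps" "distinct rs" "set ps \<inter> set rs = {}" "set ps \<union> set rs \<subseteq> V"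
    and ne: "length ps \<ge> 2" "rs \<noteq> []"
    and P: "\<And>a b. a < length ps \<Longrightarrow> b < length ps \<Longrightarrow> E (ps ! a) (ps ! b) \<longleftrightarrow> b = Suc a \<or> a = Suc b"
    and R: "\<And>a b. a < length rs \<Longrightarrow> b < length rs \<Longrightarrow> E (rs ! a) (rs ! b) \<longleftrightarrow> b = Suc a \<or> a = Suc b"
    and C: "\<And>a b. a < length ps \<Longrightarrow> b < length rs \<Longrightarrow>
      E (ps ! a) (rs ! b) \<longleftrightarrow> a = 0 \<and> b = 0 \<or> Suc a = length ps \<and> Suc b = length rs"
    and n: "n \<ge> 4" "length ps + length rs \<ge> n"
  shows "cycle_minor n V E"
proof -
  obtain x xs where ps: "ps = x # xs" using ne by (cases ps) auto
  obtain y ys where rs: "rs = y # ys" using ne by (cases rs) auto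
  let ?w = "Lc # replicate (length xs) La @ replicate (length ys) Lb @ [Lc]"
  have dd: "distinct (x # y # xs @ ys)" using d ps rs by auto
  have xx: "x = ps ! 0" "y = rs ! 0" "last (x # xs) = ps ! (length ps - 1)" "last (y # ys) = rs ! (length rs - 1)"
    using last_conv_nth[of ps] last_conv_nth[of rs] ps rs by auto
  have ladder_edge: "ladder_edge ?w x y xs ys u v = (edge_pair (ps ! 0) (rs ! 0) u v \<noteq> (path_edge ps u v \<noteq> (path_edge rs u v \<noteq>
      edge_pair (ps ! (length ps - 1)) (rs ! (length rs - 1)) u v)))" for u v
    unfolding ladder_edge_cycle[OF dd] using xx ps rs by (simp del: last.simps)
  have "E u v = ladder_edge ?w x y xs ys u v" if "u \<in> set (x # y # xs @ ys)" "v \<in> set (x # y # xs @ ys)" for u v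
  proof -
    have inp: "ps ! a \<noteq> rs ! b" if "a < length ps" "b < length rs" for a b
      using d(3) nth_mem[OF that(1)] nth_mem[OF that(2)] by (metis IntI empty_iff)
    have z: "0 < length ps" "0 < length rs" "length ps - 1 < length ps" "length rs - 1 < length rs"
      using ps rs by auto
    have pp: "E (ps ! a) (ps ! b) = ladder_edge ?w x y xs ys (ps ! a) (ps ! b)" if "a < length ps" "b < length ps" for a b
    proof -
      have "\<not> edge_pair (ps ! c) (rs ! e) (ps ! a) (ps ! b)" if "e < length rs" for c e
        using inp[OF \<open>a < length ps\<close> that] inp[OF \<open>b < length ps\<close> that] unfolding edge_pair_def by metis
      moreover have "\<not> path_edge rs (ps ! a) (ps ! b)" using path_edge_in[of rs "ps ! a" "ps ! b"] d(3) nth_mem[OF that(1)] by blast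
      ultimately show ?thesis unfolding ladder_edge using P[OF that] path_edge_nth[OF d(1) that] z by simp
    qed
    have rr: "E (rs ! a) (rs ! b) = ladder_edge ?w x y xs ys (rs ! a) (rs ! b)" if "a < length rs" "b < length rs" for a b
    proof -
      have "\<not> edge_pair (ps ! c) (rs ! e) (rs ! a) (rs ! b)" if "c < length ps" for c e
        using inp[OF that \<open>a < length rs\<close>] inp[OF that \<open>b < length rs\<close>] unfolding edge_pair_def by metis
      moreover have "\<not> path_edge ps (rs ! a) (rs ! b)" using path_edge_in[of ps "rs ! a" "rs ! b"] d(3) nth_mem[OF that(1)] by blast
      ultimately show ?thesis unfolding ladder_edge using R[OF that] path_edge_nth[OF d(2) that] z by simp
    qed
    have pr1: "edge_pair (ps ! c) (rs ! e) (ps ! a) (rs ! b) \<longleftrightarrow> a = c \<and> b = e"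
      if "a < length ps" "b < length rs" "c < length ps" "e < length rs" for a b c e
      using d(1,2) that inp[of a e] by (simp add: edge_pair_def nth_eq_iff_index_eq)
    have c: "E (ps ! a) (rs ! b) = ladder_edge ?w x y xs ys (ps ! a) (rs ! b)" if "a < length ps" "b < length rs" for a b
    proof -
      have "\<not> path_edge rs (ps ! a) (rs ! b)" using path_edge_in[of rs "ps ! a" "rs ! b"] d(3) nth_mem[OF that(1)] by blast
      moreover have "\<not> path_edge ps (ps ! a) (rs ! b)" using path_edge_in[of ps "ps ! a" "rs ! b"] d(3) nth_mem[OF that(2)] by blast
      ultimately show ?thesis unfolding ladder_edge using C[OF that] pr1[OF that z(1,2)] pr1[OF that z(3,4)] z ne(1) that by auto
    qed
    have ers: "ladder_edge ?w x y xs ys u v = ladder_edge ?w x y xs ys v u" for u v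
      unfolding ladder_edge using edge_pair_commute path_edge_commute by metis
    have u: "(\<exists>a<length ps. u = ps ! a) \<or> (\<exists>a<length rs. u = rs ! a)"
      using that(1) ps rs by (metis UnE in_set_conv_nth list.set_intros(1) list.set_intros(2) set_ConsD set_append)
    have v: "(\<exists>a<length ps. v = ps ! a) \<or> (\<exists>a<length rs. v = rs ! a)"
      using that(2) ps rs by (metis UnE in_set_conv_nth list.set_intros(1) list.set_intros(2) set_ConsD set_append)
    show ?thesis using u v pp rr c ers simple_rel_sym[OF sg] by metis
  qed
  then have "has_ladder V E ?w" unfolding has_ladder_def fits_def
    using dd d(4) ps rs by (intro exI[of _ x] exI[of _ y] exI[of _ xs] exI[of _ ys]) auto
  then have "ladder_minor V E ?w" unfolding ladder_minor_def using vminor_sub[of V V E] by blast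
  then show ?thesis by (rule cycle_minor_word) (use n ps rs in auto)
qed

context minchain
begin

text \<open>\<open>{q ! x, us ! l}\<close> separates the earlier from the later part of the two paths.\<close>

definition separates :: "nat \<Rightarrow> nat \<Rightarrow> bool" where
  "separates l x \<longleftrightarrow> (\<forall>i<l. hi (us ! i) \<le> Suc x) \<and> (\<forall>i. l < i \<longrightarrow> i < m \<longrightarrow> x \<le> lo (us ! i))"

lemma u_inj: "i < m \<Longrightarrow> k < m \<Longrightarrow> us ! i = us ! k \<longleftrightarrow> i = k"
  using ud ulen by (simp add: nth_eq_iff_index_eq)

lemma in_us: "z \<in> set us \<longleftrightarrow> (\<exists>i<m. z = us ! i)"
  unfolding in_set_conv_nth using ulen by auto

lemma q_not_u: "i \<le> K \<Longrightarrow> k < m \<Longrightarrow> q ! i \<noteq> us ! k"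
  using u_in[of k] qlen nth_mem[of i q] by (metis DiffD2 less_Suc_eq_le)

text \<open>If the jump at \<open>l\<close> were not a separation, then \<open>us ! Suc l\<close> would look like \<open>q ! Suc j\<close> from
  the left and \<open>us ! l\<close> like \<open>q ! j'\<close> from the right, so these path vertices would be superfluous.\<close>

lemma no_overlap:
  assumes l: "0 < l" "l + 2 < m"
    and lw: "\<And>i. i < l \<Longrightarrow> hi (us ! i) \<le> j + 2" and lo1: "lo (us ! Suc l) = j"
    and hil: "hi (us ! l) = j' + 2" and jj: "j < j'"
  shows False
proof -
  \<comment> \<open>\<open>A\<close> and \<open>B\<close> are the parts of both paths before and
    after the overlap, \<open>M\<close> is the stretch of \<open>q\<close> to be discarded; only
    \<open>us ! l\<close> and \<open>us ! Suc l\<close> are left over. The existence of a rank-one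
    separation \<open>A'\<close> of \<open>H - M\<close> is to be carried over to
    \<open>H\<close>.\<close>
  define A where "A = (!) q ` {..j} \<union> (!) us ` {..<l}"
  define B where "B = (!) q ` {j'<..K} \<union> (!) us ` {Suc l<..<m}"
  define M where "M = (!) q ` {j<..j'}"
  let ?ul = "us ! l" and ?u1 = "us ! Suc l"
  have j'K: "j' < K" using hi_le[of ?ul] hil by simp
  have far: "j' \<le> lo (us ! i)" if "Suc l < i" "i < m" for i using u_far(1)[of l i] that hil by simp
  have AB: "\<not> E a b" if "a \<in> A" "b \<in> B" for a b
  proof -
    from that(1) consider (q) i where "i \<le> j" "a = q ! i" | (u) i where "i < l" "a = us ! i"
      unfolding A_def by auto
    then show ?thesis
    proof cases
      case q
      from that(2) consider (q2) k where "j' < k" "k \<le> K" "b = q ! k" | (u2) k where "Suc l < k" "k < m" "b = us ! k"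
        unfolding B_def by auto
      then show ?thesis
      proof cases
        case q2 then show ?thesis using q qE[of i k] jj by auto
      next
        case u2
        then show ?thesis using q hi_lo[of i b] far[of k] simple_rel_sym[OF sg, of a b] jj j'K by auto
      qed
    next
      case u
      from that(2) consider (q2) k where "j' < k" "k \<le> K" "b = q ! k" | (u2) k where "Suc l < k" "k < m" "b = us ! k"
        unfolding B_def by auto
      then show ?thesis
      proof cases
        case q2 then show ?thesis using u hi_lo[of k a] lw[of i] jj by auto
      next
        case u2
        then show ?thesis using u u_far(2)[of i k] lw[of i] far[of k] jj by auto
      qed
    qed
  qed
  have colA: "E a (q ! i) \<longleftrightarrow> i = Suc j \<and> E a ?u1" if "a \<in> A" "j < i" "i \<le> j'" for a i
  proof -
    from that(1) consider (q) k where "k \<le> j" "a = q ! k" | (u) k where "k < l" "a = us ! k"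
      unfolding A_def by auto
    then show ?thesis
    proof cases
      case q
      have "E a ?u1 \<longleftrightarrow> k = j"
        using q hi_lo[of k ?u1] lo_adj[of ?u1] lo1 simple_rel_sym[OF sg, of a ?u1] jj j'K by auto
      then show ?thesis using q qE[of k i] that j'K by auto
    next
      case u
      have "E a ?u1 \<longleftrightarrow> hi a = j + 2" using u_far(2)[of k "Suc l"] u l lo1 by simp
      then show ?thesis using u hi_lo[of i a] hi_adj[of a "Suc j"] lw[of k] that j'K by auto
    qed
  qed
  have rowB: "E (q ! i) b \<longleftrightarrow> i = j' \<and> E ?ul b" if "b \<in> B" "j < i" "i \<le> j'" for b i
  proof -
    from that(1) consider (q) k where "j' < k" "k \<le> K" "b = q ! k" | (u) k where "Suc l < k" "k < m" "b = us ! k"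
      unfolding B_def by auto
    then show ?thesis
    proof cases
      case q
      have "E ?ul b \<longleftrightarrow> k = Suc j'" using q hi_lo[of k ?ul] hi_adj[of ?ul "Suc j'"] hil by auto
      then show ?thesis using q qE[of i k] that j'K by auto
    next
      case u
      have "E ?ul b \<longleftrightarrow> lo b = j'" using u_far(2)[of l k] u hil by auto
      then show ?thesis using u hi_lo[of i b] lo_adj[of b] far[of k] that j'K simple_rel_sym[OF sg, of "q ! i" b] by auto
    qed
  qed
  let ?H = "H - M"
  have part: "z \<in> A \<or> z \<in> B \<or> z = ?ul \<or> z = ?u1 \<or> z \<in> M" if "z \<in> H" for z
  proof -
    from that H_eq in_q in_us consider (q) i where "i \<le> K" "z = q ! i" | (u) i where "i < m" "z = us ! i" by blast
    then show ?thesis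
    proof cases
      case q
      then have "i \<le> j \<or> j < i \<and> i \<le> j' \<or> j' < i \<and> i \<le> K" by auto
      then show ?thesis using q unfolding A_def B_def M_def by auto
    next
      case u
      then have "i < l \<or> i = l \<or> i = Suc l \<or> Suc l < i" by auto
      then show ?thesis using u unfolding A_def B_def by auto
    qed
  qed
  have Mq: "\<exists>i. j < i \<and> i \<le> j' \<and> z = q ! i" if "z \<in> M" for z using that unfolding M_def by auto
  have qM: "q ! i \<in> M \<longleftrightarrow> j < i \<and> i \<le> j'" if "i \<le> K" for i
  proof
    assume "q ! i \<in> M"
    then obtain k where "j < k" "k \<le> j'" "q ! i = q ! k" using Mq by blast
    then show "j < i \<and> i \<le> j'" using q_inj[of i k] that j'K by auto
  qed (auto simp: M_def)
  have uM: "us ! i \<notin> M" if "i < m" for i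
  proof
    assume "us ! i \<in> M"
    then obtain k where "k \<le> j'" "us ! i = q ! k" using Mq by blast
    then show False using q_not_u[of k i] that j'K by auto
  qed
  have MH: "M \<subseteq> H" using qH qlen j'K unfolding M_def by auto
  have ends: "x0 = us ! 0" "y0 = us ! (m - 1)" using u0 um by auto
  have XH: "q ! 0 \<in> ?H" "x0 \<in> ?H" "q ! K \<in> ?H" "y0 \<in> ?H"
    using qM[of 0] qM[of K] uM[of 0] uM[of "m - 1"] qH qlen ends l j'K x0(1) y0(1) by auto
  have XA: "q ! 0 \<in> A" "x0 \<in> A" using ends l unfolding A_def by auto
  have YB: "q ! K \<in> B" "y0 \<in> B" using ends l j'K unfolding B_def by auto
  have uls: "?ul \<in> ?H" "?u1 \<in> ?H" using u_in[of l] u_in[of "Suc l"] uM l by auto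
  have AH: "A \<subseteq> ?H" "B \<subseteq> ?H"
  proof -
    show "A \<subseteq> ?H" unfolding A_def using qM uM qH qlen u_in l jj j'K by auto
    show "B \<subseteq> ?H" unfolding B_def using qM uM qH qlen u_in l jj j'K by auto
  qed
  have "q ! Suc j \<in> M" using jj unfolding M_def by auto
  then have "?H \<subset> H" using MH by blast
  then have nl: "\<not> linked ?H E {q ! 0, x0} {q ! K, y0}" by (rule minimal) (use XH in auto)
  obtain A' f g where A': "{q ! 0, x0} \<subseteq> A'" "A' \<subseteq> ?H" "A' \<inter> {q ! K, y0} = {}"
    "\<And>x y. x \<in> A' \<Longrightarrow> y \<in> ?H - A' \<Longrightarrow> E x y \<longleftrightarrow> f x \<and> g y"
    by (rule not_linkedE[OF nl]) (rule that)
  have BD: "y \<in> ?H - A'" if "y \<in> B" "y \<notin> A'" for y using that AH by blast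
  have AD: "y \<in> ?H - A'" if "y \<in> A" "y \<notin> A'" for y using that AH by blast
  \<comment> \<open>Everything except \<open>B - A'\<close> goes to the left side. By
    \<open>rowB\<close>, within \<open>M\<close> only \<open>q ! j'\<close> has neighbours there,
    and its row is that of \<open>us ! l\<close>, so \<open>M\<close> does not raise the
    rank.\<close>
  have right: False if r: "\<And>z y. z \<in> H - M - A - (B - A') \<Longrightarrow> y \<in> B \<Longrightarrow> y \<notin> A' \<Longrightarrow> E z y \<longleftrightarrow> f' z \<and> g' y"
    and ul: "\<And>y. y \<in> B \<Longrightarrow> y \<notin> A' \<Longrightarrow> E ?ul y \<longleftrightarrow> f' ?ul \<and> g' y" for f' g'
  proof (rule linkedD[OF lk, of "H - (B - A')" "\<lambda>z. if z \<in> M then z = q ! j' \<and> f' ?ul else z \<notin> A \<and> f' z" g'])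
    show "{q ! 0, x0} \<subseteq> H - (B - A')" using XH A'(1) by auto
    show "(H - (B - A')) \<inter> {q ! K, y0} = {}" using YB A'(3) by auto
    fix z y assume z: "z \<in> H - (B - A')" and "y \<in> H - (H - (B - A'))"
    then have y: "y \<in> B" "y \<notin> A'" by auto
    show "E z y \<longleftrightarrow> (if z \<in> M then z = q ! j' \<and> f' ?ul else z \<notin> A \<and> f' z) \<and> g' y"
    proof (cases "z \<in> M")
      case True
      then obtain i where i: "j < i" "i \<le> j'" "z = q ! i" using Mq by blast
      have "E z y \<longleftrightarrow> i = j' \<and> E ?ul y" using rowB[OF y(1) i(1,2)] i(3) by simp
      moreover have "i = j' \<longleftrightarrow> z = q ! j'" using i q_inj[of i j'] j'K by auto
      ultimately show ?thesis using True ul[OF y] by auto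
    next
      case False
      show ?thesis
      proof (cases "z \<in> A")
        case True
        then show ?thesis using AB[OF True y(1)] False by auto
      next
        case nA: False
        then show ?thesis using r[of z y] z False y by auto
      qed
    qed
  qed auto
  \<comment> \<open>Dually only \<open>A \<inter> A'\<close> stays on the left. By
    \<open>colA\<close> the column of \<open>q ! Suc j\<close> is that of \<open>us ! Suc l\<close>,
    and the other columns of \<open>M\<close> vanish.\<close>
  have left: False if r: "\<And>z y. z \<in> A \<Longrightarrow> z \<in> A' \<Longrightarrow> y \<in> H - M - B - (A \<inter> A') \<Longrightarrow> E z y \<longleftrightarrow> f' z \<and> g' y"
    and ul: "\<And>z. z \<in> A \<Longrightarrow> z \<in> A' \<Longrightarrow> E z ?u1 \<longleftrightarrow> f' z \<and> g' ?u1" for f' g'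
  proof (rule linkedD[OF lk, of "A \<inter> A'" f' "\<lambda>y. if y \<in> M then y = q ! Suc j \<and> g' ?u1 else y \<notin> B \<and> g' y"])
    show "{q ! 0, x0} \<subseteq> A \<inter> A'" using XA A'(1) by auto
    show "A \<inter> A' \<inter> {q ! K, y0} = {}" using A'(3) by auto
    show "A \<inter> A' \<subseteq> H" using A'(2) by auto
    fix z y assume "z \<in> A \<inter> A'" and y: "y \<in> H - A \<inter> A'"
    then have z: "z \<in> A" "z \<in> A'" by auto
    show "E z y \<longleftrightarrow> f' z \<and> (if y \<in> M then y = q ! Suc j \<and> g' ?u1 else y \<notin> B \<and> g' y)"
    proof (cases "y \<in> M")
      case True
      then obtain i where i: "j < i" "i \<le> j'" "y = q ! i" using Mq by blast
      have "E z y \<longleftrightarrow> i = Suc j \<and> E z ?u1" using colA[OF z(1) i(1,2)] i(3) by simp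
      moreover have "i = Suc j \<longleftrightarrow> y = q ! Suc j" using i q_inj[of i "Suc j"] j'K by auto
      ultimately show ?thesis using True ul[OF z] by auto
    next
      case False
      show ?thesis
      proof (cases "y \<in> B")
        case True
        then show ?thesis using AB[OF z(1) True] False by auto
      next
        case nB: False
        then show ?thesis using r[of z y] z False y by auto
      qed
    qed
  qed
  have cross: False if "e1 \<in> A" "e1 \<in> A'" "f e1" "e4 \<in> B" "e4 \<notin> A'" "g e4" for e1 e4
    using AB[OF that(1,4)] A'(4)[OF that(2) BD[OF that(4,5)]] that by blast
  consider (1) "?ul \<in> A'" "?u1 \<in> A'" | (2) "?ul \<notin> A'" "?u1 \<notin> A'" | (3) "?ul \<in> A'" "?u1 \<notin> A'"
    | (4) "?ul \<notin> A'" "?u1 \<in> A'" by blast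
  then show False
  proof cases
    case 1
    show False
    proof (rule right[of f g])
      fix z y assume z: "z \<in> H - M - A - (B - A')" and y: "y \<in> B" "y \<notin> A'"
      have "z \<in> A'" using part[of z] z 1 by blast
      then show "E z y \<longleftrightarrow> f z \<and> g y" using A'(4) BD[OF y] by blast
    next
      fix y assume y: "y \<in> B" "y \<notin> A'"
      show "E ?ul y \<longleftrightarrow> f ?ul \<and> g y" using A'(4) BD[OF y] 1 by blast
    qed
  next
    case 2
    show False
    proof (rule left[of f g])
      fix z y assume z: "z \<in> A" "z \<in> A'" and y: "y \<in> H - M - B - (A \<inter> A')"
      have "y \<in> ?H - A'" using part[of y] y 2 by blast
      then show "E z y \<longleftrightarrow> f z \<and> g y" using A'(4) z by blast
    next
      fix z assume z: "z \<in> A" "z \<in> A'"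
      show "E z ?u1 \<longleftrightarrow> f z \<and> g ?u1" using A'(4)[OF z(2), of ?u1] 2 uls by blast
    qed
  next
    \<comment> \<open>Along \<open>q\<close>, or by the edge from \<open>q ! j\<close> to
      \<open>us ! Suc l\<close>, some vertex of \<open>A\<close> has an edge leaving
      \<open>A'\<close>. Likewise some vertex of \<open>B\<close> receives one. Rank one would join
      these two vertices, against \<open>AB\<close>.\<close>
    case 3
    have qA: "q ! i \<in> A" if "i \<le> j" for i using that unfolding A_def by auto
    have qB: "q ! i \<in> B" if "j' < i" "i \<le> K" for i using that unfolding B_def by auto
    have "\<exists>e1. e1 \<in> A \<and> e1 \<in> A' \<and> f e1"
    proof (cases "\<forall>i\<le>j. q ! i \<in> A'")
      case True
      have "E (q ! j) ?u1" using lo_adj[of ?u1] lo1 simple_rel_sym[OF sg] jj j'K by auto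
      then have "f (q ! j)" using A'(4)[of "q ! j" ?u1] True 3 uls by blast
      then show ?thesis using True qA by blast
    next
      case False
      define i where "i = (LEAST i. i \<le> j \<and> q ! i \<notin> A')"
      have i: "i \<le> j \<and> q ! i \<notin> A'" unfolding i_def using False by (metis (mono_tags, lifting) LeastI)
      have i0: "i \<noteq> 0" using i A'(1) by (metis insert_subset)
      have im: "q ! (i - 1) \<in> A'"
      proof (rule ccontr)
        assume "q ! (i - 1) \<notin> A'"
        then have "i \<le> i - 1" using i by (subst (1) i_def) (rule Least_le, auto)
        then show False using i0 by simp
      qed
      have "E (q ! (i - 1)) (q ! i)" using qE[of "i - 1" i] i i0 jj j'K by auto
      then have "f (q ! (i - 1))" using A'(4)[OF im AD[OF qA]] i by blast
      then show ?thesis using im qA[of "i - 1"] i by (intro exI[of _ "q ! (i - 1)"]) auto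
    qed
    moreover have "\<exists>e4. e4 \<in> B \<and> e4 \<notin> A' \<and> g e4"
    proof (cases "\<forall>i. j' < i \<longrightarrow> i \<le> K \<longrightarrow> q ! i \<notin> A'")
      case True
      have s: "q ! Suc j' \<notin> A'" using True j'K by simp
      have "E ?ul (q ! Suc j')" using hi_adj[of ?ul "Suc j'"] hil by simp
      then have "g (q ! Suc j')" using A'(4)[OF 3(1) BD[OF qB s]] j'K by simp
      then show ?thesis using s qB[of "Suc j'"] j'K by auto
    next
      case False
      then obtain k where k: "j' < k" "k \<le> K" "q ! k \<in> A'" by blast
      define i where "i = (LEAST i. k \<le> i \<and> i \<le> K \<and> q ! i \<notin> A')"
      have i: "k \<le> i \<and> i \<le> K \<and> q ! i \<notin> A'" unfolding i_def
        by (rule LeastI[of _ K]) (use k A'(3) in auto)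
      have ki: "k < i" using i k by (cases "k = i") auto
      have im: "q ! (i - 1) \<in> A'"
      proof (rule ccontr)
        assume "q ! (i - 1) \<notin> A'"
        then have "i \<le> i - 1" using i ki by (subst (1) i_def) (rule Least_le, auto)
        then show False using ki by simp
      qed
      have "E (q ! (i - 1)) (q ! i)" using qE[of "i - 1" i] i ki by auto
      moreover have iB: "q ! i \<in> B" using qB[of i] i ki k by auto
      ultimately have "g (q ! i)" using A'(4)[OF im BD[OF iB]] i by blast
      then show ?thesis using i iB by blast
    qed
    ultimately show False using cross by blast
  next
    \<comment> \<open>By \<open>cross\<close> either no vertex of \<open>B - A'\<close> satisfies
      \<open>g\<close>, and then \<open>us ! l\<close> is the only candidate for edges to
      \<open>B - A'\<close> in \<open>right\<close>; or no vertex of \<open>A \<inter> A'\<close>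
      satisfies \<open>f\<close>, and then \<open>us ! Suc l\<close> is the only candidate in
      \<open>left\<close>.\<close>
    case 4
    show False
    proof (cases "\<exists>e1. e1 \<in> A \<and> e1 \<in> A' \<and> f e1")
      case True
      then have ng: "\<not> g y" if "y \<in> B" "y \<notin> A'" for y using cross that by blast
      show False
      proof (rule right[of "\<lambda>z. z = ?ul" "\<lambda>y. E ?ul y"])
        fix z y assume z: "z \<in> H - M - A - (B - A')" and y: "y \<in> B" "y \<notin> A'"
        have "z = ?ul \<or> z \<in> A'" using part[of z] z 4 by blast
        then show "E z y \<longleftrightarrow> z = ?ul \<and> E ?ul y" using A'(4) BD[OF y] ng[OF y] 4 by blast
      qed auto
    next
      case False
      show False
      proof (rule left[of "\<lambda>z. E z ?u1" "\<lambda>y. y = ?u1"])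
        fix z y assume z: "z \<in> A" "z \<in> A'" and y: "y \<in> H - M - B - (A \<inter> A')"
        have "y = ?u1 \<or> y \<in> ?H - A'" using part[of y] y 4 by blast
        then show "E z y \<longleftrightarrow> E z ?u1 \<and> y = ?u1" using A'(4)[OF z(2)] False z 4 by blast
      qed auto
    qed
  qed
qed

end

section \<open>Building ladders inside a graph\<close>

lemma ladder_edge_sym: "ladder_edge w x y xs ys u v = ladder_edge w x y xs ys v u"
proof (induction w arbitrary: x y xs ys)
  case (Cons l w)
  then show ?case by (cases l) (simp_all add: edge_pair_commute[of _ _ u v])
qed simp

definition ladder_on :: "('a \<Rightarrow> 'a \<Rightarrow> bool) \<Rightarrow> letter list \<Rightarrow> 'a \<Rightarrow> 'a \<Rightarrow> 'a list \<Rightarrow> 'a list \<Rightarrow> bool" where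
  "ladder_on E w x y xs ys \<longleftrightarrow> fits w x y xs ys \<and>
     (\<forall>u \<in> set (x # y # xs @ ys). \<forall>v \<in> set (x # y # xs @ ys). E u v = ladder_edge w x y xs ys u v)"

text \<open>New vertices see old ones only at the frontier, so checking the local part suffices.
  \<open>old\<close> is required since the adjacency of the two frontier vertices is already
  accounted for by \<open>w\<close>.\<close>

lemma ladder_on_extend:
  assumes sg: "simple_rel E" and w: "ladder_on E w x y xs ys"
    and f: "xf = last (x # xs)" "yf = last (y # ys)"
    and len: "length xs2 = count_list s La" "length ys2 = count_list s Lb"
    and d: "distinct (xs2 @ ys2)" "set (xs2 @ ys2) \<inter> set (x # y # xs @ ys) = {}"
    and far: "\<And>u v. u \<in> set (x # y # xs @ ys) \<Longrightarrow> u \<noteq> xf \<Longrightarrow> u \<noteq> yf \<Longrightarrow> v \<in> set (xs2 @ ys2) \<Longrightarrow> \<not> E u v"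
    and loc: "\<And>u v. u \<in> set (xf # yf # xs2 @ ys2) \<Longrightarrow> v \<in> set (xs2 @ ys2) \<Longrightarrow> E u v = ladder_edge s xf yf xs2 ys2 u v"
    and old: "\<And>u v. u \<in> {xf, yf} \<Longrightarrow> v \<in> {xf, yf} \<Longrightarrow> \<not> ladder_edge s xf yf xs2 ys2 u v"
  shows "ladder_on E (w @ s) x y (xs @ xs2) (ys @ ys2)"
proof -
  let ?O = "set (x # y # xs @ ys)" and ?N = "set (xs2 @ ys2)"
  have w1: "distinct (x # y # xs @ ys)" "length xs = count_list w La" "length ys = count_list w Lb"
    and w2: "\<And>u v. u \<in> ?O \<Longrightarrow> v \<in> ?O \<Longrightarrow> E u v = ladder_edge w x y xs ys u v"
    using w unfolding ladder_on_def fits_def by auto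
  have S: "set (x # y # (xs @ xs2) @ ys @ ys2) = ?O \<union> ?N" by auto
  have fO: "xf \<in> ?O" "yf \<in> ?O"
    using last_in_set[of "x # xs"] last_in_set[of "y # ys"] unfolding f by auto
  have fits: "fits (w @ s) x y (xs @ xs2) (ys @ ys2)" unfolding fits_def
    using w1 len d by auto
  have e: "ladder_edge (w @ s) x y (xs @ xs2) (ys @ ys2) u v = (ladder_edge w x y xs ys u v \<noteq> ladder_edge s xf yf xs2 ys2 u v)" for u v
    unfolding f by (rule ladder_edge_append[OF w1(2,3)])
  have new: "E u v = ladder_edge (w @ s) x y (xs @ xs2) (ys @ ys2) u v" if "u \<in> ?O \<union> ?N" "v \<in> ?N" for u v
  proof -
    have "v \<notin> ?O" using that d(2) by blast
    then have "\<not> ladder_edge w x y xs ys u v" using ladder_edge_verts[OF w1(2,3)] by blast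
    moreover have "E u v = ladder_edge s xf yf xs2 ys2 u v"
    proof (cases "u \<in> set (xf # yf # xs2 @ ys2)")
      case True then show ?thesis using loc that by blast
    next
      case False
      then have "\<not> E u v" using far[of u v] that by auto
      then show ?thesis using ladder_edge_verts[OF len] False by blast
    qed
    ultimately show ?thesis unfolding e by blast
  qed
  have "E u v = ladder_edge (w @ s) x y (xs @ xs2) (ys @ ys2) u v" if "u \<in> ?O \<union> ?N" "v \<in> ?O \<union> ?N" for u v
  proof (cases "u \<in> ?N \<or> v \<in> ?N")
    case True
    then show ?thesis using new[of u v] new[of v u] that simple_rel_sym[OF sg, of u v] ladder_edge_sym[of "w @ s" x y "xs @ xs2" "ys @ ys2" u v] by auto
  next
    case False
    then have o: "u \<in> ?O" "v \<in> ?O" using that by auto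
    have "\<not> ladder_edge s xf yf xs2 ys2 u v"
    proof
      assume ladder_edge: "ladder_edge s xf yf xs2 ys2 u v"
      then have "u \<in> {xf, yf}" "v \<in> {xf, yf}" using ladder_edge_verts[OF len ladder_edge] False by auto
      then show False using old ladder_edge by blast
    qed
    then show ?thesis unfolding e using w2[OF o] by blast
  qed
  then show ?thesis unfolding ladder_on_def S using fits by blast
qed

lemma ladder_on_vw: "ladder_on E w x y xs ys \<Longrightarrow> set (x # y # xs @ ys) \<subseteq> V \<Longrightarrow> ladder_minor V E w"
  unfolding ladder_minor_def ladder_on_def has_ladder_def using vminor_sub[of V V E] by blast

text \<open>Since no two letters \<open>Lc\<close> are adjacent in \<open>w @ [Lc]\<close>, only the
  first run can be empty, namely when this word begins with \<open>Lc\<close>.\<close>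

lemma word_runs:
  "ladder_minor V E (p @ Lc # w @ [Lc]) \<Longrightarrow> successively (\<lambda>k l. \<not> (k = Lc \<and> l = Lc)) (w @ [Lc]) \<Longrightarrow>
   \<exists>rs. rs \<noteq> [] \<and> ladder_minor V E (p @ enc rs) \<and> (0, 0) \<notin> set (tl rs) \<and> (hd (w @ [Lc]) \<noteq> Lc \<longrightarrow> hd rs \<noteq> (0, 0)) \<and>
     sum_list (map rsize rs) = count_list w La + count_list w Lb"
proof (induction "length w" arbitrary: w p rule: less_induct)
  case less
  define u where "u = takeWhile (\<lambda>l. l \<noteq> Lc) w"
  define t where "t = dropWhile (\<lambda>l. l \<noteq> Lc) w"
  have w: "w = u @ t" unfolding u_def t_def by simp
  have uc: "Lc \<notin> set u" unfolding u_def by (auto dest: set_takeWhileD)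
  define r where "r = (count_list u La, count_list u Lb)"
  have len: "length u = rsize r" using uc unfolding r_def rsize_def
  proof (induction u)
    case (Cons l u)
    then show ?case by (cases l) auto
  qed simp
  have r0: "r \<noteq> (0, 0)" if "hd (w @ [Lc]) \<noteq> Lc"
  proof -
    have "u \<noteq> []" using that w unfolding u_def by (cases w) auto
    then show ?thesis using len by (auto simp: rsize_def)
  qed
  have runp: "ladder_minor V E (p @ Lc # run r @ s)" if "ladder_minor V E (p @ Lc # u @ s)" for s
    using ladder_minor_perm[of V E "p @ [Lc]" u s "run r"] that uc unfolding r_def by simp
  show ?case
  proof (cases t)
    case Nil
    then have "ladder_minor V E (p @ Lc # u @ [Lc])" using less.prems(1) w by simp
    from runp[OF this] have "ladder_minor V E (p @ enc [r])" by simp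
    then show ?thesis using r0 w Nil by (intro exI[of _ "[r]"]) (auto simp: r_def rsize_def)
  next
    case (Cons l t')
    have l: "l = Lc" using Cons hd_dropWhile[of "\<lambda>l. l \<noteq> Lc" w] unfolding t_def by force
    have "ladder_minor V E (p @ Lc # u @ (Lc # t' @ [Lc]))" using less.prems(1) w Cons l by simp
    from runp[OF this] have v: "ladder_minor V E ((p @ Lc # run r) @ Lc # t' @ [Lc])" by simp
    have s: "successively (\<lambda>k l. \<not> (k = Lc \<and> l = Lc)) (Lc # t' @ [Lc])"
      using less.prems(2) w Cons l by (simp add: successively_append_iff)
    then have s': "successively (\<lambda>k l. \<not> (k = Lc \<and> l = Lc)) (t' @ [Lc])" "hd (t' @ [Lc]) \<noteq> Lc"
      by (auto simp: successively_Cons)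
    obtain rs where rs: "rs \<noteq> []" "ladder_minor V E ((p @ Lc # run r) @ enc rs)" "(0, 0) \<notin> set (tl rs)" "hd rs \<noteq> (0, 0)"
      "sum_list (map rsize rs) = count_list t' La + count_list t' Lb"
      using less.hyps[OF _ v s'(1)] s'(2) w Cons by auto
    have z: "(0, 0) \<notin> set rs" using rs(1,3,4) by (cases rs) auto
    show ?thesis using rs z r0 w Cons l by (intro exI[of _ "r # rs"]) (auto simp: r_def rsize_def)
  qed
qed

text \<open>Unless one run is already long enough for a cycle, each has at most \<open>n\<close>
  letters, so many letters mean many runs.\<close>

lemma cycle_minor_nocc_word:
  assumes n: "n \<ge> 4" and v: "ladder_minor V E (Lc # w @ [Lc])"
    and s: "successively (\<lambda>k l. \<not> (k = Lc \<and> l = Lc)) (Lc # w @ [Lc])"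
    and big: "count_list w La + count_list w Lb \<ge> ((n - 1) * (n - 1) + 2 * n + 3) * n"
  shows "cycle_minor n V E"
proof -
  have s': "successively (\<lambda>k l. \<not> (k = Lc \<and> l = Lc)) (w @ [Lc])" "hd (w @ [Lc]) \<noteq> Lc"
    using s by (auto simp: successively_Cons)
  obtain rs where rs: "rs \<noteq> []" "runs_minor V E rs" "(0, 0) \<notin> set (tl rs)" "hd rs \<noteq> (0, 0)"
    "sum_list (map rsize rs) = count_list w La + count_list w Lb"
    using word_runs[of V E "[]" w] v s' unfolding runs_minor_def by auto
  have z: "(0, 0) \<notin> set rs" using rs(1,3,4) by (cases rs) auto
  show ?thesis
  proof (cases "\<exists>r \<in> set rs. rsize r + 2 \<ge> n")
    case True
    then show ?thesis using runs_minor_long_run[OF rs(2) z _ n] by blast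
  next
    case False
    then have "\<And>r. r \<in> set rs \<Longrightarrow> rsize r \<le> n" by force
    then have "sum_list (map rsize rs) \<le> length rs * n"
      using sum_list_mono[of rs rsize "\<lambda>_. n"] by (simp add: sum_list_triv)
    then have "((n - 1) * (n - 1) + 2 * n + 3) * n \<le> length rs * n" using big rs(5) by linarith
    then have "length rs \<ge> (n - 1) * (n - 1) + 2 * n + 3" using n by simp
    then show ?thesis using cycle_minor_runs[OF n rs(2) z] by blast
  qed
qed

text \<open>A two by two matrix of rank two over the two-element field has determinant one, so
  exactly one of its two diagonal products is nonzero.\<close>

lemma rank2_matching:
  assumes "\<not> rank1 E {x, y} {c, d}" "c \<noteq> d" "x \<noteq> y"
  shows "(E x c \<and> E y d \<and> \<not> (E x d \<and> E y c)) \<or> (E x d \<and> E y c \<and> \<not> (E x c \<and> E y d))"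
proof (rule ccontr)
  assume n: "\<not> ?thesis"
  have "rank1 E {x, y} {c, d}" unfolding rank1_def
    by (rule exI[of _ "\<lambda>z. z = x \<and> (E x c \<or> E x d) \<or> z = y \<and> (E y c \<or> E y d)"],
        rule exI[of _ "\<lambda>w. w = c \<and> (E x c \<or> E y c) \<or> w = d \<and> (E x d \<or> E y d)"])
      (use n assms(2,3) in auto)
  then show False using assms(1) by blast
qed

lemma path_edge_snoc:
  assumes "l \<noteq> []"
  shows "path_edge (l @ [z]) u v \<longleftrightarrow> path_edge l u v \<or> edge_pair (last l) z u v"
  using assms
proof (induction l)
  case (Cons x l)
  then show ?case by (cases l) (auto simp: path_edge_Cons)
qed simp

lemma induced_path:
  assumes sg: "simple_rel E" and conn: "(\<lambda>u v. E u v \<and> u \<in> W \<and> v \<in> W)\<^sup>*\<^sup>* x y" and xy: "x \<noteq> y"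
  obtains zs where "distinct (x # zs @ [y])" "set (x # zs @ [y]) \<subseteq> W"
    "\<And>u v. u \<in> set (x # zs @ [y]) \<Longrightarrow> v \<in> set (x # zs @ [y]) \<Longrightarrow> E u v = path_edge (x # zs @ [y]) u v"
proof -
  let ?R = "\<lambda>u v. E u v \<and> u \<in> W \<and> v \<in> W"
  obtain vs where "dpath ?R {x} {y} vs" using dpath_rtranclp[OF conn] by blast
  then obtain us where us: "dpath ?R {x} {y} us" "\<And>i j. i + 2 \<le> j \<Longrightarrow> j < length us \<Longrightarrow> \<not> ?R (us ! i) (us ! j)"
    "distinct us" by (rule shortest_dpath) blast
  have hl: "us \<noteq> []" "hd us = x" "last us = y" using us(1) unfolding dpath_def by auto
  then obtain us' where us': "us = x # us'" by (cases us) auto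
  have "us' \<noteq> []" using us' hl xy by auto
  then obtain zs where zs: "us = x # zs @ [y]" using us' hl by (metis append_butlast_last_id last_ConsR)
  have nx: "E (us ! i) (us ! Suc i)" "us ! i \<in> W" "us ! Suc i \<in> W" if "Suc i < length us" for i
    using dpath_nth[OF us(1) that] by auto
  have W: "us ! i \<in> W" if "i < length us" for i
  proof (cases i)
    case 0 then show ?thesis using nx(2)[of 0] zs by simp
  next
    case (Suc k) then show ?thesis using nx(3)[of k] that by simp
  qed
  have fw: "E (us ! i) (us ! j) \<longleftrightarrow> j = Suc i" if "i < j" "j < length us" for i j
    using us(2)[of i j] nx(1)[of i] that W[of i] W[of j] by (cases "j = Suc i") auto
  have E: "E (us ! i) (us ! j) \<longleftrightarrow> j = Suc i \<or> i = Suc j" if "i < length us" "j < length us" for i j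
  proof -
    consider "i < j" | "i = j" | "j < i" by linarith
    then show ?thesis
    proof cases
      case 1 then show ?thesis using fw[of i j] that by auto
    next
      case 2 then show ?thesis using sg unfolding simple_rel_def by auto
    next
      case 3 then show ?thesis using fw[of j i] that simple_rel_sym[OF sg, of "us ! i" "us ! j"] by auto
    qed
  qed
  have "E u v = path_edge us u v" if uv: "u \<in> set us" "v \<in> set us" for u v
  proof -
    obtain i j where "i < length us" "u = us ! i" "j < length us" "v = us ! j"
      using uv by (metis in_set_conv_nth)
    then show ?thesis using E[of i j] path_edge_nth[OF us(3), of i j] by auto
  qed
  moreover have "set us \<subseteq> W" using W by (metis in_set_conv_nth subsetI)
  ultimately show ?thesis using that[of zs] us(3) zs by simp
qed

subsection \<open>Layered graphs\<close>

text \<open>The graph after the elimination: each pair \<open>{a t, b t}\<close> separates the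
  layers before it from those after it. \<open>left\<close> and \<open>right\<close> provide the
  paths that close the ladder at its two ends.\<close>

locale layered =
  fixes V :: "'a set" and E :: "'a \<Rightarrow> 'a \<Rightarrow> bool" and L R X Y :: "'a set" and a b :: "nat \<Rightarrow> 'a" and T :: nat
  assumes sg: "simple_rel E" and T2: "T \<ge> 2"
    and VL: "V = L \<union> R \<union> a ` {..<T} \<union> b ` {..<T}"
    and LR: "L \<inter> R = {}"
    and aLR: "\<And>t. t < T \<Longrightarrow> a t \<notin> L \<union> R" "\<And>t. t < T \<Longrightarrow> b t \<notin> L \<union> R"
    and ab: "\<And>s t. s < T \<Longrightarrow> t < T \<Longrightarrow> a s \<noteq> b t"
    and inj: "\<And>s t. s < T \<Longrightarrow> t < T \<Longrightarrow> a s = a t \<Longrightarrow> s = t" "\<And>s t. s < T \<Longrightarrow> t < T \<Longrightarrow> b s = b t \<Longrightarrow> s = t"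
    and an: "\<And>t. t < T \<Longrightarrow> nonadjacent E (L \<union> a ` {..<t} \<union> b ` {..<t}) (R \<union> a ` {t<..<T} \<union> b ` {t<..<T})"
    and lk: "linked V E X Y" and XL: "X \<subseteq> L" and YR: "Y \<subseteq> R"
    and left: "(\<lambda>u v. E u v \<and> u \<in> L \<union> {a 0, b 0} \<and> v \<in> L \<union> {a 0, b 0})\<^sup>*\<^sup>* (a 0) (b 0)"
    and right: "(\<lambda>u v. E u v \<and> u \<in> R \<union> {a (T - 1), b (T - 1)} \<and> v \<in> R \<union> {a (T - 1), b (T - 1)})\<^sup>*\<^sup>* (a (T - 1)) (b (T - 1))"
begin

lemma nonadj:
  assumes "t < T" "u \<in> L \<or> (\<exists>s<t. u = a s \<or> u = b s)" "v \<in> R \<or> (\<exists>s. t < s \<and> s < T \<and> (v = a s \<or> v = b s))"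
  shows "\<not> E u v"
  using an[OF assms(1)] assms(2,3) unfolding nonadjacent_def by auto

text \<open>All edges across the cut after layer \<open>t\<close> run between the two pairs, so a
  rank-one matrix there would contradict \<open>linked\<close>.\<close>

lemma rank2:
  assumes t: "Suc t < T"
  shows "\<not> rank1 E {a t, b t} {a (Suc t), b (Suc t)}"
proof
  assume "rank1 E {a t, b t} {a (Suc t), b (Suc t)}"
  then obtain f g where fg: "\<And>x y. x \<in> {a t, b t} \<Longrightarrow> y \<in> {a (Suc t), b (Suc t)} \<Longrightarrow> E x y \<longleftrightarrow> f x \<and> g y"
    unfolding rank1_def by blast
  let ?A = "L \<union> a ` {..t} \<union> b ` {..t}"
  show False
  proof (rule linkedD[OF lk, of ?A "\<lambda>z. z \<in> {a t, b t} \<and> f z" "\<lambda>w. w \<in> {a (Suc t), b (Suc t)} \<and> g w"])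
    show "X \<subseteq> ?A" using XL by auto
    show "?A \<subseteq> V" using t unfolding VL by auto
    have "a s \<notin> Y" "b s \<notin> Y" if "s \<le> t" for s using aLR[of s] YR t that by auto
    then show "?A \<inter> Y = {}" using YR LR by auto
    fix z w assume z: "z \<in> ?A" and w: "w \<in> V - ?A"
    have w': "w \<in> R \<or> (\<exists>s. t < s \<and> s < T \<and> (w = a s \<or> w = b s))"
    proof -
      consider "w \<in> R" | s where "s < T" "w = a s \<or> w = b s" using w unfolding VL by auto
      then show ?thesis
      proof cases
        case 2
        have "\<not> s \<le> t" using w 2 by auto
        then show ?thesis using 2 by (intro disjI2 exI[of _ s]) auto
      qed simp
    qed
    show "E z w \<longleftrightarrow> (z \<in> {a t, b t} \<and> f z) \<and> (w \<in> {a (Suc t), b (Suc t)} \<and> g w)"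
    proof (cases "z \<in> {a t, b t}")
      case True
      show ?thesis
      proof (cases "w \<in> {a (Suc t), b (Suc t)}")
        case T2: True
        then show ?thesis using fg[OF True T2] True by blast
      next
        case False
        have "w \<in> R \<or> (\<exists>s. Suc t < s \<and> s < T \<and> (w = a s \<or> w = b s))"
        proof -
          from w' consider "w \<in> R" | s where "t < s" "s < T" "w = a s \<or> w = b s" by blast
          then show ?thesis
          proof cases
            case 2
            have "s \<noteq> Suc t" using False 2 by auto
            then show ?thesis using 2 by (intro disjI2 exI[of _ s]) auto
          qed simp
        qed
        then have "\<not> E z w" using nonadj[OF t, of z w] True by blast
        then show ?thesis using False by blast
      qed
    next
      case False
      have "z \<in> L \<or> (\<exists>s<t. z = a s \<or> z = b s)"
      proof -
        consider "z \<in> L" | s where "s \<le> t" "z = a s \<or> z = b s" using z by auto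
        then show ?thesis
        proof cases
          case 2
          have "s \<noteq> t" using False 2 by auto
          then show ?thesis using 2 by (intro disjI2 exI[of _ s]) auto
        qed simp
      qed
      then have "\<not> E z w" using nonadj[OF _ _ w', of z] t by simp
      then show ?thesis using False by blast
    qed
  qed
qed

text \<open>Names are chosen layer by layer so that the nonzero diagonal product from
  \<open>rank2_matching\<close> always gives the edges \<open>x\<close>-\<open>x\<close> and
  \<open>y\<close>-\<open>y\<close>. At most one crossing edge can then occur.\<close>

lemma labels:
  obtains x y where "\<And>t. t < T \<Longrightarrow> {x t, y t} = {a t, b t}" "\<And>t. t < T \<Longrightarrow> x t \<noteq> y t" "x 0 = a 0" "y 0 = b 0"
    "\<And>t. Suc t < T \<Longrightarrow> E (x t) (x (Suc t)) \<and> E (y t) (y (Suc t)) \<and> \<not> (E (x t) (y (Suc t)) \<and> E (y t) (x (Suc t)))"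
proof -
  let ?P = "\<lambda>t (p::'a \<times> 'a). (t < T \<longrightarrow> {fst p, snd p} = {a t, b t} \<and> fst p \<noteq> snd p) \<and> (t = 0 \<longrightarrow> p = (a 0, b 0))"
  let ?Q = "\<lambda>t (p::'a \<times> 'a) p'. Suc t < T \<longrightarrow> E (fst p) (fst p') \<and> E (snd p) (snd p') \<and> \<not> (E (fst p) (snd p') \<and> E (snd p) (fst p'))"
  have "\<exists>f. \<forall>t. ?P t (f t) \<and> ?Q t (f t) (f (Suc t))"
  proof (rule dependent_nat_choice)
    show "\<exists>p. ?P 0 p" using ab[of 0 0] T2 by (intro exI[of _ "(a 0, b 0)"]) auto
  next
    fix p t assume p: "?P t p"
    show "\<exists>p'. ?P (Suc t) p' \<and> ?Q t p p'"
    proof (cases "Suc t < T")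
      case True
      have pt: "{fst p, snd p} = {a t, b t}" "fst p \<noteq> snd p" using p True by auto
      have "\<not> rank1 E {fst p, snd p} {a (Suc t), b (Suc t)}" using rank2[OF True] pt(1) by simp
      then consider
        "E (fst p) (a (Suc t)) \<and> E (snd p) (b (Suc t)) \<and> \<not> (E (fst p) (b (Suc t)) \<and> E (snd p) (a (Suc t)))"
        | "E (fst p) (b (Suc t)) \<and> E (snd p) (a (Suc t)) \<and> \<not> (E (fst p) (a (Suc t)) \<and> E (snd p) (b (Suc t)))"
        using rank2_matching[of E "fst p" "snd p" "a (Suc t)" "b (Suc t)"] ab[OF True True] pt(2) by auto
      then show ?thesis
      proof cases
        case 1
        then show ?thesis using ab[OF True True] by (intro exI[of _ "(a (Suc t), b (Suc t))"]) auto
      next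
        case 2
        then show ?thesis using ab[OF True True] by (intro exI[of _ "(b (Suc t), a (Suc t))"]) auto
      qed
    next
      case False
      then show ?thesis by auto
    qed
  qed
  then obtain f where f: "\<And>t. ?P t (f t)" "\<And>t. ?Q t (f t) (f (Suc t))" by blast
  show ?thesis
  proof (rule that[of "fst \<circ> f" "snd \<circ> f"])
    show "{(fst \<circ> f) t, (snd \<circ> f) t} = {a t, b t}" "(fst \<circ> f) t \<noteq> (snd \<circ> f) t" if "t < T" for t
      using f(1)[of t] that by auto
    show "(fst \<circ> f) 0 = a 0" "(snd \<circ> f) 0 = b 0" using f(1)[of 0] by auto
    show "E ((fst \<circ> f) t) ((fst \<circ> f) (Suc t)) \<and> E ((snd \<circ> f) t) ((snd \<circ> f) (Suc t)) \<and>
      \<not> (E ((fst \<circ> f) t) ((snd \<circ> f) (Suc t)) \<and> E ((snd \<circ> f) t) ((fst \<circ> f) (Suc t)))" if "Suc t < T" for t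
      using f(2)[of t] that by simp
  qed
qed

end

text \<open>A crossing edge is a rung drawn when only one of the two frontier vertices has moved:
  \<open>x y'\<close> after moving the second one first, \<open>y x'\<close> after moving the first
  one first. A rung inside the new pair comes last.\<close>

lemma ladder_edge_layer:
  assumes d: "distinct [x, y, x', y']" and ij: "\<not> (i \<and> j)"
  shows "ladder_edge ((if i then [Lb, Lc, La] else if j then [La, Lc, Lb] else [La, Lb]) @ (if k then [Lc] else [])) x y [x'] [y'] u v \<longleftrightarrow>
    edge_pair x x' u v \<or> edge_pair y y' u v \<or> i \<and> edge_pair x y' u v \<or> j \<and> edge_pair y x' u v \<or> k \<and> edge_pair x' y' u v"
proof -
  define A where "A = edge_pair x x' u v"
  define B where "B = edge_pair y y' u v"
  define C where "C = edge_pair x y' u v"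
  define D where "D = edge_pair y x' u v"
  define F where "F = edge_pair x' y' u v"
  have D': "D = edge_pair x' y u v" unfolding D_def edge_pair_def by blast
  note fl = A_def B_def C_def D_def D' F_def
  have "\<not> (A \<and> B)" "\<not> (A \<and> C)" "\<not> (A \<and> D)" "\<not> (A \<and> F)" "\<not> (B \<and> C)" "\<not> (B \<and> D)" "\<not> (B \<and> F)"
    "\<not> (C \<and> F)" "\<not> (D \<and> F)"
    using d unfolding A_def B_def C_def D_def F_def edge_pair_def by (simp_all, metis+)
  then show ?thesis using ij
    by (cases i; cases j; cases k) (simp_all flip: fl, argo+)
qed

context layered
begin

text \<open>The graph is read layer by layer as one word. Every layer contributes one
  \<open>La\<close> and one \<open>Lb\<close> and starts with one of them, so no two
  \<open>Lc\<close> become adjacent.\<close>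

lemma layered_cycle:
  assumes n: "n \<ge> 4" and big: "2 * (T - 1) \<ge> ((n - 1) * (n - 1) + 2 * n + 3) * n"
  shows "cycle_minor n V E"
proof -
  obtain x y where xy: "\<And>t. t < T \<Longrightarrow> {x t, y t} = {a t, b t}" and xny: "\<And>t. t < T \<Longrightarrow> x t \<noteq> y t"
    and x0: "x 0 = a 0" and y0: "y 0 = b 0"
    and M: "\<And>t. Suc t < T \<Longrightarrow> E (x t) (x (Suc t)) \<and> E (y t) (y (Suc t)) \<and> \<not> (E (x t) (y (Suc t)) \<and> E (y t) (x (Suc t)))"
    by (rule labels) (rule that)
  define S where "S t = L \<union> a ` {..t} \<union> b ` {..t}" for t
  let ?nc = "\<lambda>k l. \<not> (k = Lc \<and> l = Lc)"
  \<comment> \<open>The first edge \<open>a 0\<close>-\<open>y1\<close> of this path is the initial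
    rung; letters \<open>Lb\<close> along the rest of it carry the second frontier vertex to
    \<open>b 0\<close>.\<close>
  obtain zs where zs: "distinct (a 0 # zs @ [b 0])" "set (a 0 # zs @ [b 0]) \<subseteq> L \<union> {a 0, b 0}"
    "\<And>u v. u \<in> set (a 0 # zs @ [b 0]) \<Longrightarrow> v \<in> set (a 0 # zs @ [b 0]) \<Longrightarrow> E u v = path_edge (a 0 # zs @ [b 0]) u v"
    by (rule induced_path[OF sg left]) (use ab[of 0 0] T2 in simp, rule that)
  obtain y1 ys0 where y1: "zs @ [b 0] = y1 # ys0" by (cases "zs @ [b 0]") auto
  \<comment> \<open>The last clause of \<open>P\<close> tells, when the layers are exhausted,
    whether the word already ends with a rung.\<close>
  define P where "P t w xs ys \<longleftrightarrow> ladder_on E (Lc # w) (a 0) y1 xs ys \<and> last (a 0 # xs) = x t \<and> last (y1 # ys) = y t \<and>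
    set (a 0 # y1 # xs @ ys) \<subseteq> S t \<and> successively ?nc (Lc # w) \<and> count_list w La + count_list w Lb \<ge> 2 * t \<and>
    (last (Lc # w) = Lc \<longleftrightarrow> E (x t) (y t))" for t w xs ys
  have inv: "\<exists>w xs ys. P t w xs ys" if "t < T" for t
    using that
  proof (induction t)
    case 0
    let ?w = "replicate (length ys0) Lb"
    have d: "distinct (a 0 # y1 # ys0)" using zs(1) y1 by simp
    have e: "ladder_edge (Lc # ?w) (a 0) y1 [] ys0 u v = path_edge (a 0 # y1 # ys0) u v" for u v
    proof -
      have "\<not> (edge_pair (a 0) y1 u v \<and> path_edge (y1 # ys0) u v)"
        using d path_edge_in[of "y1 # ys0" u v] by (auto simp: edge_pair_def)
      then show ?thesis using ladder_edge_path_b[of y1 ys0 "length ys0" "a 0" u v] d by (auto simp: path_edge_Cons)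
    qed
    have "ladder_on E (Lc # ?w) (a 0) y1 [] ys0"
      unfolding ladder_on_def fits_def e using d zs(3) y1 by auto
    moreover have l: "last (y1 # ys0) = b 0" using y1 by (metis last_snoc)
    moreover have "successively ?nc (Lc # ?w)" by (simp add: successively_conv_nth nth_Cons split: nat.splits)
    moreover have "last (Lc # ?w) = Lc \<longleftrightarrow> E (a 0) (b 0)"
    proof (cases ys0)
      case Nil
      then have "zs = []" "y1 = b 0" using y1 by (cases zs; auto)+
      then show ?thesis using Nil zs(3)[of "a 0" "b 0"] by (simp add: path_edge_Cons edge_pair_def)
    next
      case (Cons z ys1)
      have len: "length (a 0 # zs @ [b 0]) = Suc (Suc (Suc (length ys1)))" using y1 Cons by simp
      have "\<not> path_edge (a 0 # zs @ [b 0]) ((a 0 # zs @ [b 0]) ! 0) ((a 0 # zs @ [b 0]) ! (Suc (Suc (length ys1))))"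
        using path_edge_nth[OF zs(1), of 0 "Suc (Suc (length ys1))"] len by simp
      moreover have "(a 0 # zs @ [b 0]) ! (Suc (Suc (length ys1))) = b 0" using len by (simp add: nth_append)
      ultimately show ?thesis using zs(3)[of "a 0" "b 0"] Cons by simp
    qed
    moreover have "set (a 0 # y1 # ys0) \<subseteq> S 0"
      using zs(2) unfolding y1 S_def by auto
    ultimately have "P 0 ?w [] ys0" unfolding P_def using x0 y0 by simp
    then show ?case by blast
  next
    case (Suc t)
    then obtain w xs ys where "P t w xs ys" by auto
    then have p: "ladder_on E (Lc # w) (a 0) y1 xs ys" "x t = last (a 0 # xs)" "y t = last (y1 # ys)"
      "set (a 0 # y1 # xs @ ys) \<subseteq> S t" "successively ?nc (Lc # w)" "count_list w La + count_list w Lb \<ge> 2 * t"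
      unfolding P_def by simp_all
    define x' where "x' = x (Suc t)"
    define y' where "y' = y (Suc t)"
    have m: "E (x t) x'" "E (y t) y'" "\<not> (E (x t) y' \<and> E (y t) x')" using M[OF Suc.prems] unfolding x'_def y'_def by auto
    have xs': "{x', y'} = {a (Suc t), b (Suc t)}" unfolding x'_def y'_def by (rule xy[OF Suc.prems])
    have x'ab: "x' \<in> {a (Suc t), b (Suc t)}" "y' \<in> {a (Suc t), b (Suc t)}" "x' \<noteq> y'"
      using xny[OF Suc.prems] unfolding xs'[symmetric] x'_def y'_def by simp_all
    have fresh: "z \<notin> S t" if "z \<in> {a (Suc t), b (Suc t)}" for z
    proof -
      have s: "a (Suc t) \<noteq> a s" "a (Suc t) \<noteq> b s" "b (Suc t) \<noteq> a s" "b (Suc t) \<noteq> b s" if "s \<le> t" for s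
        using inj(1)[of "Suc t" s] inj(2)[of "Suc t" s] ab[of "Suc t" s] ab[of s "Suc t"] Suc.prems that by auto
      then have "a (Suc t) \<notin> a ` {..t}" "a (Suc t) \<notin> b ` {..t}" "b (Suc t) \<notin> a ` {..t}" "b (Suc t) \<notin> b ` {..t}"
        by blast+
      then have "a (Suc t) \<notin> S t" "b (Suc t) \<notin> S t" unfolding S_def using aLR[OF Suc.prems] by simp_all
      then show ?thesis using that by blast
    qed
    have xyt: "x t \<noteq> y t" "{x t, y t} = {a t, b t}" using xy[of t] xny[of t] Suc.prems by simp_all
    have "{a t, b t} \<subseteq> S t" unfolding S_def by simp
    then have xyS: "x t \<in> S t" "y t \<in> S t" unfolding xyt(2)[symmetric] by simp_all
    have dd: "x t \<noteq> y t" "x t \<noteq> x'" "x t \<noteq> y'" "y t \<noteq> x'" "y t \<noteq> y'" "x' \<noteq> y'"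
      using xyt(1) xyS fresh[OF x'ab(1)] fresh[OF x'ab(2)] x'ab(3) by metis+
    define s0 where "s0 = (if E (x t) y' then [Lb, Lc, La] else if E (y t) x' then [La, Lc, Lb] else [La, Lb])"
    define s where "s = s0 @ (if E x' y' then [Lc] else [])"
    have irr: "\<not> E z z" for z using sg unfolding simple_rel_def by blast
    have ladder_edge: "ladder_edge s (x t) (y t) [x'] [y'] u v \<longleftrightarrow> edge_pair (x t) x' u v \<or> edge_pair (y t) y' u v \<or> E (x t) y' \<and> edge_pair (x t) y' u v \<or>
       E (y t) x' \<and> edge_pair (y t) x' u v \<or> E x' y' \<and> edge_pair x' y' u v" for u v
      unfolding s_def s0_def by (rule ladder_edge_layer[OF _ m(3)]) (use dd in simp)
    have st: "ladder_on E ((Lc # w) @ s) (a 0) y1 (xs @ [x']) (ys @ [y'])"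
    proof (rule ladder_on_extend[OF sg p(1-3)])
      show "length [x'] = count_list s La" "length [y'] = count_list s Lb" unfolding s_def s0_def by auto
      show "distinct ([x'] @ [y'])" using dd by simp
      show "set ([x'] @ [y']) \<inter> set (a 0 # y1 # xs @ ys) = {}" using fresh x'ab p(4) by auto
      fix u v
      show "\<not> E u v" if u: "u \<in> set (a 0 # y1 # xs @ ys)" "u \<noteq> x t" "u \<noteq> y t" and v: "v \<in> set ([x'] @ [y'])"
      proof -
        have "u \<in> S t" "u \<notin> {x t, y t}" using u p(4) by auto
        then have "u \<in> S t" "u \<noteq> a t" "u \<noteq> b t" unfolding xyt(2) by simp_all
        then have "u \<in> L \<or> (\<exists>s<t. u = a s \<or> u = b s)" unfolding S_def by (auto simp: le_less)
        moreover have "v = a (Suc t) \<or> v = b (Suc t)" using v x'ab by auto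
        ultimately show ?thesis using nonadj[of t u v] Suc.prems by auto
      qed
      show "\<not> ladder_edge s (x t) (y t) [x'] [y'] u v" if "u \<in> {x t, y t}" "v \<in> {x t, y t}"
        unfolding ladder_edge edge_pair_def using that dd by auto
      show "E u v = ladder_edge s (x t) (y t) [x'] [y'] u v" if "u \<in> set (x t # y t # [x'] @ [y'])" "v \<in> set ([x'] @ [y'])"
      proof -
        have u: "u = x t \<or> u = y t \<or> u = x' \<or> u = y'" and v: "v = x' \<or> v = y'" using that by auto
        have "E y' x' = E x' y'" by (rule simple_rel_sym[OF sg])
        then show ?thesis using u v unfolding ladder_edge edge_pair_def using dd dd[symmetric] m(1,2) irr
          by (elim disjE) simp_all
      qed
    qed
    have cs: "count_list s La + count_list s Lb = 2" unfolding s_def s0_def by auto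
    have hs: "s \<noteq> []" "hd s \<noteq> Lc" "successively ?nc s" unfolding s_def s0_def by auto
    have ls: "last ((Lc # w) @ s) = Lc \<longleftrightarrow> E x' y'" unfolding s_def s0_def by auto
    have sub: "S t \<subseteq> S (Suc t)" "x' \<in> S (Suc t)" "y' \<in> S (Suc t)" using x'ab unfolding S_def by auto
    have "successively ?nc ((Lc # w) @ s)" unfolding successively_append_iff using p(5) hs by simp
    then have "P (Suc t) (w @ s) (xs @ [x']) (ys @ [y'])" unfolding P_def
      using st p(4,6) cs ls sub x'_def y'_def by auto
    then show ?case by blast
  qed
  define t where "t = T - 1"
  have t: "t < T" using T2 unfolding t_def by simp
  obtain w xs ys where "P t w xs ys" using inv[OF t] by auto
  then have p: "ladder_on E (Lc # w) (a 0) y1 xs ys" "x t = last (a 0 # xs)" "y t = last (y1 # ys)"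
    "set (a 0 # y1 # xs @ ys) \<subseteq> S t" "successively ?nc (Lc # w)" "count_list w La + count_list w Lb \<ge> 2 * t"
    "last (Lc # w) = Lc \<longleftrightarrow> E (x t) (y t)"
    unfolding P_def by simp_all
  have big': "2 * t \<ge> ((n - 1) * (n - 1) + 2 * n + 3) * n" using big unfolding t_def .
  have SV: "S t \<subseteq> V" unfolding S_def VL using t by auto
  show ?thesis
  proof (cases "E (x t) (y t)")
    case True
    have "w \<noteq> []" using p(6) T2 unfolding t_def by auto
    then obtain w' where w': "w = w' @ [Lc]" using p(7) True by (metis append_butlast_last_id last_ConsR)
    have "ladder_minor V E (Lc # w)" by (rule ladder_on_vw[OF p(1)]) (use p(4) SV in auto)
    then show ?thesis using cycle_minor_nocc_word[OF n, of V E w'] p(5,6) w' big' by simp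
  next
    \<comment> \<open>The missing last rung is replaced by an induced path through \<open>R\<close>
      from \<open>y t\<close> to \<open>x t\<close>, read as letters \<open>Lb\<close> followed by
      one \<open>Lc\<close>.\<close>
    case False
    let ?W = "R \<union> {a t, b t}"
    let ?R = "\<lambda>u v. E u v \<and> u \<in> ?W \<and> v \<in> ?W"
    have r: "?R\<^sup>*\<^sup>* (a t) (b t)" using right unfolding t_def .
    have "symp ?R" using simple_rel_sym[OF sg] by (intro sympI) blast
    then have r': "?R\<^sup>*\<^sup>* (b t) (a t)" using r by (meson sympD symp_rtranclp)
    have xt: "x t = a t \<and> y t = b t \<or> x t = b t \<and> y t = a t" using xy[OF t] xny[OF t] by (simp add: doubleton_eq_iff)
    then have "?R\<^sup>*\<^sup>* (y t) (x t)" using r r' by auto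
    from induced_path[OF sg this] obtain rs where rs: "distinct (y t # rs @ [x t])" "set (y t # rs @ [x t]) \<subseteq> ?W"
      "\<And>u v. u \<in> set (y t # rs @ [x t]) \<Longrightarrow> v \<in> set (y t # rs @ [x t]) \<Longrightarrow> E u v = path_edge (y t # rs @ [x t]) u v"
      using xny[OF t] by metis
    have rs0: "rs \<noteq> []" using rs(3)[of "y t" "x t"] False simple_rel_sym[OF sg, of "x t" "y t"] by (auto simp: path_edge_Cons edge_pair_def)
    have rsR: "set rs \<subseteq> R" using rs(1,2) xt by auto
    let ?s = "replicate (length rs) Lb @ [Lc]"
    have ladder_edge: "ladder_edge ?s (x t) (y t) [] rs u v = path_edge (y t # rs @ [x t]) u v" for u v
    proof -
      have "ladder_edge ?s (x t) (y t) ([] @ []) (rs @ []) u v = (ladder_edge (replicate (length rs) Lb) (x t) (y t) [] rs u v \<noteq>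
         ladder_edge [Lc] (last [x t]) (last (y t # rs)) [] [] u v)" by (rule ladder_edge_append) auto
      moreover have "\<not> (path_edge (y t # rs) u v \<and> edge_pair (last (y t # rs)) (x t) u v)"
        using path_edge_in[of "y t # rs" u v] rs(1) unfolding edge_pair_def by auto
      moreover have "edge_pair (x t) (last (y t # rs)) u v = edge_pair (last (y t # rs)) (x t) u v" unfolding edge_pair_def by blast
      moreover have "last [x t] = x t" by simp
      ultimately show ?thesis
        using ladder_edge_path_b[of "y t" rs "length rs" "x t" u v] path_edge_snoc[of "y t # rs" "x t" u v] rs(1)
        by (simp del: last.simps) blast
    qed
    have RS: "R \<inter> S t = {}" unfolding S_def using LR aLR t by auto
    have fin: "ladder_on E ((Lc # w) @ ?s) (a 0) y1 (xs @ []) (ys @ rs)"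
    proof (rule ladder_on_extend[OF sg p(1-3)])
      show "length [] = count_list ?s La" "length rs = count_list ?s Lb" by auto
      show "distinct ([] @ rs)" using rs(1) by simp
      show "set ([] @ rs) \<inter> set (a 0 # y1 # xs @ ys) = {}" using rsR RS p(4) by auto
      fix u v
      show "\<not> E u v" if u: "u \<in> set (a 0 # y1 # xs @ ys)" "u \<noteq> x t" "u \<noteq> y t" and v: "v \<in> set ([] @ rs)"
      proof -
        have "u \<in> S t" "u \<noteq> a t" "u \<noteq> b t" using u p(4) xt by auto
        then have "u \<in> L \<or> (\<exists>s<t. u = a s \<or> u = b s)" unfolding S_def by (auto simp: le_less)
        moreover have "v \<in> R" using v rsR by auto
        ultimately show ?thesis using nonadj[of t u v] t by auto
      qed
      show "\<not> ladder_edge ?s (x t) (y t) [] rs u v" if "u \<in> {x t, y t}" "v \<in> {x t, y t}"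
      proof -
        have "\<not> E u v" using that False simple_rel_sym[OF sg, of "y t" "x t"] sg unfolding simple_rel_def by auto
        then show ?thesis using rs(3)[of u v] that unfolding ladder_edge by auto
      qed
      show "E u v = ladder_edge ?s (x t) (y t) [] rs u v" if "u \<in> set (x t # y t # [] @ rs)" "v \<in> set ([] @ rs)"
        using rs(3)[of u v] that unfolding ladder_edge by auto
    qed
    have "R \<subseteq> V" unfolding VL by blast
    then have "set (a 0 # y1 # (xs @ []) @ ys @ rs) \<subseteq> V" using p(4) SV rsR by auto
    from ladder_on_vw[OF fin this] have "ladder_minor V E (Lc # (w @ replicate (length rs) Lb) @ [Lc])" by simp
    moreover have "successively ?nc (Lc # (w @ replicate (length rs) Lb) @ [Lc])"
    proof -
      have 1: "successively ?nc ?s" using rs0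
        by (auto simp: successively_conv_nth nth_append)
      have "hd ?s = Lb" using rs0 by (cases rs) auto
      then have "successively ?nc ((Lc # w) @ ?s)"
        using successively_append_iff[of ?nc "Lc # w" ?s] p(5) 1 by (simp only: letter.distinct) blast
      then show ?thesis by simp
    qed
    ultimately show ?thesis using cycle_minor_nocc_word[OF n, of V E "w @ replicate (length rs) Lb"] p(6) big' by simp
  qed
qed

end

lemma cycle_minor_vmin:
  assumes v: "vminor V E V' E'" and c: "cycle_minor n V' E'"
  shows "cycle_minor n V E"
proof -
  obtain cs F where cs: "length cs = n" "distinct cs" "set cs \<subseteq> V'" "lceq V' E' F"
    "\<forall>a<n. \<forall>b<n. F (cs ! a) (cs ! b) \<longleftrightarrow> b = Suc a mod n \<or> a = Suc b mod n"
    using c unfolding cycle_minor_def by blast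
  have "vminor V' E' V' F" unfolding vminor_def using cs(4) by blast
  from cycle_minorI[OF vminor_trans[OF v this] cs(1-3,5)] show ?thesis .
qed

section \<open>Two-vertex separators at the jumps\<close>

context minchain
begin

text \<open>At \<open>l\<close> the value \<open>hi\<close> exceeds its previous maximum
  \<open>h\<close>. Later vertices lie far enough right because \<open>us\<close> has no forward
  shortcut; only for \<open>us ! Suc l\<close> this is one short, and there
  \<open>no_overlap\<close> excludes the bad value.\<close>

lemma jump_sep:
  assumes l: "0 < l" "l + 2 < m" and h: "\<And>i. i < l \<Longrightarrow> hi (us ! i) \<le> h" "k < l" "hi (us ! k) = h" "h < hi (us ! l)"
  shows "separates l (h - 1)"
  unfolding separates_def
proof (intro conjI allI impI)
  show "hi (us ! i) \<le> Suc (h - 1)" if "i < l" for i using h(1)[OF that] by simp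
next
  fix i assume i: "l < i" "i < m"
  show "h - 1 \<le> lo (us ! i)"
  proof (cases "i = Suc l")
    case False
    then show ?thesis using u_far(1)[of l i] i h(4) by simp
  next
    case True
    have "h \<le> lo (us ! Suc l) + 2" using u_far(1)[of k "Suc l"] h(2,3) l by simp
    moreover have "h \<noteq> lo (us ! Suc l) + 2"
    proof
      assume e: "h = lo (us ! Suc l) + 2"
      show False by (rule no_overlap[OF l, of "lo (us ! Suc l)" "hi (us ! l) - 2"]) (use h e in auto)
    qed
    ultimately show ?thesis using True by simp
  qed
qed

text \<open>Let \<open>us ! i\<close> be the last vertex before \<open>us ! l\<close> with a
  neighbour on \<open>q\<close>; it exists as \<open>x0\<close> has one. The arrows from
  \<open>us ! i\<close> to \<open>us ! l\<close> are edges, since the vertices between see nothing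
  of \<open>q\<close>. Together with the stretch of \<open>q\<close> jumped over, they form a long
  induced cycle.\<close>

lemma jump_small:
  assumes l: "0 < l" "l < m" and h: "\<And>i. i < l \<Longrightarrow> hi (us ! i) \<le> h" and big: "hi (us ! l) + 1 \<ge> h + n" and n: "n \<ge> 4"
  shows "cycle_minor n H E"
proof -
  define i where "i = Max {i. i < l \<and> hi (us ! i) > 0}"
  let ?S = "{i. i < l \<and> hi (us ! i) > 0}"
  have fS: "finite ?S" by simp
  have "0 \<in> ?S" using hi_lo[of 0 "us ! 0"] x0(2) u0 l(1) by auto
  then have "i \<in> ?S" unfolding i_def by (intro Max_in[OF fS]) auto
  then have i: "i < l" "hi (us ! i) > 0" by auto
  have mid: "hi (us ! k) = 0" "lo (us ! k) = Suc K" if "i < k" "k < l" for k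
  proof -
    show "hi (us ! k) = 0"
    proof (rule ccontr)
      assume "hi (us ! k) \<noteq> 0"
      then have "k \<le> i" unfolding i_def using that by (intro Max_ge[OF fS]) auto
      then show False using that by simp
    qed
    then show "lo (us ! k) = Suc K" using hi0 by blast
  qed
  define x where "x = hi (us ! i) - 1"
  define y where "y = lo (us ! l)"
  have ul: "us ! l \<in> H - set q" using u_in[OF l(2)] .
  have hih: "hi (us ! i) \<le> h" using h[OF i(1)] .
  \<comment> \<open>The neighbours of \<open>us ! l\<close> lie within three consecutive vertices of
    \<open>q\<close>, so even the first of them is far beyond \<open>h\<close>.\<close>
  have yl: "h + n \<le> y + 4" using hi_win[OF ul] big unfolding y_def by simp
  have yK: "y \<le> K" using hi0[of "us ! l"] lo_le[of "us ! l"] big n unfolding y_def by linarith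
  have xy: "x < y" "hi (us ! i) = Suc x" "y + 4 \<ge> Suc x + n" using i(2) yl n hih unfolding x_def by auto
  have Ei: "E (us ! i) (q ! x)" using hi_adj[OF xy(2)] by blast
  have El: "E (us ! l) (q ! y)" using lo_adj[of "us ! l"] yK unfolding y_def by blast
  have cons: "E (us ! k) (us ! Suc k)" if "i \<le> k" "k < l" for k
  proof -
    have "hi (us ! k) < lo (us ! Suc k) + 2"
    proof (cases "Suc k < l")
      case True
      then have "lo (us ! Suc k) = Suc K" using mid(2)[of "Suc k"] that by simp
      then show ?thesis using hi_le[of "us ! k"] by simp
    next
      case False
      then have "Suc k = l" using that by simp
      then show ?thesis using h[of k] that yl n unfolding y_def by simp
    qed
    then show ?thesis using uarr[of k] that l(2) unfolding arr_def by (auto split: if_splits)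
  qed
  have far: "\<not> E (us ! k) (us ! k')" if "i \<le> k" "k + 2 \<le> k'" "k' \<le> l" for k k'
  proof -
    have "hi (us ! k) < lo (us ! k') + 2"
    proof (cases "k' < l")
      case True
      then have "lo (us ! k') = Suc K" using mid(2)[of k'] that by simp
      then show ?thesis using hi_le[of "us ! k"] by simp
    next
      case False
      then have "k' = l" using that by simp
      then show ?thesis using h[of k] that yl n unfolding y_def by simp
    qed
    then show ?thesis using u_far(2)[of k k'] that l(2) by simp
  qed
  have uu: "E (us ! k) (us ! k') \<longleftrightarrow> k' = Suc k \<or> k = Suc k'" if "i \<le> k" "k \<le> l" "i \<le> k'" "k' \<le> l" for k k'
  proof -
    have *: "E (us ! k) (us ! k') \<longleftrightarrow> k' = Suc k" if "i \<le> k" "k < k'" "k' \<le> l" for k k'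
      using cons[of k] far[of k k'] that by (cases "k' = Suc k") auto
    consider "k < k'" | "k' < k" | "k = k'" by linarith
    then show ?thesis
    proof cases
      case 1 then show ?thesis using *[of k k'] that by auto
    next
      case 2 then show ?thesis using *[of k' k] that simple_rel_sym[OF sg, of "us ! k" "us ! k'"] by auto
    next
      case 3 then show ?thesis using sg unfolding simple_rel_def by auto
    qed
  qed
  have qu: "E (q ! j) (us ! k) \<longleftrightarrow> j = x \<and> k = i \<or> j = y \<and> k = l" if "x \<le> j" "j \<le> y" "i \<le> k" "k \<le> l" for j k
  proof -
    have s: "E (q ! j) (us ! k) = E (us ! k) (q ! j)" by (rule simple_rel_sym[OF sg])
    consider "k = i" | "k = l" | "i < k" "k < l" using \<open>i \<le> k\<close> \<open>k \<le> l\<close> by linarith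
    then show ?thesis
    proof cases
      case 1 then show ?thesis using s Ei hi_lo[of j "us ! i"] that xy yK i(1) by auto
    next
      case 2 then show ?thesis using s El hi_lo[of j "us ! l"] that xy yK i(1) unfolding y_def by auto
    next
      case 3 then show ?thesis using s hi_lo[of j "us ! k"] mid(1)[OF 3] that yK by auto
    qed
  qed
  let ?ps = "map ((!) q) [x..<Suc y]" and ?rs = "map ((!) us) [i..<Suc l]"
  have psn: "?ps ! j = q ! (x + j)" if "j < Suc y - x" for j using that by (simp del: upt_Suc)
  have rsn: "?rs ! j = us ! (i + j)" if "j < Suc l - i" for j using that by (simp del: upt_Suc)
  have len: "length ?ps = Suc y - x" "length ?rs = Suc l - i" by (simp_all del: upt_Suc)
  show ?thesis
  proof (rule cyc_two_paths[OF sg, of ?ps ?rs])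
    show "distinct ?ps" using q_inj yK by (auto simp: distinct_map inj_on_def simp del: upt_Suc)
    show "distinct ?rs" using u_inj l(2) by (auto simp: distinct_map inj_on_def simp del: upt_Suc)
    show "set ?ps \<inter> set ?rs = {}" using q_not_u yK l(2) by (fastforce simp del: upt_Suc)
    show "set ?ps \<union> set ?rs \<subseteq> H"
    proof -
      have "q ! j \<in> H" if "j \<le> y" for j using that yK qH qlen nth_mem[of j q] by auto
      moreover have "us ! j \<in> H" if "j \<le> l" for j using u_in[of j] that l(2) by simp
      ultimately show ?thesis by (auto simp del: upt_Suc)
    qed
    show "2 \<le> length ?ps" "?rs \<noteq> []" using xy i(1) unfolding len by auto
    show "n \<le> length ?ps + length ?rs" using xy i(1) unfolding len by linarith
    fix c d
    show "E (?ps ! c) (?ps ! d) \<longleftrightarrow> d = Suc c \<or> c = Suc d" if "c < length ?ps" "d < length ?ps"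
      using that qE[of "x + c" "x + d"] yK unfolding len by (auto simp: psn simp del: upt_Suc)
    show "E (?rs ! c) (?rs ! d) \<longleftrightarrow> d = Suc c \<or> c = Suc d" if "c < length ?rs" "d < length ?rs"
      using that uu[of "i + c" "i + d"] unfolding len by (auto simp: rsn simp del: upt_Suc)
    show "E (?ps ! c) (?rs ! d) \<longleftrightarrow> c = 0 \<and> d = 0 \<or> Suc c = length ?ps \<and> Suc d = length ?rs"
      if "c < length ?ps" "d < length ?rs"
    proof -
      have cd: "x + c \<le> y" "i + d \<le> l" using that unfolding len by auto
      have "E (?ps ! c) (?rs ! d) = E (q ! (x + c)) (us ! (i + d))" using psn[of c] rsn[of d] that unfolding len by simp
      also have "\<dots> \<longleftrightarrow> x + c = x \<and> i + d = i \<or> x + c = y \<and> i + d = l" using qu[of "x + c" "i + d"] cd by simp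
      also have "\<dots> \<longleftrightarrow> c = 0 \<and> d = 0 \<or> Suc c = length ?ps \<and> Suc d = length ?rs"
        unfolding len using cd xy(1) i(1) by auto
      finally show ?thesis .
    qed
  qed (use n in simp)
qed

text \<open>The first index at which \<open>hi\<close> reaches the threshold is a new maximum. Jumps
  are at most \<open>n - 2\<close> by \<open>jump_small\<close>, so the values before and after the
  jump both lie within \<open>n\<close> of the threshold.\<close>

lemma threshold_sep:
  assumes n: "n \<ge> 4" and nc: "\<not> cycle_minor n H E" and tau: "\<tau> \<ge> 4" "\<tau> + 2 * n \<le> K + 5"
    and l_def: "l = (LEAST l. l < m \<and> \<tau> \<le> hi (us ! l))"
  obtains x where "separates l x" "0 < l" "l < m" "\<tau> + 1 \<le> x + n" "x + 2 \<le> \<tau>" "hi (us ! l) + 3 \<le> \<tau> + n" "\<tau> \<le> hi (us ! l)"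
proof -
  have jump: "hi (us ! k) + 2 \<le> h + n" if "0 < k" "k < m" "\<And>i. i < k \<Longrightarrow> hi (us ! i) \<le> h" for k h
    using jump_small[OF that _ n] nc by linarith
  have hy: "hi (us ! (m - 1)) = Suc K"
    using hi_lo[of K y0] y0(2) hi_le[of y0] um by simp
  have ex: "m - 1 < m \<and> \<tau> \<le> hi (us ! (m - 1))" using hy tau n m2 by simp
  have lm: "l < m" "\<tau> \<le> hi (us ! l)" using LeastI[of "\<lambda>l. l < m \<and> \<tau> \<le> hi (us ! l)", OF ex] unfolding l_def by auto
  have below: "hi (us ! i) < \<tau>" if "i < l" for i
    using not_less_Least[of i "\<lambda>l. l < m \<and> \<tau> \<le> hi (us ! l)"] that lm unfolding l_def[symmetric] by auto
  have "lo (us ! 0) = 0" using hi_lo[of 0 "us ! 0"] x0(2) u0 by auto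
  then have "hi (us ! 0) \<le> 3" using hi_win[OF u_in[of 0]] m2 by simp
  then have l0: "0 < l" using lm(2) tau(1) by (cases l) auto
  define h where "h = Max ((\<lambda>i. hi (us ! i)) ` {..<l})"
  have hge: "hi (us ! i) \<le> h" if "i < l" for i unfolding h_def using that by (intro Max_ge) auto
  have "h \<in> (\<lambda>i. hi (us ! i)) ` {..<l}" unfolding h_def using l0 by (intro Max_in) auto
  then obtain k where k: "k < l" "hi (us ! k) = h" by auto
  have ht: "h < \<tau>" using below[OF k(1)] k(2) by simp
  have hl: "hi (us ! l) + 2 \<le> h + n" using jump[OF l0 lm(1) hge] .
  \<comment> \<open>\<open>jump_sep\<close> needs two more indices after \<open>l\<close>. If they
    were missing, two jumps of at most \<open>n - 2\<close> would lead from below the threshold to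
    \<open>hi y0 = Suc K\<close>, against the bound on \<open>K\<close>.\<close>
  have l1: "l \<noteq> m - 1" using hl hy ht tau(2) n by auto
  have l2: "l \<noteq> m - 2"
  proof
    assume e: "l = m - 2"
    have le: "hi (us ! i) \<le> hi (us ! l)" if "i < m - 1" for i
    proof (cases "i < l")
      case True then show ?thesis using below[OF True] lm by simp
    next
      case False
      then have "i = l" using that e by simp
      then show ?thesis by simp
    qed
    have "hi (us ! (m - 1)) + 2 \<le> hi (us ! l) + n" by (rule jump[OF _ _ le]) (use l0 e in auto)
    then have "Suc K + 2 \<le> hi (us ! l) + n" using hy by simp
    then show False using hl ht tau(2) n by simp
  qed
  have lm2: "l + 2 < m" using l1 l2 lm(1) by linarith
  have sep: "separates l (h - 1)" by (rule jump_sep[OF l0 lm2 hge k]) (use ht lm in simp_all)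
  have h1: "h \<ge> 1" using hge[of 0] hi_lo[of 0 "us ! 0"] x0(2) u0 l0 by auto
  show ?thesis by (rule that[OF sep l0 lm(1)]) (use ht hl lm h1 in auto)
qed

end

section \<open>The two sides of a separator, and elimination between separators\<close>

context minchain
begin

definition lside where "lside l x = (!) q ` {..<x} \<union> (!) us ` {..<l}"
definition rside where "rside l x = (!) q ` {x<..K} \<union> (!) us ` {l<..<m}"

lemma lsideE:
  assumes "z \<in> lside l x"
  obtains i where "i < x" "z = q ! i" | i where "i < l" "z = us ! i"
  using assms unfolding lside_def by blast

lemma rsideE:
  assumes "z \<in> rside l x"
  obtains i where "x < i" "i \<le> K" "z = q ! i" | i where "l < i" "i < m" "z = us ! i"
  using assms unfolding rside_def by force

text \<open>Between vertices of \<open>us\<close> on different sides an edge would need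
  \<open>hi = lo + 2\<close> by \<open>u_far\<close>, but here \<open>hi\<close> is at most
  \<open>x + 1\<close> and \<open>lo\<close> at least \<open>x\<close>.\<close>

lemma separates_anti:
  assumes s: "separates l x" and x: "x \<le> K"
  shows "nonadjacent E (lside l x) (rside l x)"
  unfolding nonadjacent_def
proof (intro ballI)
  fix u v assume u: "u \<in> lside l x" and v: "v \<in> rside l x"
  have s1: "hi (us ! i) \<le> Suc x" if "i < l" for i using s that unfolding separates_def by blast
  have s2: "x \<le> lo (us ! i)" if "l < i" "i < m" for i using s that unfolding separates_def by blast
  from u show "\<not> E u v"
  proof (cases rule: lsideE)
    case (1 i)
    note i = this
    from v show ?thesis
    proof (cases rule: rsideE)
      case (1 k)
      then show ?thesis using i qE[of i k] by auto
    next
      case (2 k)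
      then show ?thesis using i s2[of k] hi_lo[of i "us ! k"] x simple_rel_sym[OF sg, of u v] by auto
    qed
  next
    case (2 i)
    note i = this
    from v show ?thesis
    proof (cases rule: rsideE)
      case (1 k)
      then show ?thesis using i s1[of i] hi_lo[of k "us ! i"] by auto
    next
      case (2 k)
      then show ?thesis using i s1[of i] s2[of k] u_far(2)[of i k] by auto
    qed
  qed
qed

lemma side_cover:
  assumes "z \<in> H" "l < m" "x \<le> K"
  shows "z \<in> lside l x \<or> z \<in> rside l x \<or> z = q ! x \<or> z = us ! l"
proof -
  from assms(1) H_eq in_q in_us consider (q) i where "i \<le> K" "z = q ! i" | (u) i where "i < m" "z = us ! i" by blast
  then show ?thesis
  proof cases
    case q
    then have "i < x \<or> i = x \<or> x < i" by auto
    then show ?thesis using q unfolding lside_def rside_def by auto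
  next
    case u
    then have "i < l \<or> i = l \<or> l < i" by auto
    then show ?thesis using u unfolding lside_def rside_def by auto
  qed
qed

lemma not_side:
  assumes "l < m" "x \<le> K"
  shows "q ! x \<notin> lside l x" "us ! l \<notin> lside l x" "q ! x \<notin> rside l x" "us ! l \<notin> rside l x"
proof -
  have u: "us ! k \<noteq> q ! i" if "i \<le> K" "k < m" for i k using q_not_u[OF that] by simp
  show "q ! x \<notin> lside l x" "us ! l \<notin> lside l x" using assms by (auto simp: lside_def q_inj u_inj q_not_u u)
  show "q ! x \<notin> rside l x" "us ! l \<notin> rside l x" using assms by (auto simp: rside_def q_inj u_inj q_not_u u)
qed

lemma side_disjoint:
  assumes "l \<le> l'" "x \<le> x'" "l' < m" "x' \<le> K"
  shows "lside l x \<inter> rside l' x' = {}"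
proof -
  have False if z: "z \<in> lside l x" "z \<in> rside l' x'" for z
  proof -
    from z(1) show False
    proof (cases rule: lsideE)
      case (1 i)
      from z(2) show False
      proof (cases rule: rsideE)
        case (1 k) then show False using \<open>i < x\<close> \<open>z = q ! i\<close> q_inj[of i k] assms by simp
      next
        case (2 k) then show False using \<open>i < x\<close> \<open>z = q ! i\<close> q_not_u[of i k] assms by simp
      qed
    next
      case (2 i)
      from z(2) show False
      proof (cases rule: rsideE)
        case (1 k) then show False using \<open>i < l\<close> \<open>z = us ! i\<close> q_not_u[of k i] assms by simp
      next
        case (2 k) then show False using \<open>i < l\<close> \<open>z = us ! i\<close> u_inj[of i k] assms by simp
      qed
    qed
  qed
  then show ?thesis by blast
qed

lemma arr_edge: "Suc i < m \<Longrightarrow> hi (us ! i) < lo (us ! Suc i) + 2 \<Longrightarrow> E (us ! i) (us ! Suc i)"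
  using uarr[of i] unfolding arr_def by (auto split: if_splits)

text \<open>Every vertex of \<open>us\<close> up to \<open>l\<close> is connected to the initial
  part of \<open>q\<close>: it has a neighbour before \<open>q ! x\<close>, or else the arrow
  leading to it is an edge, because \<open>hi \<le> Suc x\<close> and \<open>lo \<ge> x\<close>
  exclude the other ways to be an arrow.\<close>

lemma left_connected:
  assumes s: "separates l x" and l: "l < m" "x \<le> K" "1 \<le> x"
    and E': "\<And>u v. u \<in> lside l x \<Longrightarrow> E u v \<Longrightarrow> E' u v \<and> E' v u"
  defines "W \<equiv> lside l x \<union> {q ! x, us ! l}"
  shows "(\<lambda>u v. E' u v \<and> u \<in> W \<and> v \<in> W)\<^sup>*\<^sup>* (q ! x) (us ! l)"
proof -
  define R where "R = (\<lambda>u v. E' u v \<and> u \<in> W \<and> v \<in> W)"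
  have RI: "R u v" "R v u" if "u \<in> lside l x" "v \<in> W" "E u v" for u v
    using E'[OF that(1,3)] that(1,2) unfolding R_def W_def by auto
  have qL: "q ! i \<in> lside l x" if "i < x" for i using that unfolding lside_def by blast
  have uL: "us ! i \<in> lside l x" if "i < l" for i using that unfolding lside_def by blast
  have qW: "q ! i \<in> W" if "i \<le> x" for i using that qL[of i] unfolding W_def by (cases "i = x") auto
  have uW: "us ! i \<in> W" if "i \<le> l" for i using that uL[of i] unfolding W_def by (cases "i = l") auto
  have up: "R\<^sup>*\<^sup>* (q ! 0) (q ! i)" if "i \<le> x" for i
    using that
  proof (induction i)
    case (Suc i)
    have "R (q ! i) (q ! Suc i)" by (rule RI(1)) (use Suc.prems qL qW qE[of i "Suc i"] l in auto)
    then show ?case using Suc by (meson Suc_leD rtranclp.rtrancl_into_rtrancl)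
  qed simp
  have down: "R\<^sup>*\<^sup>* (q ! i) (q ! 0)" if "i \<le> x" for i
    using that
  proof (induction i)
    case (Suc i)
    have "R (q ! Suc i) (q ! i)" by (rule RI(2)) (use Suc.prems qL qW qE[of i "Suc i"] l in auto)
    then show ?case using Suc by (meson Suc_leD converse_rtranclp_into_rtranclp)
  qed simp
  have "R\<^sup>*\<^sup>* (q ! 0) (us ! i)" if "i \<le> l" for i
    using that
  proof (induction i)
    case 0
    have "R (q ! 0) (us ! 0)" by (rule RI(1)) (use qL uW l x0(2) u0 simple_rel_sym[OF sg, of x0] in auto)
    then show ?case by blast
  next
    case (Suc i)
    show ?case
    proof (cases "lo (us ! Suc i) < x")
      case True
      have "E (q ! lo (us ! Suc i)) (us ! Suc i)"
        using lo_adj[of "us ! Suc i"] True l simple_rel_sym[OF sg, of "us ! Suc i"] by auto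
      then have "R (q ! lo (us ! Suc i)) (us ! Suc i)" by (intro RI(1)) (use True qL uW Suc.prems in auto)
      then show ?thesis using up[of "lo (us ! Suc i)"] True by (meson less_imp_le rtranclp.rtrancl_into_rtrancl)
    next
      case False
      have "hi (us ! i) \<le> Suc x" using s Suc.prems unfolding separates_def by simp
      then have "E (us ! i) (us ! Suc i)" using arr_edge[of i] False Suc.prems l by simp
      then have "R (us ! i) (us ! Suc i)" by (intro RI(1)) (use uL uW Suc.prems in auto)
      then show ?thesis using Suc by (meson Suc_leD rtranclp.rtrancl_into_rtrancl)
    qed
  qed
  from rtranclp_trans[OF down[of x] this[of l]] show ?thesis unfolding R_def by simp
qed

text \<open>The mirror image, by induction backwards from \<open>y0\<close>.\<close>

lemma right_connected:
  assumes s: "separates l x" and l: "l < m" "x < K"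
    and E': "\<And>u v. u \<in> rside l x \<Longrightarrow> E u v \<Longrightarrow> E' u v \<and> E' v u"
  defines "W \<equiv> rside l x \<union> {q ! x, us ! l}"
  shows "(\<lambda>u v. E' u v \<and> u \<in> W \<and> v \<in> W)\<^sup>*\<^sup>* (q ! x) (us ! l)"
proof -
  define R where "R = (\<lambda>u v. E' u v \<and> u \<in> W \<and> v \<in> W)"
  have RI: "R u v" "R v u" if "u \<in> rside l x" "v \<in> W" "E u v" for u v
    using E'[OF that(1,3)] that(1,2) unfolding R_def W_def by auto
  have qL: "q ! i \<in> rside l x" if "x < i" "i \<le> K" for i using that unfolding rside_def by auto
  have uL: "us ! i \<in> rside l x" if "l < i" "i < m" for i using that unfolding rside_def by auto
  have qW: "q ! i \<in> W" if "x \<le> i" "i \<le> K" for i using that qL[of i] unfolding W_def by (cases "i = x") auto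
  have uW: "us ! i \<in> W" if "l \<le> i" "i < m" for i using that uL[of i] unfolding W_def by (cases "i = l") auto
  have up: "R\<^sup>*\<^sup>* (q ! x) (q ! (x + i))" if "x + i \<le> K" for i
    using that
  proof (induction i)
    case (Suc i)
    have "R (q ! (x + i)) (q ! (x + Suc i))"
      by (rule RI(2)) (use Suc.prems qL[of "x + Suc i"] qW[of "x + i"] qE[of "x + i" "x + Suc i"] qE[of "x + Suc i" "x + i"] in auto)
    moreover have "R\<^sup>*\<^sup>* (q ! x) (q ! (x + i))" using Suc by simp
    ultimately show ?case by (meson rtranclp.rtrancl_into_rtrancl)
  qed simp
  have up': "R\<^sup>*\<^sup>* (q ! x) (q ! j)" if "x \<le> j" "j \<le> K" for j using up[of "j - x"] that by simp
  have "R\<^sup>*\<^sup>* (q ! x) (us ! (m - 1 - i))" if "i \<le> m - 1 - l" for i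
    using that
  proof (induction i)
    case 0
    have "R (q ! K) (us ! (m - 1))"
      by (rule RI(1)) (use qL[of K] uW[of "m - 1"] l y0(2) um simple_rel_sym[OF sg, of y0] in auto)
    then show ?case using up'[of K] l by (simp add: rtranclp.rtrancl_into_rtrancl)
  next
    case (Suc i)
    define k where "k = m - 1 - Suc i"
    have k: "m - 1 - i = Suc k" "l \<le> k" "Suc k < m" using Suc.prems l unfolding k_def by auto
    have ih: "R\<^sup>*\<^sup>* (q ! x) (us ! Suc k)" using Suc k(1) by simp
    have "R\<^sup>*\<^sup>* (q ! x) (us ! k)"
    proof (cases "Suc x < hi (us ! k)")
      case True
      then obtain j where j: "hi (us ! k) = Suc j" "x < j" by (cases "hi (us ! k)") auto
      have "E (q ! j) (us ! k)" "j \<le> K" using hi_adj[OF j(1)] simple_rel_sym[OF sg, of "us ! k"] by auto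
      then have "R (q ! j) (us ! k)" by (intro RI(1)) (use j qL uW k in auto)
      then show ?thesis using up'[of j] j(2) \<open>j \<le> K\<close> by (meson less_imp_le rtranclp.rtrancl_into_rtrancl)
    next
      case False
      have "x \<le> lo (us ! Suc k)" using s k unfolding separates_def by simp
      then have "E (us ! k) (us ! Suc k)" using arr_edge[of k] False k by simp
      then have "E (us ! Suc k) (us ! k)" using simple_rel_sym[OF sg] by blast
      then have "R (us ! Suc k) (us ! k)" by (intro RI(1)) (use uL uW k in auto)
      then show ?thesis using ih by (meson rtranclp.rtrancl_into_rtrancl)
    qed
    then show ?case unfolding k_def .
  qed
  from this[of "m - 1 - l"] show ?thesis using l unfolding R_def by simp
qed

text \<open>Eliminates everything except the separators and the parts before the first and after the
  last of them. For \<open>eliminate\<close>, \<open>Fam\<close> collects the two sides of all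
  separators and \<open>D\<close> consists of the two end parts, where the closing paths must
  survive.\<close>

lemma sequence_cycle:
  assumes n: "n \<ge> 4" and T: "2 * (T - 1) \<ge> ((n - 1) * (n - 1) + 2 * n + 3) * n" "T \<ge> 2"
    and s: "\<And>t. t < T \<Longrightarrow> separates (l t) (x t) \<and> 0 < l t \<and> l t + 1 < m \<and> 0 < x t \<and> x t < K"
    and mono: "\<And>s t. s < t \<Longrightarrow> t < T \<Longrightarrow> l s < l t \<and> x s < x t"
  shows "cycle_minor n H E"
proof -
  let ?a = "\<lambda>t. q ! x t" and ?b = "\<lambda>t. us ! l t"
  define L where "L = lside (l 0) (x 0)"
  define R where "R = rside (l (T - 1)) (x (T - 1))"
  define W where "W = L \<union> R \<union> ?a ` {..<T} \<union> ?b ` {..<T}"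
  define Fam where "Fam = (\<lambda>t. (lside (l t) (x t), rside (l t) (x t))) ` {..<T}"
  have T0: "0 < T" "T - 1 < T" using T by auto
  have st: "separates (l t) (x t)" "0 < l t" "l t < m" "0 < x t" "x t < K" "x t \<le> K" "l t + 1 < m" if "t < T" for t using s[OF that] by auto
  have mon: "l s \<le> l t" "x s \<le> x t" if "s \<le> t" "t < T" for s t
    using mono[of s t] that by (cases "s = t"; simp)+
  have cov: "z \<in> lside (l t) (x t) \<or> z \<in> rside (l t) (x t)" if "t < T" "z \<in> H" "z \<notin> W" for t z
    using side_cover[OF that(2) st(3,6)[OF that(1)]] that unfolding W_def by auto
  have an: "nonadjacent E (lside (l t) (x t)) (rside (l t) (x t))" if "t < T" for t
    using separates_anti st that by blast
  have qH': "q ! i \<in> H" if "i \<le> K" for i using that qH qlen nth_mem[of i q] by auto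
  have uH': "us ! i \<in> H" if "i < m" for i using u_in[OF that] by blast
  have LH: "L \<subseteq> H" unfolding L_def using qH' uH' st[OF T0(1)] by (force elim!: lsideE)
  have RH: "R \<subseteq> H" unfolding R_def using qH' uH' by (force elim!: rsideE)
  have XL: "{q ! 0, x0} \<subseteq> L" unfolding L_def lside_def using st[OF T0(1)] u0 by auto
  have YR: "{q ! K, y0} \<subseteq> R"
  proof -
    have "q ! K \<in> R" unfolding R_def rside_def using st[OF T0(2)] by auto
    moreover have "us ! (m - 1) \<in> R" unfolding R_def rside_def using st[OF T0(2)] by auto
    ultimately show ?thesis using um by simp
  qed
  have "\<exists>E'. vminor H E W E' \<and> simple_rel E' \<and> linked W E' {q ! 0, x0} {q ! K, y0} \<and> (\<forall>(A, B) \<in> Fam. nonadjacent E' A B) \<and>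
    (\<forall>z\<in>L \<union> R. \<forall>y. E' z y = E z y)"
  proof (rule eliminate[OF fin sg lk])
    show "{q ! 0, x0} \<subseteq> W" "{q ! K, y0} \<subseteq> W" using XL YR unfolding W_def by auto
    show "W \<subseteq> H" unfolding W_def using LH RH qH' uH' st by auto
    show "nonadjacent E A B \<and> H - W \<subseteq> A \<union> B" if "(A, B) \<in> Fam" for A B
      using that an cov unfolding Fam_def by auto
    \<comment> \<open>An eliminated vertex lies right of the first and left of the last
      separator.\<close>
    show "\<not> E v z" if "z \<in> L \<union> R" "v \<in> H - W" for z v
    proof -
      have v1: "v \<in> rside (l 0) (x 0)" using cov[OF T0(1), of v] that(2) unfolding W_def L_def by auto
      have v2: "v \<in> lside (l (T - 1)) (x (T - 1))" using cov[OF T0(2), of v] that(2) unfolding W_def R_def by auto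
      have "\<not> E z v \<or> \<not> E v z" using an[OF T0(1)] an[OF T0(2)] v1 v2 that(1) unfolding nonadjacent_def L_def R_def by blast
      then show ?thesis using simple_rel_sym[OF sg] by blast
    qed
  qed
  then obtain E' where E': "vminor H E W E'" "simple_rel E'" "linked W E' {q ! 0, x0} {q ! K, y0}" "\<And>A B. (A, B) \<in> Fam \<Longrightarrow> nonadjacent E' A B"
    "\<And>z y. z \<in> L \<union> R \<Longrightarrow> E' z y = E z y" by blast
  have ag: "E' u v \<and> E' v u" if "u \<in> L \<union> R" "E u v" for u v using E'(5)[OF that(1), of v] simple_rel_sym[OF E'(2), of v u] that(2) by blast
  have inj: "t = s" if "t < T" "s < T" "?a t = ?a s \<or> ?b t = ?b s" for s t
  proof -
    have "x t = x s \<or> l t = l s"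
      using that(3) q_inj[OF st(6)[OF that(1)] st(6)[OF that(2)]] u_inj[OF st(3)[OF that(1)] st(3)[OF that(2)]] by blast
    then show ?thesis using mono[of s t] mono[of t s] that(1,2) by (metis less_irrefl linorder_neqE_nat)
  qed
  interpret layered W E' L R "{q ! 0, x0}" "{q ! K, y0}" ?a ?b T
  proof
    show "simple_rel E'" "T \<ge> 2" "W = L \<union> R \<union> ?a ` {..<T} \<union> ?b ` {..<T}" "linked W E' {q ! 0, x0} {q ! K, y0}"
      "{q ! 0, x0} \<subseteq> L" "{q ! K, y0} \<subseteq> R" using E'(2,3) T(2) XL YR W_def by auto
    show "L \<inter> R = {}" unfolding L_def R_def by (rule side_disjoint) (use mon[of 0 "T - 1"] st[OF T0(2)] T0 in auto)
    fix t assume t: "t < T"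
    have sub1: "lside (l s) (x s) \<subseteq> lside (l t) (x t)" if "s \<le> t" for s
      using mon[OF that t] unfolding lside_def by (intro Un_mono image_mono) auto
    have sub2: "rside (l s) (x s) \<subseteq> rside (l t) (x t)" if "t \<le> s" "s < T" for s
      using mon[OF that] unfolding rside_def by (intro Un_mono image_mono) auto
    have L1: "L \<subseteq> lside (l t) (x t)" unfolding L_def using sub1[of 0] by simp
    have R1: "R \<subseteq> rside (l t) (x t)" unfolding R_def using sub2[of "T - 1"] t by simp
    show "?a t \<notin> L \<union> R" "?b t \<notin> L \<union> R" using L1 R1 not_side[OF st(3,6)[OF t]] by auto
    show "?a s \<noteq> ?b t" if "s < T" for s by (rule q_not_u[OF st(6)[OF that] st(3)[OF t]])
    show "?a t = ?a s \<Longrightarrow> t = s" "?b t = ?b s \<Longrightarrow> t = s" if "s < T" for s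
      by (rule inj[OF t that], simp)+
    show "nonadjacent E' (L \<union> ?a ` {..<t} \<union> ?b ` {..<t}) (R \<union> ?a ` {t<..<T} \<union> ?b ` {t<..<T})"
    proof -
      have a: "nonadjacent E' (lside (l t) (x t)) (rside (l t) (x t))" by (rule E'(4)) (use t in \<open>auto simp: Fam_def\<close>)
      have "L \<union> ?a ` {..<t} \<union> ?b ` {..<t} \<subseteq> lside (l t) (x t)"
        using L1 mono[OF _ t] unfolding lside_def by auto
      moreover have "R \<union> ?a ` {t<..<T} \<union> ?b ` {t<..<T} \<subseteq> rside (l t) (x t)"
        using R1 mono[of t] st unfolding rside_def by auto
      ultimately show ?thesis using a unfolding nonadjacent_def by blast
    qed
  next
    show "(\<lambda>u v. E' u v \<and> u \<in> L \<union> {?a 0, ?b 0} \<and> v \<in> L \<union> {?a 0, ?b 0})\<^sup>*\<^sup>* (?a 0) (?b 0)"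
      unfolding L_def by (rule left_connected) (use st[OF T0(1)] ag in \<open>auto simp: L_def\<close>)
    show "(\<lambda>u v. E' u v \<and> u \<in> R \<union> {?a (T - 1), ?b (T - 1)} \<and> v \<in> R \<union> {?a (T - 1), ?b (T - 1)})\<^sup>*\<^sup>* (?a (T - 1)) (?b (T - 1))"
      unfolding R_def by (rule right_connected) (use st[OF T0(2)] ag in \<open>auto simp: R_def\<close>)
  qed
  show ?thesis by (rule cycle_minor_vmin[OF E'(1) layered_cycle[OF n T(1)]])
qed

text \<open>One separator per threshold \<open>n * Suc t\<close>. The estimates of
  \<open>threshold_sep\<close> confine both coordinates to less than \<open>n\<close> around the
  threshold, so both increase strictly; the bound on \<open>K\<close> leaves room for the last
  threshold.\<close>

lemma chain_cycle:
  assumes n: "n \<ge> 4" and T: "2 * (T - 1) \<ge> ((n - 1) * (n - 1) + 2 * n + 3) * n" "T \<ge> 2" and K: "n * T + 2 * n \<le> K + 5"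
  shows "cycle_minor n H E"
proof (rule ccontr)
  assume nc: "\<not> cycle_minor n H E"
  define l where "l t = (LEAST l. l < m \<and> n * Suc t \<le> hi (us ! l))" for t
  have tau: "4 \<le> n * Suc t" "n * Suc t + 2 * n \<le> K + 5" if "t < T" for t
  proof -
    show "4 \<le> n * Suc t" using n by simp
    have "n * Suc t \<le> n * T" using that by (intro mult_le_mono2) simp
    then show "n * Suc t + 2 * n \<le> K + 5" using K by simp
  qed
  have "\<exists>x. separates (l t) x \<and> 0 < l t \<and> l t < m \<and> n * Suc t + 1 \<le> x + n \<and> x + 2 \<le> n * Suc t \<and>
     hi (us ! l t) + 3 \<le> n * Suc t + n \<and> n * Suc t \<le> hi (us ! l t)" if "t < T" for t
    using threshold_sep[OF n nc tau[OF that] l_def] by blast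
  then obtain x where x: "\<And>t. t < T \<Longrightarrow> separates (l t) (x t) \<and> 0 < l t \<and> l t < m \<and> n * Suc t + 1 \<le> x t + n \<and> x t + 2 \<le> n * Suc t \<and>
     hi (us ! l t) + 3 \<le> n * Suc t + n \<and> n * Suc t \<le> hi (us ! l t)" by metis
  have step: "l s < l t \<and> x s < x t" if "s < t" "t < T" for s t
  proof -
    have "n * Suc (Suc s) \<le> n * Suc t" using that by (intro mult_le_mono2) simp
    then have nn: "n * Suc s + n \<le> n * Suc t" by simp
    have xs: "hi (us ! l s) + 3 \<le> n * Suc s + n" "x s + 2 \<le> n * Suc s" using x[of s] that by auto
    have xt: "n * Suc t + 1 \<le> x t + n" "n * Suc t \<le> hi (us ! l t)" "l t < m" using x[of t] that by auto
    have "l s \<le> l t" unfolding l_def[of s] by (rule Least_le) (use xt nn in auto)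
    moreover have "l s \<noteq> l t"
    proof
      assume "l s = l t"
      then have "hi (us ! l s) = hi (us ! l t)" by simp
      then show False using xs(1) xt(2) nn by linarith
    qed
    ultimately show ?thesis using xs(2) xt(1) nn by linarith
  qed
  have "cycle_minor n H E"
  proof (rule sequence_cycle[OF n T _ step])
    fix t assume t: "t < T"
    have xt: "separates (l t) (x t)" "0 < l t" "l t < m" "n * Suc t + 1 \<le> x t + n" "x t + 2 \<le> n * Suc t"
      "hi (us ! l t) + 3 \<le> n * Suc t + n" using x[OF t] by auto
    have "hi (us ! (m - 1)) = Suc K" using hi_lo[of K y0] y0(2) hi_le[of y0] um by simp
    then have "l t \<noteq> m - 1" using xt(6) tau(2)[OF t] n by auto
    moreover have "n \<le> n * Suc t" by simp
    ultimately show "separates (l t) (x t) \<and> 0 < l t \<and> l t + 1 < m \<and> 0 < x t \<and> x t < K"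
      using xt tau(2)[OF t] n by linarith
  qed
  then show False using nc by blast
qed

end

subsection \<open>Long induced paths\<close>

definition ipath :: "('a \<Rightarrow> 'a \<Rightarrow> bool) \<Rightarrow> 'a list \<Rightarrow> bool" where
  "ipath E p \<longleftrightarrow> distinct p \<and> (\<forall>i<length p. \<forall>j<length p. E (p ! i) (p ! j) \<longleftrightarrow> j = Suc i \<or> i = Suc j)"

text \<open>With \<open>v\<close> as the fixed second frontier vertex, walking along
  \<open>p\<close> from the first to the last neighbour of \<open>v\<close> spells runs in
  \<open>La\<close> separated by rungs at \<open>v\<close>. The \<open>3 * n + 2\<close> neighbours
  give a first run and \<open>3 * n\<close> others for \<open>cycle_minor_fan\<close>.\<close>

lemma fan_on_path:
  assumes n: "n \<ge> 4" and sg: "simple_rel E" and p: "ipath E p" "set p \<subseteq> V" and v: "v \<in> V" "v \<notin> set p"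
    and big: "card {i. i < length p \<and> E v (p ! i)} \<ge> 3 * n + 2"
  shows "cycle_minor n V E"
proof -
  define N where "N = {i. i < length p \<and> E v (p ! i)}"
  have fN: "finite N" unfolding N_def by simp
  have N0: "N \<noteq> {}" using big unfolding N_def[symmetric] by auto
  define s where "s = Min N"
  have sN: "s \<in> N" unfolding s_def using fN N0 by (rule Min_in)
  then have s: "s < length p" "E v (p ! s)" unfolding N_def by auto
  have pE: "E (p ! i) (p ! j) \<longleftrightarrow> j = Suc i \<or> i = Suc j" if "i < length p" "j < length p" for i j
    using p(1) that unfolding ipath_def by blast
  have pin: "p ! i = p ! j \<longleftrightarrow> i = j" if "i < length p" "j < length p" for i j
    using p(1) that unfolding ipath_def by (simp add: nth_eq_iff_index_eq)
  have pv: "p ! i \<noteq> v" if "i < length p" for i using v(2) nth_mem[OF that] by auto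
  let ?G = "map (\<lambda>g. (g, 0::nat))"
  let ?xs = "\<lambda>k. map ((!) p) [Suc s..<Suc (s + k)]"
  have set: "set (p ! s # v # ?xs k @ []) = insert v ((!) p ` {s..s + k})" for k
    by (auto simp: image_iff Bex_def simp del: upt_Suc)
      (metis Suc_leI le_eq_less_or_eq less_Suc_eq_le)
  \<comment> \<open>\<open>gs\<close> lists the completed runs and \<open>c\<close> counts the
    letters since the last neighbour of \<open>v\<close>.\<close>
  have inv: "\<exists>gs c. ladder_on E (enc (?G gs) @ replicate c La) (p ! s) v (?xs k) [] \<and> 0 \<notin> set gs \<and>
      length gs = card (N \<inter> {s<..s + k}) \<and> (E v (p ! (s + k)) \<longrightarrow> c = 0)" if "s + k < length p" for k
    using that
  proof (induction k)
    case 0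
    have "E (p ! s) v" using s(2) simple_rel_sym[OF sg] by blast
    moreover have "\<not> E z z" for z using sg unfolding simple_rel_def by blast
    ultimately have "ladder_on E (enc (?G []) @ replicate 0 La) (p ! s) v [] []"
      unfolding ladder_on_def fits_def using s(2) pv[OF s(1)] by (auto simp: edge_pair_def)
    then show ?case by (intro exI[of _ "[]"] exI[of _ 0]) auto
  next
    case (Suc k)
    then obtain gs c where gs: "ladder_on E (enc (?G gs) @ replicate c La) (p ! s) v (?xs k) []" "0 \<notin> set gs"
      "length gs = card (N \<inter> {s<..s + k})" by auto
    let ?x = "p ! (s + k)" and ?x' = "p ! Suc (s + k)"
    have sk: "Suc (s + k) < length p" using Suc.prems by simp
    have lx: "?x = last (p ! s # ?xs k)" by (cases k) auto
    define e where "e \<longleftrightarrow> E v ?x'"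
    define t where "t = La # (if e then [Lc] else [])"
    have xx: "?x \<noteq> ?x'" "?x \<noteq> v" "?x' \<noteq> v" using pin[of "s + k" "Suc (s + k)"] pv sk by auto
    have ladder_edge: "ladder_edge t ?x v [?x'] [] u w \<longleftrightarrow> edge_pair ?x ?x' u w \<or> e \<and> edge_pair ?x' v u w" for u w
    proof -
      have "\<not> (edge_pair ?x ?x' u w \<and> edge_pair ?x' v u w)" unfolding edge_pair_def using xx by metis
      then show ?thesis unfolding t_def by (cases e) auto
    qed
    have ext: "ladder_on E ((enc (?G gs) @ replicate c La) @ t) (p ! s) v (?xs k @ [?x']) ([] @ [])"
    proof (rule ladder_on_extend[OF sg gs(1) lx])
      show "v = last [v]" "length [?x'] = count_list t La" "length [] = count_list t Lb" "distinct ([?x'] @ [])"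
        unfolding t_def by auto
      have "?x' \<notin> insert v ((!) p ` {s..s + k})" using sk xx by (auto simp: pin)
      then show "set ([?x'] @ []) \<inter> set (p ! s # v # ?xs k @ []) = {}" unfolding set by simp
      fix u w
      show "\<not> E u w" if uw: "u \<in> set (p ! s # v # ?xs k @ [])" "u \<noteq> ?x" "u \<noteq> v" "w \<in> set ([?x'] @ [])"
      proof -
        obtain i where i: "s \<le> i" "i \<le> s + k" "u = p ! i" using uw(1,3) unfolding set by auto
        have "i \<noteq> s + k" using i uw(2) by blast
        then show ?thesis using i pE[of i "Suc (s + k)"] sk uw(4) by auto
      qed
      show "\<not> ladder_edge t ?x v [?x'] [] u w" if "u \<in> {?x, v}" "w \<in> {?x, v}"
        unfolding ladder_edge edge_pair_def using that xx by auto
      show "E u w = ladder_edge t ?x v [?x'] [] u w" if "u \<in> set (?x # v # [?x'] @ [])" "w \<in> set ([?x'] @ [])"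
      proof -
        have w: "w = ?x'" using that by simp
        have "E ?x ?x'" "\<not> E ?x' ?x'" using pE[of "s + k" "Suc (s + k)"] pE[of "Suc (s + k)" "Suc (s + k)"] sk by auto
        moreover have "u = ?x \<or> u = v \<or> u = ?x'" using that by simp
        ultimately show ?thesis unfolding ladder_edge edge_pair_def w using xx e_def by auto
      qed
    qed
    have xs: "?xs k @ [?x'] = ?xs (Suc k)" by simp
    have N': "N \<inter> {s<..s + Suc k} = (if e then insert (Suc (s + k)) (N \<inter> {s<..s + k}) else N \<inter> {s<..s + k})"
      using sk unfolding N_def e_def by (auto simp: le_Suc_eq)
    show ?case
    proof (cases e)
      case True
      have "enc (?G (gs @ [Suc c])) = (enc (?G gs) @ replicate c La) @ t"
        unfolding t_def using True enc_append[of "?G gs" "[]"] enc_append[of "?G gs" "[(Suc c, 0)]"]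
        by (simp add: run_def replicate_append_same)
      moreover have "length (gs @ [Suc c]) = card (N \<inter> {s<..s + Suc k})" unfolding N' using True gs(3) fN by simp
      ultimately show ?thesis using ext gs(2) xs by (intro exI[of _ "gs @ [Suc c]"] exI[of _ 0]) simp
    next
      case False
      have "(enc (?G gs) @ replicate c La) @ t = enc (?G gs) @ replicate (Suc c) La"
        unfolding t_def using False by (simp add: replicate_append_same)
      then show ?thesis using ext gs(2,3) xs N' False unfolding e_def
        by (intro exI[of _ gs] exI[of _ "Suc c"]) simp
    qed
  qed
  define k where "k = Max N - s"
  have MN: "Max N \<in> N" using fN N0 by (rule Max_in)
  have "s \<le> Max N" unfolding s_def using fN MN by (rule Min_le)
  then have k: "s + k = Max N" unfolding k_def by simp
  have kl: "s + k < length p" "E v (p ! (s + k))" using MN unfolding k N_def by auto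
  obtain gs where gs: "ladder_on E (enc (?G gs)) (p ! s) v (?xs k) []" "0 \<notin> set gs" "length gs = card (N \<inter> {s<..s + k})"
    using inv[OF kl(1)] kl(2) by auto
  have "N \<inter> {s<..s + k} = N - {s}"
  proof -
    have b: "s \<le> i \<and> i \<le> s + k" if "i \<in> N" for i
      unfolding k using fN that Max_ge[OF fN that] Min_le[OF fN that] by (simp add: s_def)
    have "i \<in> N \<inter> {s<..s + k} \<longleftrightarrow> i \<in> N - {s}" for i using b[of i] by auto
    then show ?thesis by blast
  qed
  then have len: "length gs \<ge> 3 * n + 1" using gs(3) big sN fN unfolding N_def[symmetric] by simp
  have "runs_minor V E (?G gs)" unfolding runs_minor_def
  proof (rule ladder_on_vw[OF gs(1)])
    show "set (p ! s # v # ?xs k @ []) \<subseteq> V" unfolding set using v(1) p(2) kl(1) by auto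
  qed
  moreover obtain g gs' where g: "gs = Suc g # gs'"
    using len gs(2) by (cases gs; cases "hd gs") auto
  ultimately have "runs_minor V E ((Suc g, 0) # ?G gs')" by simp
  then show ?thesis by (rule cycle_minor_fan[OF n, of _ _ _ _ n]) (use gs(2) g len in \<open>auto intro: gr0I\<close>)
qed

text \<open>No vertex strictly between \<open>p ! i\<close> and \<open>p ! j\<close> is in or
  adjacent to the connected set \<open>Q\<close>, so a shortest path through \<open>Q\<close>
  between these two closes the stretch of \<open>p\<close> to an induced cycle.\<close>

lemma gap_cycle:
  assumes n: "n \<ge> 4" and sg: "simple_rel E" and p: "ipath E p" "set p \<subseteq> V" and Q: "Q \<subseteq> V"
    and conn: "\<And>u w. u \<in> Q \<Longrightarrow> w \<in> Q \<Longrightarrow> (\<lambda>u w. E u w \<and> u \<in> Q \<and> w \<in> Q)\<^sup>*\<^sup>* u w"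
    and ij: "j < length p" "i + n \<le> j"
    and ends: "w1 \<in> Q" "p ! i = w1 \<or> E (p ! i) w1" "w2 \<in> Q" "p ! j = w2 \<or> E (p ! j) w2"
    and gap: "\<And>k w. i < k \<Longrightarrow> k < j \<Longrightarrow> w \<in> Q \<Longrightarrow> p ! k \<noteq> w \<and> \<not> E (p ! k) w"
  shows "cycle_minor n V E"
proof -
  have pE: "E (p ! i) (p ! j) \<longleftrightarrow> j = Suc i \<or> i = Suc j" if "i < length p" "j < length p" for i j
    using p(1) that unfolding ipath_def by blast
  have pin: "p ! i = p ! j \<longleftrightarrow> i = j" if "i < length p" "j < length p" for i j
    using p(1) that unfolding ipath_def by (simp add: nth_eq_iff_index_eq)
  let ?x = "p ! i" and ?y = "p ! j"
  \<comment> \<open>If an end of the gap were in \<open>Q\<close>, its neighbour inside the gap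
    would be adjacent to \<open>Q\<close>.\<close>
  have xQ: "?x \<notin> Q" using gap[of "Suc i" ?x] pE[of "Suc i" i] ij n by auto
  have yQ: "?y \<notin> Q" 
  proof
    assume "?y \<in> Q"
    moreover have "i < j - 1" "j - 1 < j" "E (p ! (j - 1)) ?y" using pE[of "j - 1" j] ij n by auto
    ultimately show False using gap by blast
  qed
  define W where "W = insert ?x (insert ?y Q)"
  define R where "R = (\<lambda>u w. E u w \<and> u \<in> W \<and> w \<in> W)"
  have "(\<lambda>u w. E u w \<and> u \<in> Q \<and> w \<in> Q) \<le> R" unfolding R_def W_def by auto
  from rtranclp_mono[OF this] have "R\<^sup>*\<^sup>* w1 w2" using conn[OF ends(1,3)] by auto
  moreover have "R ?x w1" "R w2 ?y" using ends xQ yQ simple_rel_sym[OF sg, of ?y w2] unfolding R_def W_def by auto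
  ultimately have "R\<^sup>*\<^sup>* ?x ?y" by (meson converse_rtranclp_into_rtranclp rtranclp.rtrancl_into_rtrancl)
  then have c: "(\<lambda>u w. E u w \<and> u \<in> W \<and> w \<in> W)\<^sup>*\<^sup>* ?x ?y" unfolding R_def .
  have xy: "?x \<noteq> ?y" using pin[of i j] ij n by auto
  obtain zs where zs: "distinct (?x # zs @ [?y])" "set (?x # zs @ [?y]) \<subseteq> W"
    "\<And>u v. u \<in> set (?x # zs @ [?y]) \<Longrightarrow> v \<in> set (?x # zs @ [?y]) \<Longrightarrow> E u v = path_edge (?x # zs @ [?y]) u v"
    by (rule induced_path[OF sg c xy]) (rule that)
  let ?r = "?x # zs @ [?y]"
  have zQ: "set zs \<subseteq> Q" using zs(1,2) unfolding W_def by auto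
  have z0: "zs \<noteq> []"
  proof
    assume "zs = []"
    then have "E ?x ?y" using zs(3)[of ?x ?y] by (simp add: path_edge_Cons edge_pair_def)
    then show False using pE[of i j] ij n by auto
  qed
  have rE: "E (?r ! a) (?r ! b) \<longleftrightarrow> b = Suc a \<or> a = Suc b" if "a < length ?r" "b < length ?r" for a b
    using zs(3)[OF nth_mem[OF that(1)] nth_mem[OF that(2)]] path_edge_nth[OF zs(1) that] by simp
  have rz: "?r ! Suc b = zs ! b" if "b < length zs" for b using that by (simp add: nth_append)
  have ry: "?r ! Suc (length zs) = ?y" by simp
  let ?ps = "map ((!) p) [i..<Suc j]"
  have psn: "?ps ! a = p ! (i + a)" if "a < Suc j - i" for a using that by (simp del: upt_Suc)
  have len: "length ?ps = Suc j - i" by (simp del: upt_Suc)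
  show ?thesis
  proof (rule cyc_two_paths[OF sg, of ?ps zs])
    show "distinct ?ps" using pin ij by (auto simp: distinct_map inj_on_def simp del: upt_Suc)
    show "distinct zs" using zs(1) by simp
    show "set ?ps \<inter> set zs = {}"
    proof -
      have "p ! k \<notin> Q" if "i \<le> k" "k \<le> j" for k
        using gap[of k] xQ yQ that by (cases "k = i"; cases "k = j") auto
      then show ?thesis using zQ by (auto simp del: upt_Suc)
    qed
    show "set ?ps \<union> set zs \<subseteq> V" using zQ Q p(2) ij nth_mem[of _ p] by (auto simp del: upt_Suc)
    show "2 \<le> length ?ps" "zs \<noteq> []" "n \<le> length ?ps + length zs" using z0 ij n unfolding len by auto
    fix a b
    show "E (?ps ! a) (?ps ! b) \<longleftrightarrow> b = Suc a \<or> a = Suc b" if "a < length ?ps" "b < length ?ps"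
      using that pE[of "i + a" "i + b"] ij unfolding len by (auto simp: psn simp del: upt_Suc)
    show "E (zs ! a) (zs ! b) \<longleftrightarrow> b = Suc a \<or> a = Suc b" if "a < length zs" "b < length zs"
      using rE[of "Suc a" "Suc b"] rz[OF that(1)] rz[OF that(2)] that by simp
    show "E (?ps ! a) (zs ! b) \<longleftrightarrow> a = 0 \<and> b = 0 \<or> Suc a = length ?ps \<and> Suc b = length zs"
      if "a < length ?ps" "b < length zs"
    proof -
      have ab: "a < Suc j - i" using that(1) unfolding len .
      consider "a = 0" | "i + a = j" | "0 < a" "i + a < j" using ab by linarith
      then show ?thesis
      proof cases
        case 1
        have "E ?x (zs ! b) \<longleftrightarrow> b = 0" using rE[of 0 "Suc b"] rz[OF that(2)] that(2) by simp
        then show ?thesis unfolding len psn[OF ab] using 1 ij n by auto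
      next
        case 2
        have "E ?y (zs ! b) \<longleftrightarrow> Suc b = length zs"
          using rE[of "Suc (length zs)" "Suc b"] rz[OF that(2)] that(2) ry by auto
        then show ?thesis unfolding len psn[OF ab] using 2 ij n by auto
      next
        case 3
        have "\<not> E (p ! (i + a)) (zs ! b)" using gap[of "i + a" "zs ! b"] 3 zQ nth_mem[OF that(2)] by auto
        then show ?thesis unfolding len psn[OF ab] using 3 by auto
      qed
    qed
  qed (use n in simp)
qed

text \<open>The intervals of length \<open>n\<close> that start at the elements of \<open>M\<close>
  cover \<open>{..L}\<close>.\<close>

lemma gap_count:
  assumes M: "M \<subseteq> {..L}" "0 \<in> M" "L \<in> M"
    and gap: "\<And>i j. i \<in> M \<Longrightarrow> j \<in> M \<Longrightarrow> i < j \<Longrightarrow> (\<And>k. i < k \<Longrightarrow> k < j \<Longrightarrow> k \<notin> M) \<Longrightarrow> j \<le> i + n"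
    and n: "n \<ge> 1"
  shows "L + 1 \<le> n * card M"
proof -
  have fM: "finite M" using M(1) finite_subset by blast
  have "{..L} \<subseteq> (\<Union>j\<in>M. {j..<j + n})"
  proof
    fix i assume "i \<in> {..L}"
    then have i: "i \<le> L" by simp
    define j where "j = Max {j \<in> M. j \<le> i}"
    have f1: "finite {j \<in> M. j \<le> i}" using fM by simp
    have "j \<in> {j \<in> M. j \<le> i}" unfolding j_def by (rule Max_in[OF f1]) (use M in auto)
    then have j: "j \<in> M" "j \<le> i" by auto
    have jm: "k \<le> j" if "k \<in> M" "k \<le> i" for k unfolding j_def by (rule Max_ge[OF f1]) (use that in simp)
    have "i < j + n"
    proof (rule ccontr)
      assume c: "\<not> i < j + n"
      then have "i < L" using jm[OF M(3)] i n by (cases "i = L") auto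
      define j' where "j' = Min {j \<in> M. i < j}"
      have f2: "finite {j \<in> M. i < j}" using fM by simp
      have "j' \<in> {j \<in> M. i < j}" unfolding j'_def by (rule Min_in[OF f2]) (use M \<open>i < L\<close> in auto)
      then have j': "j' \<in> M" "i < j'" by auto
      have "k \<notin> M" if "j < k" "k < j'" for k
      proof
        assume k: "k \<in> M"
        then have "i < k" using jm[of k] that by (cases "k \<le> i") auto
        then have "j' \<le> k" unfolding j'_def by (intro Min_le[OF f2]) (use k in simp)
        then show False using that by simp
      qed
      then have "j' \<le> j + n" using gap[OF j(1) j'(1)] j j' by auto
      then show False using c j' by simp
    qed
    then show "i \<in> (\<Union>j\<in>M. {j..<j + n})" using j by auto
  qed
  then have "card {..L} \<le> card (\<Union>j\<in>M. {j..<j + n})" by (intro card_mono) (use fM in auto)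
  also have "\<dots> \<le> (\<Sum>j\<in>M. card {j..<j + n})" by (rule card_UN_le[OF fM])
  also have "\<dots> = n * card M" by simp
  finally show ?thesis by simp
qed

text \<open>\<open>M\<close> is the set of positions on \<open>p\<close> that are in or adjacent to
  \<open>Q\<close>. A vertex of \<open>Q\<close> outside \<open>p\<close> accounts for fewer than
  \<open>3 * n + 2\<close> of them by \<open>fan_on_path\<close>, one on \<open>p\<close> for at
  most three, and by \<open>gap_cycle\<close> consecutive positions differ by at most
  \<open>n\<close>.\<close>

lemma connecting_path_long:
  assumes n: "n \<ge> 4" and sg: "simple_rel E" and p: "ipath E p" "set p \<subseteq> V" "length p = Suc L" and Q: "Q \<subseteq> V" "finite Q"
    and conn: "\<And>u w. u \<in> Q \<Longrightarrow> w \<in> Q \<Longrightarrow> (\<lambda>u w. E u w \<and> u \<in> Q \<and> w \<in> Q)\<^sup>*\<^sup>* u w"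
    and ends: "w1 \<in> Q" "p ! 0 = w1 \<or> E (p ! 0) w1" "w2 \<in> Q" "p ! L = w2 \<or> E (p ! L) w2"
    and nc: "\<not> cycle_minor n V E"
  shows "L + 1 \<le> n * ((3 * n + 2) * card Q)"
proof -
  define N where "N w = {i. i \<le> L \<and> (p ! i = w \<or> E (p ! i) w)}" for w
  define M where "M = (\<Union>w\<in>Q. N w)"
  have fN: "finite (N w)" for w unfolding N_def by simp
  have LM: "L + 1 \<le> n * card M"
  proof (rule gap_count)
    show "M \<subseteq> {..L}" "0 \<in> M" "L \<in> M" using ends unfolding M_def N_def by auto
    fix i j assume ij: "i \<in> M" "j \<in> M" "i < j" and g: "\<And>k. i < k \<Longrightarrow> k < j \<Longrightarrow> k \<notin> M"
    obtain v1 where v1: "v1 \<in> Q" "p ! i = v1 \<or> E (p ! i) v1" using ij(1) unfolding M_def N_def by blast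
    obtain v2 where v2: "v2 \<in> Q" "p ! j = v2 \<or> E (p ! j) v2" "j \<le> L" using ij(2) unfolding M_def N_def by blast
    show "j \<le> i + n"
    proof (rule ccontr)
      assume c: "\<not> j \<le> i + n"
      have "cycle_minor n V E"
      proof (rule gap_cycle[OF n sg p(1,2) Q(1) conn _ _ v1 v2(1,2)])
        show "j < length p" "i + n \<le> j" using v2(3) p(3) c by auto
        show "p ! k \<noteq> w \<and> \<not> E (p ! k) w" if "i < k" "k < j" "w \<in> Q" for k w
          using g[OF that(1,2)] that v2(3) unfolding M_def N_def by auto
      qed
      then show False using nc by blast
    qed
  qed (use n in simp)
  have "card M \<le> (\<Sum>w\<in>Q. card (N w))" unfolding M_def by (rule card_UN_le[OF Q(2)])
  also have "\<dots> \<le> (\<Sum>w\<in>Q. 3 * n + 2)"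
  proof (rule sum_mono)
    fix w assume w: "w \<in> Q"
    show "card (N w) \<le> 3 * n + 2"
    proof (cases "w \<in> set p")
      case True
      then obtain k where k: "k \<le> L" "w = p ! k" using p(3) by (metis in_set_conv_nth less_Suc_eq_le)
      have "N w \<subseteq> {k - 1, k, k + 1}"
      proof
        fix i assume "i \<in> N w"
        then have i: "i \<le> L" "p ! i = p ! k \<or> E (p ! i) (p ! k)" unfolding N_def k(2) by auto
        then have "i = k \<or> k = Suc i \<or> i = Suc k" using p(1,3) k(1) unfolding ipath_def by (auto simp: nth_eq_iff_index_eq)
        then show "i \<in> {k - 1, k, k + 1}" by auto
      qed
      then have "card (N w) \<le> card {k - 1, k, k + 1}" by (intro card_mono) auto
      also have "\<dots> \<le> 3" by (rule order_trans[OF card_insert_le_m1]) (auto intro: order_trans[OF card_insert_le_m1])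
      finally show ?thesis using n by linarith
    next
      case False
      have "i \<in> N w \<longleftrightarrow> i < length p \<and> E w (p ! i)" for i
      proof -
        have "E (p ! i) w = E w (p ! i)" by (rule simple_rel_sym[OF sg])
        moreover have "p ! i \<noteq> w" if "i \<le> L" using False p(3) nth_mem[of i p] that by auto
        ultimately show ?thesis unfolding N_def using p(3) by auto
      qed
      then have "N w = {i. i < length p \<and> E w (p ! i)}" by blast
      moreover have "\<not> 3 * n + 2 \<le> card {i. i < length p \<and> E w (p ! i)}"
        using fan_on_path[OF n sg p(1,2) _ False] Q(1) w nc by blast
      ultimately show ?thesis by simp
    qed
  qed
  also have "\<dots> = (3 * n + 2) * card Q" by simp
  finally have "n * card M \<le> n * ((3 * n + 2) * card Q)" by (intro mult_le_mono2)
  then show ?thesis using LM by linarith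
qed

section \<open>From prime graphs to minimal linked sets\<close>

text \<open>Otherwise the vertices reachable from \<open>X\<close> would form a separation with no
  edges across.\<close>

lemma linked_dpath:
  assumes l: "linked H E X Y" and XY: "X \<subseteq> H" "Y \<subseteq> H"
  obtains vs where "dpath (\<lambda>u v. E u v \<and> u \<in> H \<and> v \<in> H) X Y vs"
proof -
  define R where "R = (\<lambda>u v. E u v \<and> u \<in> H \<and> v \<in> H)"
  define A where "A = {v \<in> H. \<exists>x\<in>X. R\<^sup>*\<^sup>* x v}"
  have "A \<inter> Y \<noteq> {}"
  proof
    assume e: "A \<inter> Y = {}"
    show False
    proof (rule linkedD[OF l _ _ e, of "\<lambda>_. False" "\<lambda>_. False"])
      show "X \<subseteq> A" "A \<subseteq> H" using XY unfolding A_def by auto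
      fix x y assume x: "x \<in> A" and y: "y \<in> H - A"
      have "\<not> E x y"
      proof
        assume "E x y"
        then have "R x y" using x y unfolding R_def A_def by simp
        then have "y \<in> A" using x y unfolding A_def by (auto intro: rtranclp.rtrancl_into_rtrancl)
        then show False using y by blast
      qed
      then show "E x y \<longleftrightarrow> False \<and> False" by simp
    qed
  qed
  then obtain x y where xy: "x \<in> X" "y \<in> Y" "R\<^sup>*\<^sup>* x y" unfolding A_def by blast
  from dpath_rtranclp[OF xy(3)] obtain vs where "dpath R {x} {y} vs" by blast
  then have "dpath R X Y vs" using xy unfolding dpath_def by auto
  then show ?thesis using that unfolding R_def by blast
qed

lemma dpath_connected:
  assumes sg: "simple_rel E" and s: "successively (\<lambda>u v. E u v \<and> u \<in> H \<and> v \<in> H) q" and uv: "u \<in> set q" "v \<in> set q"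
  shows "(\<lambda>u v. E u v \<and> u \<in> set q \<and> v \<in> set q)\<^sup>*\<^sup>* u v"
proof -
  define R where "R = (\<lambda>u v. E u v \<and> u \<in> set q \<and> v \<in> set q)"
  have E: "R (q ! i) (q ! Suc i)" "R (q ! Suc i) (q ! i)" if "Suc i < length q" for i
    using s that simple_rel_sym[OF sg, of "q ! Suc i" "q ! i"] unfolding successively_conv_nth R_def by auto
  have up: "R\<^sup>*\<^sup>* (q ! 0) (q ! i) \<and> R\<^sup>*\<^sup>* (q ! i) (q ! 0)" if "i < length q" for i
    using that
  proof (induction i)
    case (Suc i)
    then have "R\<^sup>*\<^sup>* (q ! 0) (q ! i)" "R\<^sup>*\<^sup>* (q ! i) (q ! 0)" by auto
    then show ?case using E[OF Suc.prems]
      by (meson converse_rtranclp_into_rtranclp rtranclp.rtrancl_into_rtrancl)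
  qed simp
  obtain i j where "i < length q" "u = q ! i" "j < length q" "v = q ! j" using uv by (metis in_set_conv_nth)
  then have "R\<^sup>*\<^sup>* u v" using up[of i] up[of j] by (meson rtranclp_trans)
  then show ?thesis unfolding R_def .
qed

lemma edge_partner:
  assumes z: "z \<in> {a, b}" and ab: "a \<noteq> b" "E a b" "E b a"
  obtains w where "{a, b} = {z, w}" "w \<noteq> z" "E w z"
proof (cases "z = a")
  case True then show ?thesis using that[of b] ab by auto
next
  case False then show ?thesis using that[of a] z ab by auto
qed

text \<open>Without a cycle minor, \<open>chain_cycle\<close> bounds the length of the shortest path
  \<open>q\<close> from above, while \<open>connecting_path_long\<close> bounds it from below in
  terms of \<open>L\<close>.\<close>

lemma prime_path_cycle:
  assumes n: "n \<ge> 4" and fin: "finite V" and sg: "simple_rel E"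
    and prime: "\<And>A. A \<subseteq> V \<Longrightarrow> card A \<ge> 2 \<Longrightarrow> card (V - A) \<ge> 2 \<Longrightarrow> \<not> rank1 E A (V - A)"
    and p: "ipath E p" "set p \<subseteq> V" "length p = Suc L"
    and T: "2 * (T - 1) \<ge> ((n - 1) * (n - 1) + 2 * n + 3) * n" "T \<ge> 2"
    and L: "L \<ge> n * ((3 * n + 2) * (n * T + 2 * n))"
  shows "cycle_minor n V E"
proof (rule ccontr)
  assume nc: "\<not> cycle_minor n V E"
  \<comment> \<open>Ensures that the first and the last edge of \<open>p\<close> are
    disjoint.\<close>
  have "4 * ((3 * 4 + 2) * (4 * 2 + 2 * 4)) \<le> n * ((3 * n + 2) * (n * T + 2 * n))"
    by (intro mult_le_mono add_le_mono) (use n T(2) in auto)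
  then have L4: "L \<ge> 4" using L by simp
  have pE: "E (p ! i) (p ! j) \<longleftrightarrow> j = Suc i \<or> i = Suc j" if "i \<le> L" "j \<le> L" for i j
    using p(1,3) that unfolding ipath_def by simp
  have pin: "p ! i = p ! j \<longleftrightarrow> i = j" if "i \<le> L" "j \<le> L" for i j
    using p(1,3) that unfolding ipath_def by (simp add: nth_eq_iff_index_eq)
  have pV: "p ! i \<in> V" if "i \<le> L" for i using p(2,3) that nth_mem[of i p] by auto
  define X where "X = {p ! 0, p ! 1}"
  define Y where "Y = {p ! (L - 1), p ! L}"
  have XY: "X \<inter> Y = {}" "X \<subseteq> V" "Y \<subseteq> V" "card X = 2" "card Y = 2"
    unfolding X_def Y_def using pV L4 by (auto simp: pin)
  \<comment> \<open>Both sides of a separation contain one of the two edges, so a rank-one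
    separation would be a split.\<close>
  have lV: "linked V E X Y"
    unfolding linked_def
  proof (intro notI, elim exE conjE)
    fix A assume A: "X \<subseteq> A" "A \<subseteq> V" "A \<inter> Y = {}" "rank1 E A (V - A)"
    have "card A \<ge> 2" using card_mono[OF finite_subset[OF A(2) fin] A(1)] XY(4) by simp
    moreover have "card (V - A) \<ge> 2" using card_mono[of "V - A" Y] fin A(3) XY(3,5) by auto
    ultimately show False using prime[OF A(2)] A(4) by blast
  qed
  define P where "P H \<longleftrightarrow> H \<subseteq> V \<and> X \<union> Y \<subseteq> H \<and> linked H E X Y" for H
  define H where "H = arg_min card P"
  have PV: "P V" unfolding P_def using lV XY by blast
  have PH: "P H" unfolding H_def by (rule arg_min_natI) (rule PV)
  have Hmin: "card H \<le> card H'" if "P H'" for H' unfolding H_def by (rule arg_min_nat_le) (rule that)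
  have H: "H \<subseteq> V" "X \<subseteq> H" "Y \<subseteq> H" "linked H E X Y" using PH unfolding P_def by auto
  have fH: "finite H" using H(1) fin finite_subset by blast
  define R where "R = (\<lambda>u v. E u v \<and> u \<in> H \<and> v \<in> H)"
  obtain vs where "dpath R X Y vs" using linked_dpath[OF H(4,2,3)] unfolding R_def by blast
  then obtain q where q: "dpath R X Y q" "\<And>vs. dpath R X Y vs \<Longrightarrow> length q \<le> length vs"
    "\<And>i j. i + 2 \<le> j \<Longrightarrow> j < length q \<Longrightarrow> \<not> R (q ! i) (q ! j)"
    "\<And>i. 0 < i \<Longrightarrow> i < length q \<Longrightarrow> q ! i \<notin> X" "\<And>i. Suc i < length q \<Longrightarrow> q ! i \<notin> Y" "distinct q"
    by (rule shortest_dpath) (rule that)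
  define K where "K = length q - 1"
  have qne: "q \<noteq> []" "q ! 0 \<in> X" "q ! K \<in> Y" "successively R q"
    using q(1) unfolding dpath_def K_def by (auto simp: hd_conv_nth last_conv_nth)
  have ql: "length q = Suc K" unfolding K_def using qne(1) by simp
  have K1: "K \<ge> 1" using qne(2,3) XY(1) by (cases K) auto
  have qn: "R (q ! i) (q ! Suc i)" if "i < K" for i using dpath_nth[OF q(1), of i] that ql by simp
  have qH: "q ! i \<in> H" if "i \<le> K" for i
    using qn[of i] qn[of "i - 1"] K1 that unfolding R_def by (cases "i < K") auto
  have qsub: "set q \<subseteq> H" using qH ql by (metis in_set_conv_nth less_Suc_eq_le subsetI)
  have qE: "E (q ! i) (q ! j) \<longleftrightarrow> i = Suc j \<or> j = Suc i" if "i \<le> K" "j \<le> K" for i j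
  proof -
    have *: "E (q ! i) (q ! j) \<longleftrightarrow> j = Suc i" if "i < j" "j \<le> K" for i j
      using qn[of i] q(3)[of i j] qH[of i] qH[of j] that ql unfolding R_def by (cases "j = Suc i") auto
    consider "i < j" | "j < i" | "i = j" by linarith
    then show ?thesis
    proof cases
      case 1 then show ?thesis using *[of i j] that by auto
    next
      case 2 then show ?thesis using *[of j i] that simple_rel_sym[OF sg, of "q ! i" "q ! j"] by auto
    next
      case 3 then show ?thesis using sg unfolding simple_rel_def by auto
    qed
  qed
  obtain x0 where x0: "X = {q ! 0, x0}" "x0 \<noteq> q ! 0" "E x0 (q ! 0)"
    by (rule edge_partner[OF qne(2)[unfolded X_def], of E, folded X_def])
      (use pE[of 0 1] pE[of 1 0] pin[of 0 1] L4 in auto)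
  obtain y0 where y0: "Y = {q ! K, y0}" "y0 \<noteq> q ! K" "E y0 (q ! K)"
    by (rule edge_partner[OF qne(3)[unfolded Y_def], of E, folded Y_def])
      (use pE[of "L - 1" L] pE[of L "L - 1"] pin[of "L - 1" L] L4 in auto)
  have x0q: "x0 \<in> H - set q"
  proof -
    have "x0 \<noteq> q ! i" if "i \<le> K" for i using q(4)[of i] x0(1,2) that ql by (cases "i = 0") auto
    then show ?thesis using H(2) x0(1) ql by (auto simp: in_set_conv_nth less_Suc_eq_le)
  qed
  have y0q: "y0 \<in> H - set q"
  proof -
    have "y0 \<noteq> q ! i" if "i \<le> K" for i using q(5)[of i] y0(1,2) that ql by (cases "i = K") auto
    then show ?thesis using H(3) y0(1) ql by (auto simp: in_set_conv_nth less_Suc_eq_le)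
  qed
  \<comment> \<open>The detour \<open>q ! i\<close>, \<open>u\<close>, \<open>q ! j\<close> would
    make \<open>q\<close> shorter.\<close>
  have win: "j \<le> i + 2" if "u \<in> H - set q" "i \<le> K" "j \<le> K" "E u (q ! i)" "E u (q ! j)" for u i j
  proof (rule ccontr)
    assume c: "\<not> j \<le> i + 2"
    have "last (take (Suc i) q) = q ! i" using that ql by (simp add: take_Suc_conv_app_nth)
    moreover have "hd (drop j q) = q ! j" using that ql by (simp add: hd_drop_conv_nth)
    moreover have "R (q ! i) u" "R u (q ! j)" using that qH simple_rel_sym[OF sg, of u "q ! i"] unfolding R_def by auto
    ultimately have "dpath R X Y (take (Suc i) q @ u # drop j q)"
      using q(1) that ql successively_take[OF qne(4), of "Suc i"] successively_drop[OF qne(4), of j]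
      by (auto simp: dpath_def successively_append_iff successively_Cons)
    from q(2)[OF this] show False using c that ql by simp
  qed
  have minimal: "\<not> linked H' E X Y" if "H' \<subset> H" "X \<union> Y \<subseteq> H'" for H'
  proof
    assume "linked H' E X Y"
    then have "P H'" unfolding P_def using that H(1) by blast
    then show False using Hmin[of H'] psubset_card_mono[OF fH that(1)] by simp
  qed
  interpret ml: minlinked H E q K x0 y0
  proof
    show "finite H" "simple_rel E" "length q = Suc K" "distinct q" "set q \<subseteq> H" "x0 \<in> H - set q" "E x0 (q ! 0)"
      "y0 \<in> H - set q" "E y0 (q ! K)" "1 \<le> K"
      by (fact fH sg ql q(6) qsub x0q x0(3) y0q y0(3) K1)+
    show "linked H E {q ! 0, x0} {q ! K, y0}" using H(4) unfolding x0(1) y0(1) .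
    show "x0 \<noteq> y0" using XY(1) x0(1) y0(1) by auto
    show "\<not> linked H' E {q ! 0, x0} {q ! K, y0}" if "H' \<subset> H" "{q ! 0, x0, q ! K, y0} \<subseteq> H'" for H'
      using minimal[OF that(1)] that(2) unfolding x0(1) y0(1) by auto
    show "E (q ! i) (q ! j) \<longleftrightarrow> i = Suc j \<or> j = Suc i" if "i \<le> K" "j \<le> K" for i j by (rule qE[OF that])
    show "j \<le> i + 2" if "u \<in> H - set q" "i \<le> K" "j \<le> K" "E u (q ! i)" "E u (q ! j)" for u i j by (rule win[OF that])
  qed
  obtain ws where "dpath ml.arr {x0} {y0} ws" using dpath_rtranclp[OF ml.arr_reach] by blast
  then obtain us where us: "dpath ml.arr {x0} {y0} us" "\<And>i j. i + 2 \<le> j \<Longrightarrow> j < length us \<Longrightarrow> \<not> ml.arr (us ! i) (us ! j)"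
    "distinct us" by (rule shortest_dpath) (rule that)
  have une: "us \<noteq> []" "us ! 0 = x0" "us ! (length us - 1) = y0"
    using us(1) unfolding dpath_def by (auto simp: hd_conv_nth last_conv_nth)
  have un: "ml.arr (us ! i) (us ! Suc i)" if "Suc i < length us" for i using dpath_nth[OF us(1) that] .
  interpret mc: minchain H E q K x0 y0 us "length us"
  proof
    show "length us = length us" "distinct us" "us ! 0 = x0" "us ! (length us - 1) = y0"
      by (fact refl us(3) une(2,3))+
    show "2 \<le> length us" using une ml.xy by (cases us; cases "tl us") auto
    have "us ! i \<in> H - set q" if "i < length us" for i
    proof (cases i)
      case 0 then show ?thesis using une(2) x0q by simp
    next
      case (Suc k) then show ?thesis using un[of k] that unfolding ml.arr_def by simp
    qed
    then show "set us \<subseteq> H - set q" by (metis in_set_conv_nth subsetI)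
    show "ml.arr (us ! i) (us ! Suc i)" if "Suc i < length us" for i by (rule un[OF that])
    show "\<not> ml.arr (us ! i) (us ! j)" if "i + 2 \<le> j" "j < length us" for i j by (rule us(2)[OF that])
  qed
  have "\<not> cycle_minor n H E" using cycle_minor_vmin[OF vminor_sub[OF H(1)]] nc by blast
  then have Kb: "K + 5 < n * T + 2 * n" using mc.chain_cycle[OF n T] by linarith
  have "L + 1 \<le> n * ((3 * n + 2) * card (set q))"
  proof (rule connecting_path_long[OF n sg p, of "set q" "q ! 0" "q ! K"])
    show "set q \<subseteq> V" "finite (set q)" using qsub H(1) by auto
    show "q ! 0 \<in> set q" "q ! K \<in> set q" using ql by auto
    show "p ! 0 = q ! 0 \<or> E (p ! 0) (q ! 0)" using qne(2) pE[of 0 1] L4 unfolding X_def by auto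
    show "p ! L = q ! K \<or> E (p ! L) (q ! K)" using qne(3) pE[of L "L - 1"] L4 unfolding Y_def by auto
    show "(\<lambda>u v. E u v \<and> u \<in> set q \<and> v \<in> set q)\<^sup>*\<^sup>* u v" if "u \<in> set q" "v \<in> set q" for u v
      by (rule dpath_connected[OF sg qne(4)[unfolded R_def] that])
  qed (rule nc)
  also have "card (set q) = Suc K" using ql q(6) by (simp add: distinct_card)
  also have "n * ((3 * n + 2) * Suc K) \<le> n * ((3 * n + 2) * (n * T + 2 * n))"
    by (intro mult_le_mono2) (use Kb in simp)
  finally show False using L by simp
qed

subsection \<open>Transfer to graphs as edge sets\<close>

lemma simple_adj_verts: "simple_graph G \<Longrightarrow> adj G x y \<Longrightarrow> x \<in> verts G \<and> y \<in> verts G"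
  unfolding simple_graph_def adj_def by blast

lemma simple_rel_adj: "simple_graph G \<Longrightarrow> simple_rel (adj G)"
  unfolding simple_rel_def simple_graph_def adj_def by (auto simp: insert_commute)

lemma verts_local_comp: "verts (local_comp G v) = verts G"
  unfolding local_comp_def Let_def verts_def by simp

lemma simple_local_comp:
  assumes "simple_graph G"
  shows "simple_graph (local_comp G v)"
  using assms unfolding simple_graph_def verts_local_comp
  by (auto simp: local_comp_def Let_def edges_def nbhd_def)

lemma adj_local_comp:
  assumes G: "simple_graph G"
  shows "adj (local_comp G v) = lcE (adj G) v"
proof (intro ext)
  fix x y
  define D where "D = {{x, y} | x y. x \<in> nbhd G v \<and> y \<in> nbhd G v \<and> x \<noteq> y}"
  have "{x, y} \<in> D \<longleftrightarrow> x \<in> nbhd G v \<and> y \<in> nbhd G v \<and> x \<noteq> y"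
    unfolding D_def by (auto simp: doubleton_eq_iff)
  also have "\<dots> \<longleftrightarrow> adj G v x \<and> adj G v y \<and> x \<noteq> y"
    unfolding nbhd_def using simple_adj_verts[OF G] by auto
  finally have "{x, y} \<in> D \<longleftrightarrow> adj G v x \<and> adj G v y \<and> x \<noteq> y" .
  moreover have "adj (local_comp G v) x y \<longleftrightarrow> adj G x y \<noteq> ({x, y} \<in> D)"
    unfolding adj_def local_comp_def Let_def edges_def D_def by auto
  ultimately show "adj (local_comp G v) x y = lcE (adj G) v x y" unfolding lcE_def by simp
qed

lemma lceq_lc_steps:
  assumes "lceq (verts G) (adj G) F" "simple_graph G"
  shows "\<exists>G'. lc_step\<^sup>*\<^sup>* G G' \<and> simple_graph G' \<and> verts G' = verts G \<and> adj G' = F"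
  using assms(1)
proof (induction rule: lceq.induct)
  case lceq_refl
  then show ?case using assms(2) by blast
next
  case (lceq_step F v)
  then obtain G' where G': "lc_step\<^sup>*\<^sup>* G G'" "simple_graph G'" "verts G' = verts G" "adj G' = F" by blast
  have "lc_step G' (local_comp G' v)" unfolding lc_step_def using lceq_step G'(3) by auto
  then show ?case using G' simple_local_comp[OF G'(2), of v] adj_local_comp[OF G'(2), of v] verts_local_comp[of G' v]
    by (intro exI[of _ "local_comp G' v"]) (auto intro: rtranclp.rtrancl_into_rtrancl)
qed

lemma adj_cycle_graph:
  assumes "i < n" "j < n"
  shows "adj (cycle_graph n) i j \<longleftrightarrow> j = Suc i mod n \<or> i = Suc j mod n"
  using assms unfolding adj_def cycle_graph_def edges_def by (auto simp: doubleton_eq_iff)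

lemma cycle_minor_vertex_minor:
  assumes c: "cycle_minor n (verts G) (adj G)" and G: "simple_graph G"
  shows "\<exists>H. vertex_minor H G \<and> graph_iso H (cycle_graph n)"
proof -
  obtain cs F where cs: "length cs = n" "distinct cs" "set cs \<subseteq> verts G" "lceq (verts G) (adj G) F"
    "\<And>i j. i < n \<Longrightarrow> j < n \<Longrightarrow> F (cs ! i) (cs ! j) \<longleftrightarrow> j = Suc i mod n \<or> i = Suc j mod n"
    using c unfolding cycle_minor_def by blast
  obtain G' where G': "lc_step\<^sup>*\<^sup>* G G'" "verts G' = verts G" "adj G' = F" using lceq_lc_steps[OF cs(4) G] by blast
  define H where "H = induced_subgraph_on G' (set cs)"
  have vm: "vertex_minor H G" unfolding vertex_minor_def H_def using G' cs(3) by blast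
  have bij: "bij_betw ((!) cs) {0..<n} (set cs)" using bij_betw_nth[OF cs(2), of "{0..<n}" "set cs"] cs(1) by (simp add: lessThan_atLeast0)
  let ?f = "inv_into {0..<n} ((!) cs)"
  have vH: "verts H = set cs" "verts (cycle_graph n) = {0..<n}" unfolding H_def induced_subgraph_on_def cycle_graph_def verts_def by auto
  have "adj H x y \<longleftrightarrow> adj (cycle_graph n) (?f x) (?f y)" if "x \<in> set cs" "y \<in> set cs" for x y
  proof -
    have f: "?f x < n" "?f y < n" "cs ! ?f x = x" "cs ! ?f y = y"
      using bij_betw_inv_into[OF bij] bij_betw_inv_into_right[OF bij] that by (auto simp: bij_betw_def)
    have "adj H x y \<longleftrightarrow> adj G' x y" using that unfolding H_def induced_subgraph_on_def adj_def edges_def by auto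
    also have "\<dots> \<longleftrightarrow> F (cs ! ?f x) (cs ! ?f y)" using f G'(3) by simp
    finally show ?thesis using cs(5)[OF f(1,2)] adj_cycle_graph[OF f(1,2)] by simp
  qed
  then have "graph_iso H (cycle_graph n)"
    unfolding graph_iso_def vH using bij_betw_inv_into[OF bij] by (intro exI[of _ ?f]) blast
  then show ?thesis using vm by blast
qed

text \<open>The supports of \<open>f\<close> and \<open>g\<close> serve as the sets
  \<open>A'\<close> and \<open>B'\<close> of a split.\<close>

lemma prime_not_rank1:
  assumes G: "simple_graph G" "prime_graph G" and A: "A \<subseteq> verts G" "card A \<ge> 2" "card (verts G - A) \<ge> 2"
  shows "\<not> rank1 (adj G) A (verts G - A)"
proof
  assume "rank1 (adj G) A (verts G - A)"
  then obtain f g where fg: "\<forall>x\<in>A. \<forall>y\<in>verts G - A. adj G x y \<longleftrightarrow> f x \<and> g y" unfolding rank1_def by blast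
  have "has_split G" unfolding has_split_def
  proof (rule exI[of _ A], rule exI[of _ "verts G - A"], intro conjI)
    show "A \<union> (verts G - A) = verts G" "A \<inter> (verts G - A) = {}" using A(1) by auto
    show "\<exists>A'\<subseteq>A. \<exists>B'\<subseteq>verts G - A. \<forall>a\<in>A. \<forall>b\<in>verts G - A. adj G a b \<longleftrightarrow> a \<in> A' \<and> b \<in> B'"
      by (rule exI[of _ "{a \<in> A. f a}"], rule conjI, blast, rule exI[of _ "{b \<in> verts G - A. g b}"], rule conjI, blast)
        (use fg in simp)
  qed (use A in auto)
  then show False using G(2) unfolding prime_graph_def by blast
qed

text \<open>Complementing at the middle vertex of three consecutive path vertices joins the other
  two.\<close>

lemma path_triangle:
  assumes p: "ipath E p" "set p \<subseteq> V" "length p \<ge> 3"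
  shows "cycle_minor 3 V E"
proof -
  have pE: "E (p ! i) (p ! j) \<longleftrightarrow> j = Suc i \<or> i = Suc j" if "i < 3" "j < 3" for i j
    using p(1,3) that unfolding ipath_def by simp
  have pin: "p ! i = p ! j \<longleftrightarrow> i = j" if "i < 3" "j < 3" for i j
    using p(1,3) that unfolding ipath_def by (simp add: nth_eq_iff_index_eq)
  have pV: "p ! i \<in> V" if "i < 3" for i using p(2,3) nth_mem[of i p] that by auto
  show ?thesis
  proof (rule cycle_minorI[OF vminor_lc[of "p ! 1" V V E]])
    show "p ! 1 \<in> V" "V \<subseteq> V" using pV by auto
    show "length (take 3 p) = 3" "distinct (take 3 p)" using p unfolding ipath_def by auto
    show "set (take 3 p) \<subseteq> V" using p(2) set_take_subset[of 3 p] by auto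
    show "\<forall>a<3. \<forall>b<3. lcE E (p ! 1) (take 3 p ! a) (take 3 p ! b) \<longleftrightarrow> b = Suc a mod 3 \<or> a = Suc b mod 3"
    proof (intro allI impI)
      fix a b :: nat assume ab: "a < 3" "b < 3"
      have a: "a = 0 \<or> a = 1 \<or> a = 2" and b: "b = 0 \<or> b = 1 \<or> b = 2" using ab by auto
      have "lcE E (p ! 1) (p ! a) (p ! b) \<longleftrightarrow> (b = Suc a \<or> a = Suc b) \<noteq>
          ((a = Suc 1 \<or> 1 = Suc a) \<and> (b = Suc 1 \<or> 1 = Suc b) \<and> a \<noteq> b)"
        unfolding lcE_def using pE[of a b] pE[of 1 a] pE[of 1 b] pin[of a b] ab by auto
      also have "\<dots> \<longleftrightarrow> b = Suc a mod 3 \<or> a = Suc b mod 3"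
        using a b by (elim disjE) simp_all
      finally show "lcE E (p ! 1) (take 3 p ! a) (take 3 p ! b) \<longleftrightarrow> b = Suc a mod 3 \<or> a = Suc b mod 3"
        using ab by simp
    qed
  qed
qed

theorem theorem6p1:
  fixes G :: "'a ugraph" and n :: nat
  assumes "n \<ge> 3"
    and "simple_graph G"
    and "prime_graph G"
    and "has_induced_path G (nat \<lceil>6.75 * (real n) ^ 7\<rceil>)"
  shows "\<exists>H. vertex_minor H G \<and> graph_iso H (cycle_graph n)"
proof -
  define L where "L = nat \<lceil>6.75 * (real n) ^ 7\<rceil>"
  have "6.75 * real n ^ 7 \<le> real L" unfolding L_def by (rule real_nat_ceiling_ge)
  moreover have "6 * real n ^ 7 \<le> 6.75 * real n ^ 7" by simp
  ultimately have "real (6 * n ^ 7) \<le> real L" by simp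
  then have L: "6 * n ^ 7 \<le> L" by (simp only: of_nat_le_iff)
  obtain p where p: "length p = L + 1" "distinct p" "set p \<subseteq> verts G"
    "\<forall>i<length p. \<forall>j<length p. adj G (p ! i) (p ! j) \<longleftrightarrow> (i = j + 1 \<or> j = i + 1)"
    using assms(4) unfolding has_induced_path_def L_def[symmetric] by blast
  have ip: "ipath (adj G) p" unfolding ipath_def using p(2,4) by auto
  have "cycle_minor n (verts G) (adj G)"
  proof (cases "n = 3")
    case True
    have "6 * 3 ^ 7 \<le> L" using L True by simp
    then show ?thesis using path_triangle[OF ip p(3)] p(1) True by simp
  next
    case False
    then have n: "n \<ge> 4" using assms(1) by simp
    have sq: "16 \<le> n * n" using mult_le_mono[OF n n] by simp
    have cu: "16 * n \<le> n ^ 3" using mult_le_mono1[OF sq, of n] by (simp add: power3_eq_cube)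
    \<comment> \<open>The choice of \<open>n ^ 3\<close> separators: the left side equals
      \<open>n ^ 3 + 4 * n\<close>, and \<open>16 * n \<le> n ^ 3\<close>.\<close>
    have T1: "((n - 1) * (n - 1) + 2 * n + 3) * n \<le> 2 * (n ^ 3 - 1)"
    proof -
      obtain k where k: "n = Suc k" using n by (cases n) auto
      have "(n - 1) * (n - 1) + 2 * n + 3 = n * n + 4" unfolding k by (simp add: algebra_simps)
      then have "((n - 1) * (n - 1) + 2 * n + 3) * n = n ^ 3 + 4 * n"
        by (simp add: algebra_simps power3_eq_cube)
      then show ?thesis using cu n by linarith
    qed
    \<comment> \<open>The factors are bounded by \<open>n\<close>, \<open>n * n\<close> and
      \<open>6 * n ^ 4\<close>, so the required length is at most \<open>6 * n ^ 7\<close>, which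
      lies below the given \<open>6.75 * n ^ 7\<close>.\<close>
    have "3 * n + 2 \<le> n * n"
    proof -
      have "4 * n \<le> n * n" using n by simp
      then show ?thesis using n by linarith
    qed
    moreover have "n * n ^ 3 + 2 * n \<le> 6 * n ^ 4"
    proof -
      have "n * n ^ 3 = n ^ 4" by (simp add: eval_nat_numeral)
      moreover have "4 * n ^ 3 \<le> n * n ^ 3" using n by (intro mult_le_mono1)
      ultimately show ?thesis using cu by linarith
    qed
    ultimately have "n * ((3 * n + 2) * (n * n ^ 3 + 2 * n)) \<le> n * ((n * n) * (6 * n ^ 4))"
      by (intro mult_le_mono order_refl)
    also have "\<dots> = 6 * n ^ 7" by algebra
    finally have LL: "n * ((3 * n + 2) * (n * n ^ 3 + 2 * n)) \<le> L" using L by linarith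
    show ?thesis
    proof (rule prime_path_cycle[OF n _ simple_rel_adj[OF assms(2)] _ ip p(3) _ T1 _ LL])
      show "finite (verts G)" using assms(2) unfolding simple_graph_def by blast
      show "length p = Suc L" using p(1) by simp
      show "2 \<le> n ^ 3" using cu n by linarith
      show "\<not> rank1 (adj G) A (verts G - A)" if "A \<subseteq> verts G" "2 \<le> card A" "2 \<le> card (verts G - A)" for A
        by (rule prime_not_rank1[OF assms(2,3) that])
    qed
  qed
  then show ?thesis by (rule cycle_minor_vertex_minor) (rule assms(2))
qed

end
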